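(* Let $(\mathcal{G},\mu)$ be a discrete measured groupoid. The following two conditions are equivalent: 1. The groupoid $(\mathcal{G},\mu)$ is icc. 2. The center of the groupoid von Neumann algebra satisfies $\mathcal{Z}(L(\mathcal{G})) = L^\infty(\mathcal{G}^{(0)},\mu)^{\mathcal{G}}$.
   Context: A discrete Borel groupoid is a groupoid $\mathcal{G}$ that is also a standard Borel space, such that the unit space $\mathcal{G}^{(0)}$ is a Borel subset, the source and target maps $s,t:\mathcal{G}\to\mathcal{G}^{(0)}$ are countable-to-one Borel maps, and composition $(g,h)\mapsto gh$ (defined when $s(g)=t(h)$) and inversion are Borel. A discrete measured groupoid $(\mathcal{G},\mu)$ is a discrete Borel groupoid with a probability measure $\mu$ on $\mathcal{G}^{(0)}$ such that the $\sigma$-finite measures $\mu_s(A)=\int_{\mathcal{G}^{(0)}}|\{g\in A: s(g)=x\}|\,d\mu(x)$ and $\mu_t(A)=\int_{\mathcal{G}^{(0)}}|\{g\in A: t(g)=x\}|\,d\mu(x)$ on $\mathcal{G}$ are equivalent (have the same null sets). For $A,B\subset\mathcal{G}$, $A\cdot B=\{gh: g\in A,h\in B,s(g)=t(h)\}$. A bisection is a subset $A\subset\mathcal{G}$ on which both $s$ and $t$ are injective. For a Borel bisection $A$, $\lambda_A\in B(L^2(\mathcal{G},\mu_s))$ is the partial isometry determined by $\lambda_A 1_E=1_{A\cdot E}$ for Borel $E\subset\mathcal{G}$ with $\mu_s(E)<\infty$. The groupoid von Neumann algebra is $L(\mathcal{G})=\{\lambda_A: A\subset\mathcal{G}\text{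 Borel bisection}\}''$. It contains a copy of $L^\infty(\mathcal{G}^{(0)},\mu)$ (with $1_Y\mapsto\lambda_Y$ for Borel $Y\subset\mathcal{G}^{(0)}$). $L^\infty(\mathcal{G}^{(0)},\mu)^{\mathcal{G}}$ denotes the functions $f\in L^\infty(\mathcal{G}^{(0)},\mu)$ that are $\mathcal{G}$-invariant, i.e. $f(t(g))=f(s(g))$ for a.e. $g\in\mathcal{G}$. $\mathrm{Iso}(\mathcal{G})=\{g\in\mathcal{G}: s(g)=t(g)\}$. For a Borel set $A\subset\mathrm{Iso}(\mathcal{G})$, its conjugacy class is the (Borel) set $\Omega_A=\bigcup_{g\in\mathcal{G}}gAg^{-1}=\{gag^{-1}: a\in A, g\in\mathcal{G}, s(g)=t(a)\}$. $(\mathcal{G},\mu)$ is icc if every Borel bisection $A\subset\mathrm{Iso}(\mathcal{G})$ with $\mu_s(A)>0$ and $\mu_s(\Omega_A)<\infty$ is contained in $\mathcal{G}^{(0)}$ up to a $\mu_s$-null set (equivalently, the same for all non-null Borel subsets $A\subset\mathrm{Iso}(\mathcal{G})$). *)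

theory Defs
  imports "HOL-Probability.Probability"
begin

section \<open>Standard Borel spaces and discrete Borel groupoids\<close>

text \<open>Only the \<^term>\<open>space\<close> and the \<^term>\<open>sets\<close> of the argument matter.\<close>

definition standard_borel :: "'a measure \<Rightarrow> bool" where
  "standard_borel M \<longleftrightarrow>
     (\<exists>X. completely_metrizable_space X \<and> second_countable X \<and>
        space M = topspace X \<and> sets M = sigma_sets (topspace X) {U. openin X U})"

text \<open>
  The elements of the groupoid form the set \<^term>\<open>space (borel_str G)\<close>; of the measure space
  \<open>borel_str G\<close> only the \<open>\<sigma>\<close>-algebra is used. All operations are total functions whose
  values outside their domains of definition are irrelevant.
\<close>

record 'g groupoid =
  borel_str :: "'g measure"
  units :: "'g set"
  src :: "'g \<Rightarrow> 'g"
  tgt :: "'g \<Rightarrow> 'g"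
  mul :: "'g \<Rightarrow> 'g \<Rightarrow> 'g"
  ginv :: "'g \<Rightarrow> 'g"

abbreviation carr :: "'g groupoid \<Rightarrow> 'g set" where
  "carr G \<equiv> space (borel_str G)"

definition composable :: "'g groupoid \<Rightarrow> ('g \<times> 'g) set" where
  "composable G = {(g, h). g \<in> carr G \<and> h \<in> carr G \<and> src G g = tgt G h}"

definition is_groupoid :: "'g groupoid \<Rightarrow> bool" where
  "is_groupoid G \<longleftrightarrow>
     units G \<subseteq> carr G \<and>
     (\<forall>g\<in>carr G. src G g \<in> units G \<and> tgt G g \<in> units G) \<and>
     (\<forall>u\<in>units G. src G u = u \<and> tgt G u = u) \<and>
     (\<forall>(g, h)\<in>composable G.
        mul G g h \<in> carr G \<and> src G (mul G g h) = src G h \<and> tgt G (mul G g h) = tgt G g) \<and>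
     (\<forall>g h k. (g, h) \<in> composable G \<longrightarrow> (h, k) \<in> composable G \<longrightarrow>
        mul G (mul G g h) k = mul G g (mul G h k)) \<and>
     (\<forall>g\<in>carr G. mul G g (src G g) = g \<and> mul G (tgt G g) g = g) \<and>
     (\<forall>g\<in>carr G. ginv G g \<in> carr G \<and>
        src G (ginv G g) = tgt G g \<and> tgt G (ginv G g) = src G g \<and>
        mul G (ginv G g) g = src G g \<and> mul G g (ginv G g) = tgt G g)"

definition discrete_borel_groupoid :: "'g groupoid \<Rightarrow> bool" where
  "discrete_borel_groupoid G \<longleftrightarrow>
     is_groupoid G \<and>
     standard_borel (borel_str G) \<and>
     units G \<in> sets (borel_str G) \<and>
     src G \<in> borel_str G \<rightarrow>\<^sub>M restrict_space (borel_str G) (units G) \<and>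
     tgt G \<in> borel_str G \<rightarrow>\<^sub>M restrict_space (borel_str G) (units G) \<and>
     (\<forall>x\<in>units G. countable {g \<in> carr G. src G g = x} \<and> countable {g \<in> carr G. tgt G g = x}) \<and>
     (\<lambda>(g, h). mul G g h)
       \<in> restrict_space (borel_str G \<Otimes>\<^sub>M borel_str G) (composable G) \<rightarrow>\<^sub>M borel_str G \<and>
     ginv G \<in> borel_str G \<rightarrow>\<^sub>M borel_str G"

text \<open>
  Counting the fibres of a countable-to-one Borel map between standard Borel spaces is a Borel
  function (Lusin-Novikov), so on a discrete Borel groupoid the set functions below are
  measures and \<^term>\<open>measure_of\<close> does not collapse to its default value.
\<close>

definition mu_s :: "'g groupoid \<Rightarrow> 'g measure \<Rightarrow> 'g measure" where
  "mu_s G \<mu> = measure_of (carr G) (sets (borel_str G))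
     (\<lambda>A. \<integral>\<^sup>+x. emeasure (count_space UNIV) {g \<in> A. src G g = x} \<partial>\<mu>)"

definition mu_t :: "'g groupoid \<Rightarrow> 'g measure \<Rightarrow> 'g measure" where
  "mu_t G \<mu> = measure_of (carr G) (sets (borel_str G))
     (\<lambda>A. \<integral>\<^sup>+x. emeasure (count_space UNIV) {g \<in> A. tgt G g = x} \<partial>\<mu>)"

definition discrete_measured_groupoid :: "'g groupoid \<Rightarrow> 'g measure \<Rightarrow> bool" where
  "discrete_measured_groupoid G \<mu> \<longleftrightarrow>
     discrete_borel_groupoid G \<and>
     prob_space \<mu> \<and> sets \<mu> = sets (restrict_space (borel_str G) (units G)) \<and>
     null_sets (mu_s G \<mu>) = null_sets (mu_t G \<mu>)"

definition set_mul :: "'g groupoid \<Rightarrow> 'g set \<Rightarrow> 'g set \<Rightarrow> 'g set" where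
  "set_mul G A B = {mul G g h | g h. g \<in> A \<and> h \<in> B \<and> src G g = tgt G h}"

definition borel_bisection :: "'g groupoid \<Rightarrow> 'g set \<Rightarrow> bool" where
  "borel_bisection G A \<longleftrightarrow> A \<in> sets (borel_str G) \<and> inj_on (src G) A \<and> inj_on (tgt G) A"

definition Iso :: "'g groupoid \<Rightarrow> 'g set" where
  "Iso G = {g \<in> carr G. src G g = tgt G g}"

definition conj_class :: "'g groupoid \<Rightarrow> 'g set \<Rightarrow> 'g set" where
  "conj_class G A =
     {mul G (mul G g a) (ginv G g) | g a. a \<in> A \<and> g \<in> carr G \<and> src G g = tgt G a}"

definition icc :: "'g groupoid \<Rightarrow> 'g measure \<Rightarrow> bool" where
  "icc G \<mu> \<longleftrightarrow>
     (\<forall>A. borel_bisection G A \<longrightarrow> A \<subseteq> Iso G \<longrightarrow>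
        emeasure (mu_s G \<mu>) A > 0 \<longrightarrow> emeasure (mu_s G \<mu>) (conj_class G A) < \<infinity> \<longrightarrow>
        A - units G \<in> null_sets (mu_s G \<mu>))"


section \<open>The Hilbert space of square integrable functions and its bounded operators\<close>

definition sq_integrable :: "'a measure \<Rightarrow> ('a \<Rightarrow> complex) set" where
  "sq_integrable M = {f \<in> borel_measurable M. integrable M (\<lambda>x. (cmod (f x))\<^sup>2)}"

definition ae_rel :: "'a measure \<Rightarrow> (('a \<Rightarrow> complex) \<times> ('a \<Rightarrow> complex)) set" where
  "ae_rel M = {(f, g). f \<in> sq_integrable M \<and> g \<in> sq_integrable M \<and> (AE x in M. f x = g x)}"

definition L2 :: "'a measure \<Rightarrow> ('a \<Rightarrow> complex) set set" where
  "L2 M = sq_integrable M // ae_rel M"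

definition L2_class :: "'a measure \<Rightarrow> ('a \<Rightarrow> complex) \<Rightarrow> ('a \<Rightarrow> complex) set" where
  "L2_class M f = ae_rel M `` {f}"

text \<open>
  The operations on classes apply the pointwise operations to representatives. As the result
  does not depend on the representatives, the unions are over families of equal sets and the
  image in the norm is a singleton.
\<close>

definition L2_add ::
    "'a measure \<Rightarrow> ('a \<Rightarrow> complex) set \<Rightarrow> ('a \<Rightarrow> complex) set \<Rightarrow> ('a \<Rightarrow> complex) set" where
  "L2_add M \<xi> \<eta> = (\<Union>f\<in>\<xi>. \<Union>g\<in>\<eta>. L2_class M (\<lambda>x. f x + g x))"

definition L2_scale ::
    "'a measure \<Rightarrow> complex \<Rightarrow> ('a \<Rightarrow> complex) set \<Rightarrow> ('a \<Rightarrow> complex) set" where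
  "L2_scale M c \<xi> = (\<Union>f\<in>\<xi>. L2_class M (\<lambda>x. c * f x))"

definition L2_norm :: "'a measure \<Rightarrow> ('a \<Rightarrow> complex) set \<Rightarrow> real" where
  "L2_norm M \<xi> = the_elem ((\<lambda>f. sqrt (\<integral>x. (cmod (f x))\<^sup>2 \<partial>M)) ` \<xi>)"

type_synonym 'a L2_op = "('a \<Rightarrow> complex) set \<Rightarrow> ('a \<Rightarrow> complex) set"

text \<open>Operators are extensional functions, so that they are equal iff they agree on \<^term>\<open>L2 M\<close>.\<close>

definition bounded_ops :: "'a measure \<Rightarrow> 'a L2_op set" where
  "bounded_ops M = {T \<in> L2 M \<rightarrow>\<^sub>E L2 M.
     (\<forall>\<xi>\<in>L2 M. \<forall>\<eta>\<in>L2 M. T (L2_add M \<xi> \<eta>) = L2_add M (T \<xi>) (T \<eta>)) \<and>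
     (\<forall>c. \<forall>\<xi>\<in>L2 M. T (L2_scale M c \<xi>) = L2_scale M c (T \<xi>)) \<and>
     (\<exists>C. \<forall>\<xi>\<in>L2 M. L2_norm M (T \<xi>) \<le> C * L2_norm M \<xi>)}"

definition commutant :: "'a measure \<Rightarrow> 'a L2_op set \<Rightarrow> 'a L2_op set" where
  "commutant M N = {T \<in> bounded_ops M. \<forall>S\<in>N. compose (L2 M) T S = compose (L2 M) S T}"

definition center :: "'a measure \<Rightarrow> 'a L2_op set \<Rightarrow> 'a L2_op set" where
  "center M N = N \<inter> commutant M N"


section \<open>The groupoid von Neumann algebra\<close>

text \<open>
  Linear combinations of the given indicator functions are dense, so at most one bounded operator
  has the property below. There is one, given by \<open>(\<lambda>\<^sub>A \<xi>)(g) = \<xi>(a\<^sup>-\<^sup>1g)\<close> if some (necessarily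
  unique) \<open>a \<in> A\<close> has the same target as \<open>g\<close> and by \<open>0\<close> otherwise, and it is a partial isometry.
\<close>

definition lambda_op :: "'g groupoid \<Rightarrow> 'g measure \<Rightarrow> 'g set \<Rightarrow> 'g L2_op" where
  "lambda_op G \<mu> A = (THE T. T \<in> bounded_ops (mu_s G \<mu>) \<and>
     (\<forall>E\<in>sets (borel_str G). emeasure (mu_s G \<mu>) E < \<infinity> \<longrightarrow>
        T (L2_class (mu_s G \<mu>) (indicator E)) = L2_class (mu_s G \<mu>) (indicator (set_mul G A E))))"

definition groupoid_vN :: "'g groupoid \<Rightarrow> 'g measure \<Rightarrow> 'g L2_op set" where
  "groupoid_vN G \<mu> =
     commutant (mu_s G \<mu>) (commutant (mu_s G \<mu>) {lambda_op G \<mu> A | A. borel_bisection G A})"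

definition Linf :: "'a measure \<Rightarrow> ('a \<Rightarrow> complex) set" where
  "Linf \<mu> = {f \<in> borel_measurable \<mu>. \<exists>C. AE x in \<mu>. cmod (f x) \<le> C}"

text \<open>
  The embedding of \<open>L\<^sup>\<infinity>\<close> of the unit space into the groupoid von Neumann algebra that extends
  \<open>1\<^sub>Y \<mapsto> \<lambda>\<^sub>Y\<close> sends \<open>f\<close> to multiplication by \<open>f \<circ> t\<close>: for \<open>Y \<subseteq> G\<^sup>(\<^sup>0\<^sup>)\<close> one has
  \<open>Y \<cdot> E = {g \<in> E. t(g) \<in> Y}\<close>.
\<close>

definition Linf_op :: "'g groupoid \<Rightarrow> 'g measure \<Rightarrow> ('g \<Rightarrow> complex) \<Rightarrow> 'g L2_op" where
  "Linf_op G \<mu> f = (\<lambda>\<xi>\<in>L2 (mu_s G \<mu>). \<Union>h\<in>\<xi>. L2_class (mu_s G \<mu>) (\<lambda>g. f (tgt G g) * h g))"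

definition Linf_inv :: "'g groupoid \<Rightarrow> 'g measure \<Rightarrow> 'g L2_op set" where
  "Linf_inv G \<mu> =
     {Linf_op G \<mu> f | f. f \<in> Linf \<mu> \<and> (AE g in mu_s G \<mu>. f (tgt G g) = f (src G g))}"

end

theory Submission
  imports Defs
begin

text \<open>
  By the theorems of Lusin-Souslin and Lusin-Novikov, the groupoid is a countable disjoint union of
  Borel bisections. Hence \<open>\<mu>\<^sub>s\<close> is a measure, left translations by bisections act on \<open>L\<^sup>2\<close>, and so do
  right translations by the bisections with bounded Radon-Nikodym derivative; the latter commute
  with all \<open>\<lambda>\<^sub>A\<close> and cover the groupoid up to a null set.

  Suppose that \<open>(G, \<mu>)\<close> is icc. A central \<open>T\<close> commutes with left and right translations, so
  \<open>\<xi> = T 1\<close>, where \<open>1\<close> is the indicator of the unit space, satisfies \<open>\<lambda> \<xi> = \<rho> \<xi>\<close> for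
  corresponding translations. Therefore \<open>\<xi>\<close> is supported on the isotropy and invariant under
  conjugation. The sets \<open>{|\<xi>| > \<epsilon>}\<close> are conjugation invariant of finite measure, so the icc property
  confines \<open>\<xi>\<close> to the unit space, and \<open>T\<close> is multiplication by \<open>\<xi> \<circ> t\<close>.

  If icc fails, some conjugation invariant set \<open>K\<close> of isotropy elements is not null, misses the unit
  space and has at most \<open>n\<close> elements over every unit. It is a union of \<open>n\<close> bisections, and the sum of
  their \<open>\<lambda>\<close> is convolution by the indicator of \<open>K\<close>, a central operator outside \<open>L\<^sup>\<infinity>\<close>.
\<close>

section \<open>Borel maps between standard Borel spaces\<close>

text \<open>Vectors and operators are known only modulo null sets, whereas conjugation compares
  values at different arrows. The equivalence of the two measures is what bridges this: the
  saturation of a null set of units is null, so countably many almost everywhere identities hold at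
  every arrow outside one invariant null set and can then be combined pointwise. Centrality is made
  concrete algebraically: for a set S of bounded operators, the center of S'' is the intersection of
  S'' and S'. A central operator thus commutes with the left translations and with whatever commutes
  with these, in particular with right translations. Right translation moves mass between source
  fibres, which is why its derivative has to be cut off before it acts on square integrable
  functions. A cut-off is also needed in the converse: a conjugacy class of finite measure has
  finite fibres almost everywhere, but without a uniform bound. Conjugation preserves the size of a
  fibre, so keeping only the fibres with at most \<open>n\<close> elements does not destroy
  invariance, and it turns convolution into a finite sum of left translations.\<close>

abbreviation borel_of_top :: "'a topology \<Rightarrow> 'a set set" where
  "borel_of_top X \<equiv> sigma_sets (topspace X) {U. openin X U}"

text \<open>
  These covers replace the refinements of a Polish topology that turn Borel sets into clopen sets:
  closed balls of shrinking radii are such covers, and every Borel set is decided by suitable ones.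
  Sequences are only required to enter a set eventually, so that families of covers can be
  interleaved.
\<close>

definition complete_covers :: "'a topology \<Rightarrow> (nat \<Rightarrow> nat \<Rightarrow> 'a set) \<Rightarrow> bool" where
  "complete_covers X U \<longleftrightarrow> (\<forall>k i. U k i \<in> borel_of_top X) \<and> (\<forall>k. (\<Union>i. U k i) = topspace X) \<and>
     (\<forall>a x. (\<forall>k. \<forall>\<^sub>F n in sequentially. x n \<in> U k (a k)) \<longrightarrow>
        (\<exists>l. limitin X x l sequentially \<and> (\<forall>k. l \<in> U k (a k))))"

definition decides :: "(nat \<Rightarrow> nat \<Rightarrow> 'a set) \<Rightarrow> 'a set \<Rightarrow> bool" where
  "decides U C \<longleftrightarrow> (\<exists>k. \<forall>i. U k i \<subseteq> C \<or> U k i \<inter> C = {})"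

lemma complete_coversE:
  assumes "complete_covers X U" "\<forall>k. \<forall>\<^sub>F n in sequentially. x n \<in> U k (a k)"
  obtains l where "limitin X x l sequentially" "\<forall>k. l \<in> U k (a k)"
proof -
  have "\<exists>l. limitin X x l sequentially \<and> (\<forall>k. l \<in> U k (a k))"
    using assms unfolding complete_covers_def by (elim conjE) simp
  then show ?thesis using that by (elim exE conjE)
qed

lemma closedin_borel_of_top: "closedin X S \<Longrightarrow> S \<in> borel_of_top X"
proof -
  assume S: "closedin X S"
  have "topspace X - S \<in> borel_of_top X" using S by (simp add: closedin_def)
  then have "topspace X - (topspace X - S) \<in> borel_of_top X" by (rule sigma_sets.Compl)
  then show ?thesis using S closedin_subset by (metis double_diff subset_refl)
qed

text \<open>A sequence that eventually stays in one ball of each radius \<open>1 / Suc k\<close> is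
  Cauchy. Completeness supplies the limit, and closedness of the balls keeps it inside each of
  them.\<close>

lemma complete_covers_exists:
  assumes "completely_metrizable_space X" "second_countable X"
  shows "\<exists>U. complete_covers X U"
proof -
  obtain M d where "Metric_space M d" and mc: "Metric_space.mcomplete M d"
    and X: "X = Metric_space.mtopology M d"
    using assms unfolding completely_metrizable_space_def by blast
  then interpret Metric_space M d by simp
  obtain C where C: "countable C" "C \<subseteq> M" "mtopology closure_of C = M"
    using second_countable_imp_separable_space[OF assms(2)]
    unfolding separable_space_def X topspace_mtopology by blast
  define D where "D = from_nat_into C"
  define U where "U k i = (if M = {} then {} else mcball (D i) (1 / Suc k))" for k i
  have cl: "closedin mtopology (U k i)" for k i by (simp add: U_def)
  have sub: "U k i \<subseteq> M" for k i by (auto simp: U_def)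
  have cov: "(\<Union>i. U k i) = M" for k
  proof (cases "M = {}")
    case False
    have "\<exists>i. x \<in> U k i" if x: "x \<in> M" for x
    proof -
      have "x \<in> mtopology closure_of C" using C x by simp
      moreover have "0 < 1 / real (Suc k)" by simp
      ultimately obtain y where "y \<in> C" "y \<in> mball x (1 / Suc k)"
        unfolding metric_closure_of by blast
      then have y: "y \<in> C" "d x y < 1 / Suc k" by (simp_all del: of_nat_Suc)
      have "y \<in> range D"
        using y(1) C(1) unfolding D_def by (metis empty_iff range_from_nat_into)
      then obtain i where "D i = y" by auto
      then have "x \<in> U k i" using y commute[of x y] x C False by (auto simp: U_def simp del: of_nat_Suc)
      then show ?thesis ..
    qed
    then have "M \<subseteq> (\<Union>i. U k i)" by auto
    moreover have "(\<Union>i. U k i) \<subseteq> M" using sub[of k] by auto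
    ultimately show ?thesis by simp
  qed (simp add: U_def)
  have "\<exists>l. limitin X x l sequentially \<and> (\<forall>k. l \<in> U k (a k))"
    if a: "\<forall>k. \<forall>\<^sub>F n in sequentially. x n \<in> U k (a k)" for a x
  proof -
    obtain N where N: "\<And>n. n \<ge> N \<Longrightarrow> x n \<in> U 0 (a 0)"
      using a[rule_format, of 0] unfolding eventually_sequentially by auto
    then have NM: "\<And>n. n \<ge> N \<Longrightarrow> x n \<in> M" using sub by blast
    have "MCauchy (\<lambda>n. x (n + N))"
      unfolding MCauchy_def
    proof (intro conjI allI impI)
      show "range (\<lambda>n. x (n + N)) \<subseteq> M" using NM by auto
      fix e :: real assume "e > 0"
      then obtain k :: nat where k: "1 / Suc k < e / 2"
        by (meson nat_approx_posE half_gt_zero)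
      obtain K where K: "\<And>n. n \<ge> K \<Longrightarrow> x n \<in> U k (a k)"
        using a[rule_format, of k] unfolding eventually_sequentially by auto
      have "d (x (n + N)) (x (n' + N)) < e" if n: "K \<le> n" "K \<le> n'" for n n'
      proof -
        have 1: "x (n + N) \<in> U k (a k)" "x (n' + N) \<in> U k (a k)" using K n by auto
        then have "M \<noteq> {}" by (auto simp: U_def)
        with 1 have 2: "x (n + N) \<in> M" "x (n' + N) \<in> M" "D (a k) \<in> M"
          "d (D (a k)) (x (n + N)) \<le> 1 / Suc k" "d (D (a k)) (x (n' + N)) \<le> 1 / Suc k"
          by (auto simp: U_def simp del: of_nat_Suc)
        have "d (x (n + N)) (x (n' + N)) \<le> 1 / Suc k + 1 / Suc k"
          using triangle[OF 2(1) 2(3) 2(2)] 2(4,5) commute[of "x (n + N)" "D (a k)"] by linarith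
        then show ?thesis using k by linarith
      qed
      then show "\<exists>Na. \<forall>n n'. Na \<le> n \<longrightarrow> Na \<le> n' \<longrightarrow> d (x (n + N)) (x (n' + N)) < e" by blast
    qed
    then obtain l where "limitin mtopology (\<lambda>n. x (n + N)) l sequentially"
      using mc unfolding mcomplete_def by blast
    then have l: "limitin mtopology x l sequentially" by (rule limitin_sequentially_offset_rev)
    have "l \<in> U k (a k)" for k
      by (rule limitin_closedin[OF l cl]) (use a in auto)
    with l X show ?thesis by blast
  qed
  then show ?thesis
    unfolding complete_covers_def using cov closedin_borel_of_top[OF cl] X
    by (intro exI[of _ U]) (simp add: topspace_mtopology)
qed

text \<open>The old levels already provide the limit; closedness of the new cells puts it into the
  chosen one.\<close>

lemma complete_covers_Cons_closed:
  assumes "complete_covers X U" "\<And>i. closedin X (W i)" "(\<Union>i. W i) = topspace X"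
  shows "complete_covers X (case_nat W U)"
  unfolding complete_covers_def
proof (intro conjI allI impI)
  show "case_nat W U k i \<in> borel_of_top X" for k i
    using assms(1) closedin_borel_of_top[OF assms(2)] by (auto simp: complete_covers_def split: nat.split)
  show "(\<Union>i. case_nat W U k i) = topspace X" for k
    using assms by (auto simp: complete_covers_def split: nat.split)
next
  fix a and x :: "nat \<Rightarrow> 'a"
  assume a: "\<forall>k. \<forall>\<^sub>F n in sequentially. x n \<in> case_nat W U k (a k)"
  then have "\<forall>k. \<forall>\<^sub>F n in sequentially. x n \<in> U k (a (Suc k))"
    by (metis nat.case(2))
  then obtain l where l: "limitin X x l sequentially" "\<forall>k. l \<in> U k (a (Suc k))"
    by (rule complete_coversE[OF assms(1)])
  have "l \<in> W (a 0)"
    by (rule limitin_closedin[OF l(1) assms(2)]) (use a[rule_format, of 0] in auto)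
  with l show "\<exists>l. limitin X x l sequentially \<and> (\<forall>k. l \<in> case_nat W U k (a k))"
    by (auto split: nat.split)
qed

text \<open>Each family of levels yields a limit of its own, and in a Hausdorff space all these
  limits coincide.\<close>

lemma complete_covers_interleave:
  assumes "\<And>n. complete_covers X (U n)" "Hausdorff_space X"
  shows "complete_covers X (\<lambda>m. U (fst (prod_decode m)) (snd (prod_decode m)))" (is "complete_covers X ?U")
  unfolding complete_covers_def
proof (intro conjI allI impI)
  show "?U k i \<in> borel_of_top X" "(\<Union>i. ?U k i) = topspace X" for k i
    using assms by (auto simp: complete_covers_def)
next
  fix a and x :: "nat \<Rightarrow> 'a"
  assume a: "\<forall>k. \<forall>\<^sub>F n in sequentially. x n \<in> ?U k (a k)"
  have "\<exists>l. limitin X x l sequentially \<and> (\<forall>k. l \<in> U n k (a (prod_encode (n, k))))" for n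
  proof -
    have "\<forall>k. \<forall>\<^sub>F m in sequentially. x m \<in> U n k (a (prod_encode (n, k)))"
      using a by (metis fst_conv snd_conv prod_encode_inverse)
    then obtain l where "limitin X x l sequentially" "\<forall>k. l \<in> U n k (a (prod_encode (n, k)))"
      by (rule complete_coversE[OF assms(1)])
    then show ?thesis by (intro exI conjI)
  qed
  then obtain l where l: "\<And>n. limitin X x (l n) sequentially"
    "\<And>n k. l n \<in> U n k (a (prod_encode (n, k)))" by metis
  have "l n = l 0" for n
    using limitin_Hausdorff_unique[OF l(1) l(1) _ assms(2)] by simp
  then have "l 0 \<in> U n k (a (prod_encode (n, k)))" for n k using l(2) by metis
  then have "\<forall>k. l 0 \<in> ?U k (a k)"
    by (metis prod.collapse prod_decode_inverse)
  with l(1) show "\<exists>l. limitin X x l sequentially \<and> (\<forall>k. l \<in> ?U k (a k))" by blast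
qed

lemma decides_interleave:
  assumes "decides (U n) C"
  shows "decides (\<lambda>m. U (fst (prod_decode m)) (snd (prod_decode m))) C"
proof -
  obtain k where "\<forall>i. U n k i \<subseteq> C \<or> U n k i \<inter> C = {}" using assms unfolding decides_def by blast
  then show ?thesis unfolding decides_def by (intro exI[of _ "prod_encode (n, k)"]) simp
qed

text \<open>The added level consists of the sets \<open>C n\<close> and the complement of their
  union. These cells need not be closed, but the existing levels decide each \<open>C n\<close>, so
  the limit lies in \<open>C n\<close> exactly when suitable members of the sequence do, and it
  inherits the new cell from them.\<close>

lemma complete_covers_decides_Union:
  fixes C :: "nat \<Rightarrow> 'a set"
  assumes U: "complete_covers X U" and dec: "\<And>n. decides U (C n)" and C: "\<And>n. C n \<in> borel_of_top X"
  shows "\<exists>U'. complete_covers X U' \<and> decides U' (\<Union>n. C n)"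
proof -
  define W where "W = case_nat (topspace X - (\<Union>n. C n)) C"
  have Cs: "C n \<subseteq> topspace X" for n
    using sigma_sets_into_sp[OF _ C] openin_subset by blast
  have CU: "(\<Union>n. C n) \<in> borel_of_top X" using C by (rule sigma_sets.Union)
  have "complete_covers X (case_nat W U)"
    unfolding complete_covers_def
  proof (intro conjI allI impI)
    show "case_nat W U k i \<in> borel_of_top X" for k i
      using U C sigma_sets.Compl[OF CU] by (auto simp: complete_covers_def W_def split: nat.split)
    have "(\<Union>i. W i) = topspace X" 
    proof
      show "(\<Union>i. W i) \<subseteq> topspace X" using Cs by (force simp: W_def split: nat.splits)
      show "topspace X \<subseteq> (\<Union>i. W i)"
      proof
        fix y assume "y \<in> topspace X"
        then have "y \<in> W 0 \<or> (\<exists>n. y \<in> W (Suc n))" by (auto simp: W_def)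
        then show "y \<in> (\<Union>i. W i)" by blast
      qed
    qed
    then show "(\<Union>i. case_nat W U k i) = topspace X" for k
      using U by (auto simp: complete_covers_def split: nat.split)
  next
    fix a and x :: "nat \<Rightarrow> 'a"
    assume a: "\<forall>k. \<forall>\<^sub>F n in sequentially. x n \<in> case_nat W U k (a k)"
    then have a1: "\<forall>k. \<forall>\<^sub>F n in sequentially. x n \<in> U k (a (Suc k))"
      by (metis nat.case(2))
    then obtain l where l: "limitin X x l sequentially" "\<forall>k. l \<in> U k (a (Suc k))"
      by (rule complete_coversE[OF U])
    have ev: "\<forall>\<^sub>F n in sequentially. x n \<in> W (a 0)" using a[rule_format, of 0] by simp
    have iff: "\<exists>m. x m \<in> W (a 0) \<and> (x m \<in> C n \<longleftrightarrow> l \<in> C n)" for n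
    proof -
      obtain k where k: "\<forall>i. U k i \<subseteq> C n \<or> U k i \<inter> C n = {}"
        using dec[of n] unfolding decides_def by blast
      have "\<exists>m. x m \<in> U k (a (Suc k)) \<and> x m \<in> W (a 0)"
        using eventually_happens'[OF _ eventually_conj[OF a1[rule_format, of k] ev]] by auto
      then show ?thesis using k l(2) by blast
    qed
    have "l \<in> W (a 0)"
    proof (cases "a 0")
      case 0
      have "l \<notin> C n" for n using iff[of n] 0 by (auto simp: W_def)
      moreover have "l \<in> topspace X" using l(1) by (simp add: limitin_def)
      ultimately show ?thesis using 0 by (auto simp: W_def)
    next
      case (Suc n)
      then show ?thesis using iff[of n] by (auto simp: W_def)
    qed
    with l show "\<exists>l. limitin X x l sequentially \<and> (\<forall>k. l \<in> case_nat W U k (a k))"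
      by (auto split: nat.split)
  qed
  moreover have "decides (case_nat W U) (\<Union>n. C n)"
    unfolding decides_def by (intro exI[of _ 0]) (auto simp: W_def split: nat.split)
  ultimately show ?thesis by blast
qed

text \<open>Induction on the generation of Borel sets. An open set of a metrizable space is a
  countable union of closed sets, so these and its complement form a level of closed cells.\<close>

lemma complete_covers_decides_exists:
  assumes X: "completely_metrizable_space X" "second_countable X" and C: "C \<in> borel_of_top X"
  shows "\<exists>U. complete_covers X U \<and> decides U C"
proof -
  have met: "metrizable_space X" and haus: "Hausdorff_space X"
    using X(1) completely_metrizable_imp_metrizable_space metrizable_imp_Hausdorff_space by blast+
  obtain B where B: "complete_covers X B" using complete_covers_exists[OF X] by blast
  show ?thesis using C
  proof (induction rule: sigma_sets.induct)
    case (Basic S)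
    then have op: "openin X S" by simp
    then have "fsigma_in X S"
      using met by (rule open_imp_fsigma_in[rotated])
    then obtain F where F: "\<And>n::nat. closedin X (F n)" "(\<Union>n. F n) = S"
      unfolding fsigma_in_ascending by blast
    define W where "W = case_nat (topspace X - S) F"
    have W1: "closedin X (W i)" for i using F op by (auto simp: W_def split: nat.split)
    have "(\<Union>i. W i) = W 0 \<union> (\<Union>i. W (Suc i))"
      using UNIV_nat_eq by (metis UN_insert image_image)
    then have W2: "(\<Union>i. W i) = topspace X"
      using F(2) openin_subset[OF op] by (auto simp: W_def)
    have "decides (case_nat W B) S"
      unfolding decides_def using F(2) by (intro exI[of _ 0]) (auto simp: W_def split: nat.split)
    then show ?case using complete_covers_Cons_closed[OF B W1 W2] by blast
  next
    case Empty
    then show ?case using B by (auto simp: decides_def)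
  next
    case (Compl S)
    then obtain U where U: "complete_covers X U" "decides U S" by blast
    have "U k i \<subseteq> topspace X" for k i
      using U(1) unfolding complete_covers_def by blast
    then have "decides U (topspace X - S)" using U(2) unfolding decides_def by blast
    with U show ?case by blast
  next
    case (Union S)
    then obtain U where U: "\<And>n. complete_covers X (U n)" "\<And>n. decides (U n) (S n)" by metis
    show ?case
      by (rule complete_covers_decides_Union[OF complete_covers_interleave[OF U(1) haus] decides_interleave[OF U(2)] Union(1)])
  qed
qed

text \<open>The topology disappears from here on: points chosen in the finite intersections along a
  branch eventually lie in each of its cells, so their limit lies in all of them.\<close>

lemma standard_borel_covers:
  assumes M: "standard_borel M" and C: "\<And>n::nat. C n \<in> sets M"
  obtains U :: "nat \<Rightarrow> nat \<Rightarrow> 'a set"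
  where "\<And>k i. U k i \<in> sets M" "\<And>k. (\<Union>i. U k i) = space M" "\<And>n. decides U (C n)"
    "\<forall>a. (\<forall>n. (\<Inter>k\<le>n. U k (a k)) \<noteq> {}) \<longrightarrow> (\<Inter>k. U k (a k)) \<noteq> {}"
proof -
  obtain X where X: "completely_metrizable_space X" "second_countable X"
    "space M = topspace X" "sets M = borel_of_top X"
    using M unfolding standard_borel_def by blast
  have haus: "Hausdorff_space X"
    using X(1) completely_metrizable_imp_metrizable_space metrizable_imp_Hausdorff_space by blast
  have "\<forall>n. \<exists>U. complete_covers X U \<and> decides U (C n)"
    using complete_covers_decides_exists[OF X(1,2)] C X(4) by simp
  then obtain V where V: "\<And>n. complete_covers X (V n)" "\<And>n. decides (V n) (C n)" by metis
  define U where "U = (\<lambda>m. V (fst (prod_decode m)) (snd (prod_decode m)))"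
  have fU: "complete_covers X U" unfolding U_def by (rule complete_covers_interleave[OF V(1) haus])
  have dU: "decides U (C n)" for n unfolding U_def by (rule decides_interleave[OF V(2)])
  have "(\<Inter>k. U k (a k)) \<noteq> {}" if a: "\<And>n. (\<Inter>k\<le>n. U k (a k)) \<noteq> {}" for a
  proof -
    have "\<forall>n. \<exists>x. x \<in> (\<Inter>k\<le>n. U k (a k))" using a by blast
    then obtain x where x: "\<And>n. x n \<in> (\<Inter>k\<le>n. U k (a k))" by metis
    have "\<forall>k. \<forall>\<^sub>F n in sequentially. x n \<in> U k (a k)"
      unfolding eventually_sequentially using x by auto
    then obtain l where "\<forall>k. l \<in> U k (a k)" by (rule complete_coversE[OF fU])
    then show ?thesis by auto
  qed
  moreover have "U k i \<in> sets M" "(\<Union>i. U k i) = space M" for k i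
    using fU X(3,4) unfolding complete_covers_def by simp_all
  ultimately show ?thesis by (intro that[of U] dU allI impI) auto
qed

lemma standard_borel_separating:
  assumes M: "standard_borel M"
  obtains V :: "nat \<Rightarrow> 'a set"
  where "\<And>n. V n \<in> sets M"
    "\<And>x y. x \<in> space M \<Longrightarrow> y \<in> space M \<Longrightarrow> x \<noteq> y \<Longrightarrow> \<exists>n. x \<in> V n \<and> y \<notin> V n"
proof -
  obtain X where X: "completely_metrizable_space X" "second_countable X"
    "space M = topspace X" "sets M = borel_of_top X"
    using M unfolding standard_borel_def by blast
  have haus: "Hausdorff_space X"
    using X(1) completely_metrizable_imp_metrizable_space metrizable_imp_Hausdorff_space by blast
  from X(2) obtain B where "countable B \<and> (\<forall>V\<in>B. openin X V) \<and>
    (\<forall>U x. openin X U \<and> x \<in> U \<longrightarrow> (\<exists>V\<in>B. x \<in> V \<and> V \<subseteq> U))"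
    unfolding second_countable_def by (elim exE)
  then have B: "countable B" "\<forall>V\<in>B. openin X V"
    "\<forall>U x. openin X U \<and> x \<in> U \<longrightarrow> (\<exists>V\<in>B. x \<in> V \<and> V \<subseteq> U)" by simp_all
  define V where "V = from_nat_into (insert {} B)"
  have rV: "range V = insert {} B" unfolding V_def by (rule range_from_nat_into) (use B in auto)
  show ?thesis
  proof (rule that[of V])
    fix n
    have "V n \<in> insert {} B" using rV by blast
    then have "openin X (V n)" using B(2) by auto
    then show "V n \<in> sets M" using X(4) by auto
  next
    fix x y assume "x \<in> space M" "y \<in> space M" "x \<noteq> y"
    then obtain P where "openin X P" "x \<in> P" "y \<notin> P"
      using haus X(3) unfolding Hausdorff_space_def disjnt_def by (metis disjoint_iff)
    then obtain W where "W \<in> B" "x \<in> W" "y \<notin> W" using B(3) by (metis subsetD)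
    then show "\<exists>n. x \<in> V n \<and> y \<notin> V n" using rV by (metis insertI2 rangeE)
  qed
qed

text \<open>The measurable remnant of a complete metric: a branch with nonempty finite intersections
  contains a point, and each prescribed set is determined by the cells of a single level.\<close>

definition cover_system :: "'a measure \<Rightarrow> 'a set set \<Rightarrow> (nat \<Rightarrow> nat \<Rightarrow> 'a set) \<Rightarrow> bool" where
  "cover_system M \<C> U \<longleftrightarrow> (\<forall>k i. U k i \<in> sets M) \<and> (\<forall>k. (\<Union>i. U k i) = space M) \<and>
     (\<forall>C\<in>\<C>. decides U C) \<and>
     (\<forall>a. (\<forall>n. (\<Inter>k\<le>n. U k (a k)) \<noteq> {}) \<longrightarrow> (\<Inter>k. U k (a k)) \<noteq> {})"

lemma cover_systemD:
  assumes "cover_system M \<C> U"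
  shows "U k i \<in> sets M" "(\<Union>i. U k i) = space M" "C \<in> \<C> \<Longrightarrow> decides U C"
    "(\<And>n. (\<Inter>k\<le>n. U k (a k)) \<noteq> {}) \<Longrightarrow> (\<Inter>k. U k (a k)) \<noteq> {}"
  using assms by (simp_all add: cover_system_def)

lemma standard_borel_covers_countable:
  fixes M :: "'a measure"
  assumes M: "standard_borel M" and C: "countable \<C>" "\<C> \<subseteq> sets M"
  shows "\<exists>U. cover_system M \<C> U"
proof -
  define C where "C = from_nat_into (insert {} \<C>)"
  have r: "range C = insert {} \<C>" unfolding C_def by (rule range_from_nat_into) (use C in auto)
  then have Cs: "C n \<in> sets M" for n using C(2) by (metis insertE rangeI sets.empty_sets subsetD)
  show ?thesis
  proof (rule standard_borel_covers[OF M Cs])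
    fix U :: "nat \<Rightarrow> nat \<Rightarrow> 'a set" assume U: "\<And>k i. U k i \<in> sets M" "\<And>k. (\<Union>i. U k i) = space M" "\<And>n. decides U (C n)"
      "\<forall>a. (\<forall>n. (\<Inter>k\<le>n. U k (a k)) \<noteq> {}) \<longrightarrow> (\<Inter>k. U k (a k)) \<noteq> {}"
    have "decides U D" if "D \<in> \<C>" for D
    proof -
      have "D \<in> range C" using r that by simp
      then show ?thesis using U(3) by auto
    qed
    then have "cover_system M \<C> U" unfolding cover_system_def using U(1,2,4) by simp
    then show "\<exists>U. cover_system M \<C> U" by blast
  qed
qed

section \<open>Separation of images and the Lusin-Souslin theorem\<close>

lemma refine_all:
  assumes "finite J" "Q c" "\<And>c i. Q c \<Longrightarrow> i \<in> J \<Longrightarrow> \<exists>n::nat. Q (c(i := c i \<inter> U n))"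
  shows "\<exists>a. Q (\<lambda>i. if i \<in> J then c i \<inter> U (a i) else c i)"
  using assms(1,3)
proof (induction J rule: finite_induct)
  case empty
  then show ?case using assms(2) by simp
next
  case (insert j J)
  then obtain a where a: "Q (\<lambda>i. if i \<in> J then c i \<inter> U (a i) else c i)" by blast
  then obtain n where
    "Q ((\<lambda>i. if i \<in> J then c i \<inter> U (a i) else c i)
         (j := (if j \<in> J then c j \<inter> U (a j) else c j) \<inter> U n))"
    using insert.prems[of "\<lambda>i. if i \<in> J then c i \<inter> U (a i) else c i" j] by blast
  moreover have "(\<lambda>i. if i \<in> J then c i \<inter> U (a i) else c i)
         (j := (if j \<in> J then c j \<inter> U (a j) else c j) \<inter> U n) =
     (\<lambda>i. if i \<in> insert j J then c i \<inter> U ((a(j := n)) i) else c i)"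
    using insert.hyps by (intro ext) auto
  ultimately show ?case by metis
qed

text \<open>\<open>Q\<close> stands for the failure of a countable decomposition, which always
  survives in some cell of a cover. Choosing a cell for every index at every level gives one branch
  per index, with \<open>Q\<close> valid at all finite stages.\<close>

lemma refine_sequence:
  assumes I: "finite I" and Qc: "Q c"
    and step: "\<And>b k i. Q b \<Longrightarrow> i \<in> I \<Longrightarrow> \<exists>n::nat. Q (b(i := b i \<inter> U k n))"
  shows "\<exists>a. \<forall>n::nat. Q (\<lambda>i. if i \<in> I then c i \<inter> (\<Inter>k<n. U k (a k i)) else c i)"
proof -
  have "\<exists>a. Q b \<longrightarrow> Q (\<lambda>i. if i \<in> I then b i \<inter> U k (a i) else b i)" for b k
    using refine_all[OF I, where Q = Q and c = b and U = "U k"] step by meson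
  then obtain h where h: "\<And>b k. Q b \<Longrightarrow> Q (\<lambda>i. if i \<in> I then b i \<inter> U k (h b k i) else b i)"
    by metis
  define s where "s = rec_nat c (\<lambda>k b i. if i \<in> I then b i \<inter> U k (h b k i) else b i)"
  have s0: "s 0 = c" and sS: "s (Suc n) = (\<lambda>i. if i \<in> I then s n i \<inter> U n (h (s n) n i) else s n i)" for n
    unfolding s_def by simp_all
  have "Q (s n) \<and> s n = (\<lambda>i. if i \<in> I then c i \<inter> (\<Inter>k<n. U k (h (s k) k i)) else c i)" for n
  proof (induction n)
    case 0
    then show ?case using Qc by (auto simp: s0 fun_eq_iff)
  next
    case (Suc n)
    then have "Q (s (Suc n))" unfolding sS using h by blast
    moreover have "s (Suc n) i = (if i \<in> I then c i \<inter> (\<Inter>k<Suc n. U k (h (s k) k i)) else c i)" for i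
    proof -
      have "s n i = (if i \<in> I then c i \<inter> (\<Inter>k<n. U k (h (s k) k i)) else c i)" using Suc by metis
      then show ?thesis unfolding sS by (auto simp: lessThan_Suc)
    qed
    ultimately show ?case by blast
  qed
  then have "\<forall>n. Q (\<lambda>i. if i \<in> I then c i \<inter> (\<Inter>k<n. U k (h (s k) k i)) else c i)" by metis
  then show ?thesis by (intro exI[of _ "\<lambda>k. h (s k) k"])
qed

text \<open>\<open>V\<close> does the work of a countable base of a Hausdorff topology on the
  target.\<close>

locale separated_map =
  fixes M :: "'a measure" and N :: "'b measure" and f :: "'a \<Rightarrow> 'b" and V :: "nat \<Rightarrow> 'b set"
  assumes M: "standard_borel M" and f[measurable]: "f \<in> M \<rightarrow>\<^sub>M N"
    and V[measurable]: "\<And>n. V n \<in> sets N"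
    and V_sep: "\<And>x y. x \<in> space N \<Longrightarrow> y \<in> space N \<Longrightarrow> x \<noteq> y \<Longrightarrow> \<exists>n. x \<in> V n \<and> y \<notin> V n"
begin

text \<open>Borel hulls of the images without a common point. For two indices this is the usual
  separation of disjoint sets by a Borel set.\<close>

definition separable :: "'i set \<Rightarrow> ('i \<Rightarrow> 'a set) \<Rightarrow> bool" where
  "separable I c \<longleftrightarrow> (\<exists>E. (\<forall>i\<in>I. E i \<in> sets N \<and> f ` c i \<subseteq> E i) \<and> (\<Inter>i\<in>I. E i) = {})"

text \<open>If all refinements were separable, the union of the hulls of the refined member and the
  intersections of the hulls of the other members would separate the original family.\<close>

lemma separable_refine:
  assumes "\<not> separable I c" "i \<in> I" "c i \<subseteq> (\<Union>n::nat. U n)"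
  shows "\<exists>n. \<not> separable I (c(i := c i \<inter> U n))"
proof (rule ccontr)
  assume "\<not> ?thesis"
  then have "\<forall>n. \<exists>E. (\<forall>j\<in>I. E j \<in> sets N \<and> f ` (c(i := c i \<inter> U n)) j \<subseteq> E j) \<and> (\<Inter>j\<in>I. E j) = {}"
    unfolding separable_def by simp
  then obtain E where E: "\<And>n j. j \<in> I \<Longrightarrow> E n j \<in> sets N"
      "\<And>n j. j \<in> I \<Longrightarrow> f ` (c(i := c i \<inter> U n)) j \<subseteq> E n j" "\<And>n. (\<Inter>j\<in>I. E n j) = {}"
    by metis
  define E' where "E' j = (if j = i then (\<Union>n. E n i) else (\<Inter>n. E n j))" for j
  have "E' j \<in> sets N" if "j \<in> I" for j
    using E(1) that assms(2) by (auto simp: E'_def)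
  moreover have "f ` c j \<subseteq> E' j" if j: "j \<in> I" for j
  proof (cases "j = i")
    case True
    have "f x \<in> (\<Union>n. E n i)" if x: "x \<in> c i" for x
    proof -
      obtain n where "x \<in> U n" using assms(3) x by blast
      then have "f x \<in> E n i" using E(2)[OF assms(2), of n] x by auto
      then show ?thesis by blast
    qed
    then show ?thesis using True by (auto simp: E'_def)
  next
    case False
    then show ?thesis using E(2)[OF j] by (auto simp: E'_def)
  qed
  moreover have "(\<Inter>j\<in>I. E' j) = {}"
  proof (rule ccontr)
    assume "(\<Inter>j\<in>I. E' j) \<noteq> {}"
    then obtain y where y: "\<And>j. j \<in> I \<Longrightarrow> y \<in> E' j" by blast
    then obtain n where n: "y \<in> E n i" using y[OF assms(2)] by (auto simp: E'_def)
    have "y \<in> E n j" if "j \<in> I" for j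
      using y[OF that] n by (auto simp: E'_def split: if_splits)
    then show False using E(3)[of n] by auto
  qed
  ultimately have "separable I c" unfolding separable_def by (intro exI[of _ E']) simp
  then show False using assms(1) by simp
qed

text \<open>A family that is not separable can be refined forever, which leaves a point
  \<open>x i\<close> of \<open>c i\<close> on a branch for each index. The images of these points do
  not all coincide, so some \<open>V n\<close> tells two of them apart. At the level deciding its
  preimage, \<open>V n\<close> and its complement are hulls for the two indices, and the refined
  family is separable after all.\<close>

lemma novikov_separation:
  assumes I: "finite I" "I \<noteq> {}" and c: "\<And>i. i \<in> I \<Longrightarrow> c i \<in> sets M"
    and empty: "(\<Inter>i\<in>I. f ` c i) = {}"
  shows "separable I c"
proof (rule ccontr)
  assume bad: "\<not> separable I c"
  define W where "W n = f -` V n \<inter> space M" for n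
  have "countable (c ` I \<union> range W)" using I(1) by (simp add: countable_finite)
  moreover have "c ` I \<union> range W \<subseteq> sets M" using c by (auto simp: W_def)
  ultimately obtain U where "cover_system M (c ` I \<union> range W) U"
    using standard_borel_covers_countable[OF M] by blast
  note U = cover_systemD[OF this]
  have csp: "c i \<subseteq> space M" if "i \<in> I" for i using c[OF that] sets.sets_into_space by blast
  define Q where "Q b \<longleftrightarrow> \<not> separable I b \<and> (\<forall>i\<in>I. b i \<subseteq> space M)" for b
  have Qc: "Q c" using bad csp by (simp add: Q_def)
  have step: "\<exists>n. Q (b(i := b i \<inter> U k n))" if b: "Q b" and i: "i \<in> I" for b k i
  proof -
    have "b i \<subseteq> (\<Union>n. U k n)" using b i U(2) by (simp add: Q_def)
    then show ?thesis using separable_refine[of I b i "U k"] b i unfolding Q_def by auto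
  qed
  have "\<exists>a. \<forall>n. Q (\<lambda>i. if i \<in> I then c i \<inter> (\<Inter>k<n. U k (a k i)) else c i)"
    by (rule refine_sequence[where Q = Q, OF I(1) Qc step])
  then obtain a
    where a: "\<And>n. Q (\<lambda>i. if i \<in> I then c i \<inter> (\<Inter>k<n. U k (a k i)) else c i)" by blast
  define s where "s n i = (if i \<in> I then c i \<inter> (\<Inter>k<n. U k (a k i)) else c i)" for n i
  have s: "Q (s n)" for n using a unfolding s_def .
  have s_eq: "s n i = c i \<inter> (\<Inter>k<n. U k (a k i))" if "i \<in> I" for n i
    using that by (simp add: s_def)
  \<comment> \<open>An empty member would admit the empty hull and make the family
    separable.\<close>
  have nonempty: "s n i \<noteq> {}" if "i \<in> I" for n i
  proof
    assume e: "s n i = {}"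
    have "separable I (s n)" unfolding separable_def
    proof (intro exI[of _ "\<lambda>j. if j = i then {} else space N"] conjI ballI)
      show "f ` s n j \<subseteq> (if j = i then {} else space N)" if "j \<in> I" for j
      proof -
        have "s n j \<subseteq> space M" using s[of n] that by (simp add: Q_def)
        then show ?thesis using e measurable_space[OF f] by auto
      qed
    qed (use \<open>i \<in> I\<close> in auto)
    then show False using s by (simp add: Q_def)
  qed
  have "\<exists>x. x \<in> (\<Inter>k. U k (a k i))" if i: "i \<in> I" for i
  proof -
    have "(\<Inter>k\<le>n. U k (a k i)) \<noteq> {}" for n
      using nonempty[OF i, of "Suc n"] unfolding s_eq[OF i] by (auto simp: lessThan_Suc_atMost)
    from U(4)[OF this] show ?thesis by blast
  qed
  then obtain x where x: "\<And>i k. i \<in> I \<Longrightarrow> x i \<in> U k (a k i)" by (metis INT_iff UNIV_I)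
  have xc: "x i \<in> c i" if i: "i \<in> I" for i
  proof -
    have "decides U (c i)" using U(3) i by blast
    then obtain k where k: "U k (a k i) \<subseteq> c i \<or> U k (a k i) \<inter> c i = {}"
      unfolding decides_def by blast
    have "c i \<inter> U k (a k i) \<noteq> {}" using nonempty[OF i, of "Suc k"] unfolding s_eq[OF i] by auto
    then show ?thesis using k x[OF i] by blast
  qed
  have xM: "x i \<in> space M" if "i \<in> I" for i using xc csp that by blast
  obtain i0 where i0: "i0 \<in> I" using I by blast
  have "\<exists>j\<in>I. f (x j) \<noteq> f (x i0)"
  proof (rule ccontr)
    assume "\<not> ?thesis"
    then have "f (x i0) \<in> (\<Inter>i\<in>I. f ` c i)" using xc by (metis INT_I imageI)
    then show False using empty by simp
  qed
  then obtain j where j: "j \<in> I" "f (x j) \<noteq> f (x i0)" by blast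
  then obtain n where n: "f (x j) \<in> V n" "f (x i0) \<notin> V n"
    using V_sep[of "f (x j)" "f (x i0)"] measurable_space[OF f] xM i0 by metis
  have "decides U (W n)" using U(3) by blast
  then obtain k where k: "\<And>i. U k i \<subseteq> W n \<or> U k i \<inter> W n = {}" unfolding decides_def by blast
  have k1: "U k (a k j) \<subseteq> W n" using k[of "a k j"] x[OF j(1), of k] n xM[OF j(1)] by (auto simp: W_def)
  have k2: "U k (a k i0) \<inter> W n = {}" using k[of "a k i0"] x[OF i0, of k] n by (auto simp: W_def)
  have "separable I (s (Suc k))" unfolding separable_def
  proof (intro exI[of _ "\<lambda>i. if i = j then V n else if i = i0 then space N - V n else space N"]
      conjI ballI)
    show "f ` s (Suc k) i \<subseteq> (if i = j then V n else if i = i0 then space N - V n else space N)"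
      if i: "i \<in> I" for i
    proof -
      have "s (Suc k) i \<subseteq> space M" using s[of "Suc k"] i by (simp add: Q_def)
      moreover have "s (Suc k) i \<subseteq> U k (a k i)" unfolding s_eq[OF i] by auto
      ultimately show ?thesis using k1 k2 measurable_space[OF f] by (auto simp: W_def)
    qed
    have "i0 \<noteq> j" using j by auto
    then show "(\<Inter>i\<in>I. if i = j then V n else if i = i0 then space N - V n else space N) = {}"
      using i0 j(1) by force
  qed auto
  then show False using s by (simp add: Q_def)
qed

text \<open>By injectivity, cells without a common point in \<open>A\<close> have traces on
  \<open>A\<close> whose images have no common point, so \<open>novikov_separation\<close> provides
  Borel hulls. There are only countably many finite choices of cells, so the hulls belonging to one
  cell can be intersected.\<close>

lemma lusin_souslin:
  assumes A: "A \<in> sets M" and inj: "inj_on f A"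
  shows "f ` A \<in> sets N"
proof -
  define W where "W n = f -` V n \<inter> space M" for n
  have "countable (insert A (range W))" by simp
  moreover have "insert A (range W) \<subseteq> sets M" using A by (auto simp: W_def)
  ultimately obtain U where "cover_system M (insert A (range W)) U"
    using standard_borel_covers_countable[OF M] by blast
  note U = cover_systemD[OF this]
  have Asp: "A \<subseteq> space M" using A sets.sets_into_space by blast
  \<comment> \<open>\<open>s ! k\<close> picks a cell at level \<open>k\<close>. The empty list is
    excluded because an intersection over no index is everything, so nothing could be
    separated.\<close>
  define void where "void s \<longleftrightarrow> s \<noteq> [] \<and> A \<inter> (\<Inter>k<length s. U k (s ! k)) = {}" for s :: "nat list"
  have "\<exists>E. (\<forall>k<length s. E k \<in> sets N \<and> f ` (A \<inter> U k (s ! k)) \<subseteq> E k) \<and> (\<Inter>k<length s. E k) = {}"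
    if s: "void s" for s
  proof -
    have "separable {..<length s} (\<lambda>k. A \<inter> U k (s ! k))"
    proof (rule novikov_separation)
      show "{..<length s} \<noteq> {}" using s by (simp add: void_def lessThan_empty_iff)
      show "(\<Inter>k\<in>{..<length s}. f ` (A \<inter> U k (s ! k))) = {}"
      proof (rule ccontr)
        assume "\<not> ?thesis"
        then obtain y where y: "\<And>k. k < length s \<Longrightarrow> y \<in> f ` (A \<inter> U k (s ! k))" by auto
        have "0 < length s" using s by (simp add: void_def)
        from y[OF this] obtain x where x: "x \<in> A" "f x = y" by auto
        have "x \<in> U k (s ! k)" if "k < length s" for k
          using y[OF that] x inj by (auto dest: inj_onD)
        then show False using s x by (auto simp: void_def)
      qed
    qed (use A U(1) in auto)
    then show ?thesis unfolding separable_def by auto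
  qed
  then obtain E where E: "\<And>s k. void s \<Longrightarrow> k < length s \<Longrightarrow> E s k \<in> sets N"
    "\<And>s k. void s \<Longrightarrow> k < length s \<Longrightarrow> f ` (A \<inter> U k (s ! k)) \<subseteq> E s k"
    "\<And>s. void s \<Longrightarrow> (\<Inter>k<length s. E s k) = {}" by metis
  \<comment> \<open>\<open>B k j\<close> is a Borel hull of \<open>f ` (A \<inter> U k j)\<close>, so small that the hulls of a tuple of sets meet
    only if the sets meet in \<open>A\<close>. A point of all \<open>\<Union>j. B k j\<close> therefore selects a branch of the covers,
    and the branch contains a point of \<open>A\<close>.\<close>
  define B where "B k j = {y \<in> space N. (\<forall>s. void s \<and> k < length s \<and> s ! k = j \<longrightarrow> y \<in> E s k) \<and>
     (\<forall>n. U k j \<inter> W n = {} \<longrightarrow> y \<notin> V n)}" for k j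
  have Bm: "B k j \<in> sets N" for k j
  proof -
    have 1: "{y \<in> space N. void s \<and> k < length s \<and> s ! k = j \<longrightarrow> y \<in> E s k} \<in> sets N" for s
      by (cases "void s \<and> k < length s \<and> s ! k = j") (use E(1)[of s k] sets.Int_space_eq1 in \<open>auto simp: Int_def[symmetric]\<close>)
    have 2: "{y \<in> space N. U k j \<inter> W n = {} \<longrightarrow> y \<notin> V n} \<in> sets N" for n
      by (cases "U k j \<inter> W n = {}") auto
    show ?thesis unfolding B_def
      by (intro sets.sets_Collect_conj sets.sets_Collect_countable_All 1 2)
  qed
  have "f ` A = (\<Inter>k. \<Union>j. B k j)"
  proof (intro equalityI subsetI)
    fix y assume "y \<in> f ` A"
    then obtain x where x: "x \<in> A" "y = f x" by blast
    have "\<exists>j. y \<in> B k j" for k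
    proof -
      obtain j where j: "x \<in> U k j" using U(2)[of k] x Asp by blast
      have "y \<in> space N" using x Asp measurable_space[OF f] by blast
      moreover have "y \<in> E s k" if "void s" "k < length s" "s ! k = j" for s
        using E(2)[OF that(1,2)] that(3) x j by auto
      moreover have "y \<notin> V n" if "U k j \<inter> W n = {}" for n
        using that j x Asp by (auto simp: W_def)
      ultimately show ?thesis unfolding B_def by blast
    qed
    then show "y \<in> (\<Inter>k. \<Union>j. B k j)" by blast
  next
    fix y assume "y \<in> (\<Inter>k. \<Union>j. B k j)"
    then have "\<forall>k. \<exists>j. y \<in> B k j" by blast
    then obtain a where a: "\<And>k. y \<in> B k (a k)" by metis
    have ne: "A \<inter> (\<Inter>k\<le>n. U k (a k)) \<noteq> {}" for n
    proof
      assume e: "A \<inter> (\<Inter>k\<le>n. U k (a k)) = {}"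
      define s where "s = map a [0..<Suc n]"
      have [simp]: "length s = Suc n" "\<And>k. k < Suc n \<Longrightarrow> s ! k = a k"
        by (auto simp: s_def simp del: upt_Suc)
      have "s \<noteq> []" by (metis \<open>length s = Suc n\<close> list.size(3) nat.distinct(1))
      moreover have "(\<Inter>k<length s. U k (s ! k)) = (\<Inter>k\<le>n. U k (a k))"
        by (simp add: lessThan_Suc_atMost)
      ultimately have v: "void s" using e by (simp add: void_def)
      have "y \<in> E s k" if "k < length s" for k
        using a[of k] v that unfolding B_def by auto
      then show False using E(3)[OF v] by blast
    qed
    then have "(\<Inter>k\<le>n. U k (a k)) \<noteq> {}" for n by blast
    from U(4)[OF this] obtain x where x: "\<And>k. x \<in> U k (a k)" by auto
    have xA: "x \<in> A"
    proof -
      have "decides U A" using U(3) by blast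
      then obtain k where k: "U k (a k) \<subseteq> A \<or> U k (a k) \<inter> A = {}" unfolding decides_def by blast
      then show ?thesis using ne[of k] x[of k] by blast
    qed
    \<comment> \<open>The second condition in \<open>B\<close> ties the point found on the branch to
      \<open>y\<close>: a cell of the branch that misses \<open>W n\<close> excludes
      \<open>y\<close> from \<open>V n\<close>.\<close>
    have "f x = y"
    proof (rule ccontr)
      assume neq: "f x \<noteq> y"
      have "y \<in> space N" using a by (auto simp: B_def)
      moreover have "f x \<in> space N" using xA Asp measurable_space[OF f] by blast
      ultimately obtain n where n: "y \<in> V n" "f x \<notin> V n" using V_sep neq by metis
      have "decides U (W n)" using U(3) by blast
      then obtain k where "U k (a k) \<subseteq> W n \<or> U k (a k) \<inter> W n = {}" unfolding decides_def by blast
      then have "U k (a k) \<inter> W n = {}" using x[of k] n by (auto simp: W_def)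
      then show False using a[of k] n by (auto simp: B_def)
    qed
    then show "y \<in> f ` A" using xA by blast
  qed
  moreover have "(\<Inter>k. \<Union>j. B k j) \<in> sets N" using Bm by blast
  ultimately show ?thesis by simp
qed

text \<open>
  A family that is not small stays so after refining one member along a countable cover or
  splitting it by a suitable Borel set. Iterating this along the binary tree produces uncountably
  many points with the same image.
\<close>

definition small :: "'i set \<Rightarrow> ('i \<Rightarrow> 'a set) \<Rightarrow> bool" where
  "small I c \<longleftrightarrow> (\<exists>F. countable F \<and> (\<forall>B\<in>F. B \<in> sets M \<and> inj_on f B) \<and>
     (\<Inter>i\<in>I. f ` (c i - \<Union>F)) = {})"

lemma small_refine:
  assumes "\<not> small I c" "i \<in> I" "c i \<subseteq> (\<Union>n::nat. U n)"
  shows "\<exists>n. \<not> small I (c(i := c i \<inter> U n))"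
proof (rule ccontr)
  assume "\<not> ?thesis"
  then have "\<forall>n. \<exists>F. countable F \<and> (\<forall>B\<in>F. B \<in> sets M \<and> inj_on f B) \<and>
     (\<Inter>j\<in>I. f ` ((c(i := c i \<inter> U n)) j - \<Union>F)) = {}"
    unfolding small_def by simp
  then obtain F where F: "\<And>n. countable (F n)" "\<And>n. \<forall>B\<in>F n. B \<in> sets M \<and> inj_on f B"
    "\<And>n. (\<Inter>j\<in>I. f ` ((c(i := c i \<inter> U n)) j - \<Union>(F n))) = {}" by metis
  define F' where "F' = (\<Union>n. F n)"
  have "(\<Inter>j\<in>I. f ` (c j - \<Union>F')) = {}"
  proof (rule ccontr)
    assume "(\<Inter>j\<in>I. f ` (c j - \<Union>F')) \<noteq> {}"
    then obtain y where y: "\<And>j. j \<in> I \<Longrightarrow> y \<in> f ` (c j - \<Union>F')" by blast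
    from y[OF assms(2)] obtain x where x: "x \<in> c i" "x \<notin> \<Union>F'" "y = f x" by blast
    then obtain n where n: "x \<in> U n" using assms(3) by blast
    have "y \<in> f ` ((c(i := c i \<inter> U n)) j - \<Union>(F n))" if "j \<in> I" for j
    proof (cases "j = i")
      case True
      then show ?thesis using x n by (auto simp: F'_def)
    next
      case False
      then show ?thesis using y[OF that] by (auto simp: F'_def)
    qed
    then show False using F(3)[of n] by blast
  qed
  moreover have "countable F'" using F(1) by (simp add: F'_def)
  moreover have "\<forall>B\<in>F'. B \<in> sets M \<and> inj_on f B" using F(2) by (auto simp: F'_def)
  ultimately have "small I c" unfolding small_def by blast
  then show False using assms(1) by simp
qed

text \<open>Otherwise the families witnessing smallness of all splittings merge into one countable
  family \<open>F'\<close>. Off \<open>F'\<close> the split families have no common image point, so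
  \<open>novikov_separation\<close> yields Borel hulls, and these cut out one further Borel set on
  which \<open>f\<close> is injective; adding it makes \<open>c\<close> small.\<close>

lemma small_split:
  fixes D :: "nat \<Rightarrow> 'a set"
  assumes bad: "\<not> small I c" and I: "finite I" "i \<in> I" "i0 \<notin> I" "i1 \<notin> I" "i0 \<noteq> i1"
    and c: "\<And>j. j \<in> I \<Longrightarrow> c j \<in> sets M" and D: "\<And>n. D n \<in> sets M"
    and D_sep: "\<And>x y. x \<in> space M \<Longrightarrow> y \<in> space M \<Longrightarrow> x \<noteq> y \<Longrightarrow> \<exists>n. x \<in> D n \<and> y \<notin> D n"
  shows "\<exists>n. \<not> small (insert i0 (insert i1 (I - {i}))) (c(i0 := c i \<inter> D n, i1 := c i - D n))"
proof (rule ccontr)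
  define J where "J = insert i0 (insert i1 (I - {i}))"
  define c' where "c' n = c(i0 := c i \<inter> D n, i1 := c i - D n)" for n
  assume "\<not> ?thesis"
  then have "\<forall>n. small J (c' n)" by (simp add: J_def c'_def)
  then obtain F where F: "\<And>n. countable (F n)" "\<And>n. \<forall>B\<in>F n. B \<in> sets M \<and> inj_on f B"
    "\<And>n. (\<Inter>j\<in>J. f ` (c' n j - \<Union>(F n))) = {}" unfolding small_def by metis
  define F' where "F' = (\<Union>n. F n)"
  have F'c: "countable F'" and F'm: "\<forall>B\<in>F'. B \<in> sets M \<and> inj_on f B"
    using F(1,2) by (auto simp: F'_def)
  have UF: "\<Union>F' \<in> sets M" using F'c F'm by (intro sets.countable_Union) auto
  have JI: "c' n j = c j" if "j \<in> I" for n j using I that by (auto simp: c'_def)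
  have "separable J (\<lambda>j. c' n j - \<Union>F')" for n
  proof (rule novikov_separation)
    show "finite J" "J \<noteq> {}" using I(1) by (auto simp: J_def)
    show "c' n j - \<Union>F' \<in> sets M" if "j \<in> J" for j
      using that c D I UF by (auto simp: J_def c'_def)
    have "(\<Inter>j\<in>J. f ` (c' n j - \<Union>F')) \<subseteq> (\<Inter>j\<in>J. f ` (c' n j - \<Union>(F n)))"
      by (intro INT_anti_mono image_mono) (auto simp: F'_def)
    then show "(\<Inter>j\<in>J. f ` (c' n j - \<Union>F')) = {}" by (simp only: F(3) subset_empty)
  qed
  then have "\<forall>n. \<exists>E. (\<forall>j\<in>J. E j \<in> sets N \<and> f ` (c' n j - \<Union>F') \<subseteq> E j) \<and> (\<Inter>j\<in>J. E j) = {}"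
    unfolding separable_def by simp
  then obtain E where "\<forall>n. (\<forall>j\<in>J. E n j \<in> sets N \<and> f ` (c' n j - \<Union>F') \<subseteq> E n j) \<and> (\<Inter>j\<in>J. E n j) = {}"
    by (rule choice[THEN exE])
  then have E: "\<And>n j. j \<in> J \<Longrightarrow> E n j \<in> sets N"
    "\<And>n j. j \<in> J \<Longrightarrow> f ` (c' n j - \<Union>F') \<subseteq> E n j" "\<And>n. (\<Inter>j\<in>J. E n j) = {}"
    by simp_all
  \<comment> \<open>If no splitting of \<open>c i\<close> works, every common image point has a single preimage in \<open>c i - \<Union>F'\<close>,
    so \<open>f\<close> is injective on \<open>B\<close>.\<close>
  define B where "B = {x \<in> space M. x \<in> c i - \<Union>F' \<and> (\<forall>n. \<forall>j\<in>I - {i}. f x \<in> E n j)}"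
  have "{x \<in> space M. f x \<in> E n j} \<in> sets M" if "j \<in> I - {i}" for n j
    using measurable_sets[OF f E(1)[of j n]] that by (auto simp: J_def vimage_def Int_def conj_commute)
  moreover have "{x \<in> space M. x \<in> c i - \<Union>F'} \<in> sets M"
  proof -
    have "{x \<in> space M. x \<in> c i - \<Union>F'} = c i - \<Union>F'"
      using sets.sets_into_space[OF c[OF I(2)]] by blast
    then show ?thesis using c[OF I(2)] UF by simp
  qed
  ultimately have "B \<in> sets M" unfolding B_def
    using I(1) by (intro sets.sets_Collect_conj sets.sets_Collect_countable_All
       sets.sets_Collect_finite_All) auto
  \<comment> \<open>Two points of \<open>B\<close> with the same image are told apart by some
    \<open>D n\<close>. One lies in each half of \<open>c i\<close>, so their image lies in all
    hulls \<open>E n j\<close>, which have no common point.\<close>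
  moreover have "inj_on f B"
  proof (rule inj_onI, rule ccontr)
    fix x y assume xy: "x \<in> B" "y \<in> B" "f x = f y" "x \<noteq> y"
    then obtain n where n: "x \<in> D n" "y \<notin> D n" using D_sep unfolding B_def by blast
    have "f x \<in> E n j" if jJ: "j \<in> J" for j
    proof -
      consider "j = i0" | "j = i1" | "j \<in> I - {i}" using jJ by (auto simp: J_def)
      then show ?thesis
      proof cases
        case 1
        then have "x \<in> c' n j - \<Union>F'" using xy n I by (auto simp: B_def c'_def)
        then show ?thesis using E(2)[OF jJ] by blast
      next
        case 2
        then have "y \<in> c' n j - \<Union>F'" using xy n I by (auto simp: B_def c'_def)
        then show ?thesis using E(2)[OF jJ] xy(3) by (metis image_subset_iff)
      next
        case 3
        then show ?thesis using xy by (auto simp: B_def)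
      qed
    qed
    then have "f x \<in> (\<Inter>j\<in>J. E n j)" by (rule INT_I)
    then show False using E(3)[of n] by simp
  qed
  ultimately have "\<forall>B\<in>insert B F'. B \<in> sets M \<and> inj_on f B" using F'm by simp
  moreover have "(\<Inter>j\<in>I. f ` (c j - \<Union>(insert B F'))) = {}"
  proof (rule ccontr)
    assume "(\<Inter>j\<in>I. f ` (c j - \<Union>(insert B F'))) \<noteq> {}"
    then obtain y where "y \<in> (\<Inter>j\<in>I. f ` (c j - \<Union>(insert B F')))" by (auto simp only: ex_in_conv[symmetric])
    then have y: "\<And>j. j \<in> I \<Longrightarrow> y \<in> f ` (c j - \<Union>(insert B F'))" by (rule INT_D)
    from y[OF I(2)] obtain x where x: "x \<in> c i" "x \<notin> \<Union>F'" "x \<notin> B" "y = f x" by blast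
    have "f x \<in> E n j" if j: "j \<in> I - {i}" for n j
    proof -
      have "f x \<in> f ` (c' n j - \<Union>F')" using y[of j] j x JI by auto
      then show ?thesis using E(2)[of j n] j by (auto simp: J_def)
    qed
    moreover have "x \<in> space M" using x(1) c[OF I(2)] sets.sets_into_space by blast
    ultimately have "x \<in> B" using x by (auto simp: B_def)
    then show False using x by simp
  qed
  moreover have "countable (insert B F')" using F'c by simp
  ultimately have "small I c" unfolding small_def by blast
  then show False using bad by simp
qed

lemma small_cong: "(\<And>i. i \<in> I \<Longrightarrow> c i = c' i) \<Longrightarrow> small I c = small I c'"
  unfolding small_def by (intro ex_cong1 conj_cong refl arg_cong[where f = "\<lambda>A. A = {}"] INF_cong) auto

section \<open>The binary tree of splittings and the Lusin-Novikov theorem\<close>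

definition level :: "nat \<Rightarrow> bool list set" where
  "level k = {l. length l = k}"

lemma finite_level: "finite (level k)"
  using finite_lists_length_eq[of "UNIV :: bool set" k] by (simp add: level_def)

text \<open>Nodes are split one at a time, each step being an instance of
  \<open>small_split\<close>; the set of \<open>D\<close> that splits a node may depend on the
  node.\<close>

lemma small_split_level:
  fixes D :: "nat \<Rightarrow> 'a set" and c :: "bool list \<Rightarrow> 'a set"
  assumes bad: "\<not> small (level k) c" and c: "\<And>l. l \<in> level k \<Longrightarrow> c l \<in> sets M"
    and D: "\<And>n. D n \<in> sets M"
    and D_sep: "\<And>x y. x \<in> space M \<Longrightarrow> y \<in> space M \<Longrightarrow> x \<noteq> y \<Longrightarrow> \<exists>n. x \<in> D n \<and> y \<notin> D n"
  shows "\<exists>n. \<not> small (level (Suc k)) (\<lambda>m. if last m then c (butlast m) \<inter> D (n (butlast m))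
    else c (butlast m) - D (n (butlast m)))"
proof -
  define g where "g n m = (if length m = Suc k then if last m then c (butlast m) \<inter> D (n (butlast m))
    else c (butlast m) - D (n (butlast m)) else c m)" for n m
  \<comment> \<open>\<open>L J\<close> is the mixed level in which the nodes of \<open>J\<close>
    have been replaced by their two children.\<close>
  define L where "L J = (level k - J) \<union> {m. length m = Suc k \<and> butlast m \<in> J}" for J
  have fin: "finite (L J)" for J
    by (rule finite_subset[of _ "level k \<union> level (Suc k)"]) (auto simp: L_def level_def finite_level[unfolded level_def])
  have "\<exists>n. \<not> small (L J) (g n)" if "finite J" "J \<subseteq> level k" for J
    using that
  proof (induction J rule: finite_induct)
    case empty
    have "L {} = level k" by (auto simp: L_def)
    moreover have "small (level k) (g n) = small (level k) c" for n
      by (rule small_cong) (auto simp: g_def level_def)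
    ultimately show ?case using bad by simp
  next
    case (insert j J)
    then obtain n where n: "\<not> small (L J) (g n)" by blast
    have j: "j \<in> level k" "length j = k" using insert by (auto simp: level_def)
    have "\<exists>p. \<not> small (insert (j @ [True]) (insert (j @ [False]) (L J - {j})))
      ((g n)(j @ [True] := g n j \<inter> D p, j @ [False] := g n j - D p))"
    proof (rule small_split[OF n fin])
      show "j \<in> L J" "j @ [True] \<notin> L J" "j @ [False] \<notin> L J" "j @ [True] \<noteq> j @ [False]"
        using insert j by (auto simp: L_def level_def)
      show "g n m \<in> sets M" if "m \<in> L J" for m
        using that c D insert.prems by (auto simp: L_def g_def level_def)
    qed (use D D_sep in auto)
    then obtain p where p: "\<not> small (insert (j @ [True]) (insert (j @ [False]) (L J - {j})))
      ((g n)(j @ [True] := g n j \<inter> D p, j @ [False] := g n j - D p))" by blast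
    have eq: "insert (j @ [True]) (insert (j @ [False]) (L J - {j})) = L (insert j J)"
    proof (intro equalityI subsetI)
      fix m assume m: "m \<in> L (insert j J)"
      show "m \<in> insert (j @ [True]) (insert (j @ [False]) (L J - {j}))"
      proof (cases "length m = Suc k \<and> butlast m = j")
        case True
        then have "m = j @ [last m]" by (metis append_butlast_last_id length_0_conv nat.distinct(1))
        then show ?thesis by (cases "last m") auto
      next
        case False
        then show ?thesis using m j by (auto simp: L_def level_def)
      qed
    qed (use j insert in \<open>auto simp: L_def level_def\<close>)
    have "small (L (insert j J)) ((g n)(j @ [True] := g n j \<inter> D p, j @ [False] := g n j - D p)) =
      small (L (insert j J)) (g (n(j := p)))"
    proof (rule small_cong)
      fix m assume "m \<in> L (insert j J)"
      then consider "m = j @ [True]" | "m = j @ [False]" | "m \<in> L J" "m \<noteq> j"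
        unfolding eq[symmetric] by auto
      then show "((g n)(j @ [True] := g n j \<inter> D p, j @ [False] := g n j - D p)) m = g (n(j := p)) m"
      proof cases
        case 3
        have "m \<noteq> j @ [True]" "m \<noteq> j @ [False]" using 3 insert j by (auto simp: L_def level_def)
        moreover have "length m = Suc k \<Longrightarrow> butlast m \<noteq> j" using 3 insert by (auto simp: L_def level_def)
        ultimately show ?thesis by (auto simp: g_def)
      qed (use j in \<open>auto simp: g_def\<close>)
    qed
    then show ?case using p unfolding eq by blast
  qed
  from this[OF finite_level subset_refl] obtain n where n: "\<not> small (L (level k)) (g n)" by blast
  have "L (level k) = level (Suc k)" by (auto simp: L_def level_def)
  moreover have "small (level (Suc k)) (g n) = small (level (Suc k)) (\<lambda>m. if last m then c (butlast m) \<inter> D (n (butlast m))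
    else c (butlast m) - D (n (butlast m)))"
    by (rule small_cong) (simp add: g_def level_def)
  ultimately show ?thesis using n by metis
qed

text \<open>One stage of the tree: splitting by a set of \<open>D\<close> will make the points of
  different branches different, and shrinking into cells of \<open>U\<close> will give every branch
  a point.\<close>

lemma small_next_level:
  fixes D U :: "nat \<Rightarrow> 'a set" and c :: "bool list \<Rightarrow> 'a set"
  assumes bad: "\<not> small (level k) c" and c: "\<And>l. l \<in> level k \<Longrightarrow> c l \<in> sets M"
    and D: "\<And>n. D n \<in> sets M"
    and D_sep: "\<And>x y. x \<in> space M \<Longrightarrow> y \<in> space M \<Longrightarrow> x \<noteq> y \<Longrightarrow> \<exists>n. x \<in> D n \<and> y \<notin> D n"
    and U: "\<And>n. U n \<in> sets M" "(\<Union>n. U n) = space M"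
  shows "\<exists>c'. (\<not> small (level (Suc k)) c' \<and> (\<forall>l\<in>level (Suc k). c' l \<in> sets M)) \<and>
    (\<forall>l\<in>level k. \<exists>n. c' (l @ [True]) \<subseteq> c l \<inter> D n \<and> c' (l @ [False]) \<subseteq> c l - D n) \<and>
    (\<forall>l\<in>level (Suc k). \<exists>j. c' l \<subseteq> U j)"
proof -
  have "\<exists>n. \<not> small (level (Suc k)) (\<lambda>m. if last m then c (butlast m) \<inter> D (n (butlast m))
    else c (butlast m) - D (n (butlast m)))"
    by (rule small_split_level) (use assms in auto)
  then obtain n where n: "\<not> small (level (Suc k)) (\<lambda>m. if last m then c (butlast m) \<inter> D (n (butlast m))
    else c (butlast m) - D (n (butlast m)))" by (rule exE)
  define b where "b m = (if last m then c (butlast m) \<inter> D (n (butlast m))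
    else c (butlast m) - D (n (butlast m)))" for m
  define Q where "Q b \<longleftrightarrow> \<not> small (level (Suc k)) b \<and> (\<forall>l\<in>level (Suc k). b l \<in> sets M)" for b
  have "b l \<in> sets M" if "l \<in> level (Suc k)" for l
  proof -
    have "c (butlast l) \<in> sets M" using that c by (simp add: level_def)
    then show ?thesis using D by (simp add: b_def)
  qed
  then have Qb: "Q b" using n unfolding Q_def b_def by simp
  have "\<exists>a. Q (\<lambda>i. if i \<in> level (Suc k) then b i \<inter> U (a i) else b i)"
  proof (rule refine_all[where Q = Q, OF finite_level Qb])
    fix c i assume ci: "Q c" "i \<in> level (Suc k)"
    then have ciU: "c i \<subseteq> (\<Union>n. U n)"
      using sets.sets_into_space[of "c i" M] U(2) by (simp add: Q_def)
    have "\<exists>n. \<not> small (level (Suc k)) (c(i := c i \<inter> U n))"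
      by (rule small_refine) (use ci ciU in \<open>simp_all add: Q_def\<close>)
    then obtain n where "\<not> small (level (Suc k)) (c(i := c i \<inter> U n))" by (rule exE)
    then show "\<exists>n. Q (c(i := c i \<inter> U n))" using ci U(1) unfolding Q_def by auto
  qed
  then obtain a where a: "Q (\<lambda>i. if i \<in> level (Suc k) then b i \<inter> U (a i) else b i)" by blast
  define c' where "c' i = (if i \<in> level (Suc k) then b i \<inter> U (a i) else b i)" for i
  have "Q c'" using a by (simp add: c'_def[abs_def])
  moreover have "c' (l @ [True]) \<subseteq> c l \<inter> D (n l)" "c' (l @ [False]) \<subseteq> c l - D (n l)" if "l \<in> level k" for l
    using that by (auto simp: c'_def b_def level_def)
  moreover have "c' l \<subseteq> U (a l)" if "l \<in> level (Suc k)" for l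
    using that by (auto simp: c'_def)
  ultimately show ?thesis unfolding Q_def by blast
qed

lemma uncountable_bool_sequences: "uncountable (UNIV :: (nat \<Rightarrow> bool) set)"
proof
  assume "countable (UNIV :: (nat \<Rightarrow> bool) set)"
  then have "range (from_nat_into UNIV) = (UNIV :: (nat \<Rightarrow> bool) set)"
    by (intro range_from_nat_into) auto
  moreover have "(\<lambda>k. \<not> from_nat_into UNIV k k) \<in> (UNIV :: (nat \<Rightarrow> bool) set)" by simp
  ultimately obtain n where "(\<lambda>k. \<not> from_nat_into UNIV k k) = (from_nat_into UNIV n :: nat \<Rightarrow> bool)"
    by blast
  from fun_cong[OF this, of n] show False by simp
qed

lemma lusin_novikov:
  assumes fib: "\<And>y. y \<in> space N \<Longrightarrow> countable {x \<in> space M. f x = y}"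
  shows "\<exists>F. countable F \<and> (\<forall>B\<in>F. B \<in> sets M \<and> inj_on f B) \<and> \<Union>F = space M"
proof (rule ccontr)
  assume none: "\<not> ?thesis"
  obtain D :: "nat \<Rightarrow> 'a set" where D: "\<And>n. D n \<in> sets M"
    "\<And>x y. x \<in> space M \<Longrightarrow> y \<in> space M \<Longrightarrow> x \<noteq> y \<Longrightarrow> \<exists>n. x \<in> D n \<and> y \<notin> D n"
    using standard_borel_separating[OF M] by metis
  define W where "W n = f -` V n \<inter> space M" for n
  have "countable (range W \<union> range D)" by simp
  moreover have "range W \<union> range D \<subseteq> sets M" using D(1) by (auto simp: W_def)
  ultimately obtain U where "cover_system M (range W \<union> range D) U"
    using standard_borel_covers_countable[OF M] by blast
  note U = cover_systemD[OF this]
  define P where "P k c \<longleftrightarrow> \<not> small (level k) c \<and> (\<forall>l\<in>level k. c l \<in> sets M)" for k c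
  define R where "R k c c' \<longleftrightarrow>
    (\<forall>l\<in>level k. \<exists>n. c' (l @ [True]) \<subseteq> c l \<inter> D n \<and> c' (l @ [False]) \<subseteq> c l - D n) \<and>
    (\<forall>l\<in>level (Suc k). \<exists>j. c' l \<subseteq> U k j)" for k c c'
  have "\<exists>C. \<forall>k. P k (C k) \<and> R k (C k) (C (Suc k))"
  proof (rule dependent_nat_choice)
    have "\<not> small (level 0) (\<lambda>_. space M)"
    proof
      assume "small (level 0) (\<lambda>_. space M)"
      then have "\<exists>F. countable F \<and> (\<forall>B\<in>F. B \<in> sets M \<and> inj_on f B) \<and> f ` (space M - \<Union>F) = {}"
        by (simp add: small_def level_def)
      then obtain F where F: "countable F \<and> (\<forall>B\<in>F. B \<in> sets M \<and> inj_on f B) \<and> f ` (space M - \<Union>F) = {}"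
        by (rule exE)
      then have "\<Union>F \<subseteq> space M" by (intro Union_least sets.sets_into_space) simp
      with F have "\<Union>F = space M" by (metis Diff_eq_empty_iff image_is_empty subset_antisym)
      with F none show False by metis
    qed
    then have "P 0 (\<lambda>_. space M)" by (simp add: P_def)
    then show "\<exists>x. P 0 x" by blast
    fix c k assume "P k c"
    then show "\<exists>c'. P (Suc k) c' \<and> R k c c'"
      unfolding P_def R_def by (intro small_next_level D U(1,2)) simp_all
  qed
  then obtain C where C: "\<And>k. P k (C k)" "\<And>k. R k (C k) (C (Suc k))" by blast
  define node where "node \<alpha> k = map \<alpha> [0..<k]" for \<alpha> :: "nat \<Rightarrow> bool" and k
  have node_Suc: "node \<alpha> (Suc k) = node \<alpha> k @ [\<alpha> k]" for \<alpha> k by (simp add: node_def)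
  have node_level: "node \<alpha> k \<in> level k" for \<alpha> k by (simp add: node_def level_def)
  have ex_y: "\<exists>y. \<forall>l\<in>level k. y \<in> f ` C k l" for k
  proof (rule ccontr)
    assume "\<not> ?thesis"
    then have "(\<Inter>l\<in>level k. f ` (C k l - \<Union>{})) = {}" by auto
    then have "small (level k) (C k)" unfolding small_def by (intro exI[of _ "{}"]) simp
    then show False using C(1) by (simp add: P_def)
  qed
  \<comment> \<open>This common image point varies with \<open>k\<close>. It serves only to show
    that nodes are nonempty and that the images of the nodes of one level overlap.\<close>
  define y where "y k = (SOME y. \<forall>l\<in>level k. y \<in> f ` C k l)" for k
  have y: "y k \<in> f ` C k l" if "l \<in> level k" for k l
    using someI_ex[OF ex_y, of k] that unfolding y_def by blast
  have ex_d: "\<exists>n. C (Suc k) (l @ [True]) \<subseteq> C k l \<inter> D n \<and> C (Suc k) (l @ [False]) \<subseteq> C k l - D n"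
    if "l \<in> level k" for k l using C(2)[of k] that by (simp add: R_def)
  define d where "d k l = (SOME n. C (Suc k) (l @ [True]) \<subseteq> C k l \<inter> D n \<and> C (Suc k) (l @ [False]) \<subseteq> C k l - D n)"
    for k l
  have d: "C (Suc k) (l @ [True]) \<subseteq> C k l \<inter> D (d k l)" "C (Suc k) (l @ [False]) \<subseteq> C k l - D (d k l)"
    if "l \<in> level k" for k l
    using someI_ex[OF ex_d[OF that]] unfolding d_def by blast+
  have Cspace: "C k l \<subseteq> space M" if "l \<in> level k" for k l
    using C(1)[of k] that sets.sets_into_space[of "C k l" M] by (simp add: P_def)
  have step: "C (Suc k) (node \<alpha> (Suc k)) \<subseteq> C k (node \<alpha> k)" for \<alpha> k
    using d[OF node_level[of \<alpha> k]] unfolding node_Suc by (cases "\<alpha> k") auto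
  have dec: "C m (node \<alpha> m) \<subseteq> C k (node \<alpha> k)" if "k \<le> m" for \<alpha> k m
    using that
  proof (induction m rule: dec_induct)
    case (step n)
    then show ?case using \<open>\<And>\<alpha> k. C (Suc k) (node \<alpha> (Suc k)) \<subseteq> C k (node \<alpha> k)\<close> by blast
  qed simp
  have ex_a: "\<exists>j. C (Suc k) (node \<alpha> (Suc k)) \<subseteq> U k j" for k \<alpha>
    using C(2)[of k] node_level[of \<alpha> "Suc k"] by (simp add: R_def)
  define a where "a \<alpha> k = (SOME j. C (Suc k) (node \<alpha> (Suc k)) \<subseteq> U k j)" for \<alpha> k
  have a: "C (Suc k) (node \<alpha> (Suc k)) \<subseteq> U k (a \<alpha> k)" for k \<alpha>
    using someI_ex[OF ex_a] unfolding a_def .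
  have "\<exists>x. \<forall>k. x \<in> U k (a \<alpha> k)" for \<alpha>
  proof -
    have "(\<Inter>k\<le>n. U k (a \<alpha> k)) \<noteq> {}" for n
    proof -
      have "C (Suc n) (node \<alpha> (Suc n)) \<subseteq> (\<Inter>k\<le>n. U k (a \<alpha> k))"
      proof (rule INT_greatest)
        fix k assume "k \<in> {..n}"
        then have "C (Suc n) (node \<alpha> (Suc n)) \<subseteq> C (Suc k) (node \<alpha> (Suc k))" by (intro dec) simp
        then show "C (Suc n) (node \<alpha> (Suc n)) \<subseteq> U k (a \<alpha> k)" using a by (rule subset_trans)
      qed
      moreover have "C (Suc n) (node \<alpha> (Suc n)) \<noteq> {}" using y[OF node_level[of \<alpha> "Suc n"]] by auto
      ultimately show ?thesis by blast
    qed
    then have "(\<Inter>k. U k (a \<alpha> k)) \<noteq> {}" by (rule U(4))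
    then show ?thesis by auto
  qed
  then obtain x where x: "\<And>\<alpha> k. x \<alpha> \<in> U k (a \<alpha> k)" by metis
  have xM: "x \<alpha> \<in> space M" for \<alpha> using x[of \<alpha> 0] sets.sets_into_space[OF U(1)[of 0 "a \<alpha> 0"]] by blast
  \<comment> \<open>If some \<open>V n\<close> told the two images apart, the level \<open>k\<close>
    deciding its preimage would make the images of two nodes of level \<open>Suc k\<close> disjoint,
    although both contain \<open>y (Suc k)\<close>.\<close>
  have same: "f (x \<alpha>) = f (x \<beta>)" for \<alpha> \<beta>
  proof (rule ccontr)
    assume "f (x \<alpha>) \<noteq> f (x \<beta>)"
    then obtain n where n: "f (x \<alpha>) \<in> V n" "f (x \<beta>) \<notin> V n"
      using V_sep measurable_space[OF f] xM by metis
    have "decides U (W n)" by (rule U(3)) simp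
    then obtain k where k: "\<And>i. U k i \<subseteq> W n \<or> U k i \<inter> W n = {}" unfolding decides_def by blast
    have "U k (a \<alpha> k) \<subseteq> W n" using k[of "a \<alpha> k"] x[of \<alpha> k] n xM by (auto simp: W_def)
    then have 1: "C (Suc k) (node \<alpha> (Suc k)) \<subseteq> W n" using a by blast
    have "U k (a \<beta> k) \<inter> W n = {}" using k[of "a \<beta> k"] x[of \<beta> k] n by (auto simp: W_def)
    then have 2: "C (Suc k) (node \<beta> (Suc k)) \<inter> W n = {}" using a[of k \<beta>] by blast
    have "y (Suc k) \<in> V n" using y[OF node_level[of \<alpha> "Suc k"]] 1 by (auto simp: W_def)
    moreover have "y (Suc k) \<notin> V n"
      using y[OF node_level[of \<beta> "Suc k"]] 2 Cspace[OF node_level[of \<beta> "Suc k"]] by (auto simp: W_def)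
    ultimately show False by simp
  qed
  \<comment> \<open>The cell of the branch at the level that decides \<open>D n\<close> meets a node
    inside \<open>D n\<close>, so the whole cell lies in \<open>D n\<close>, and
    \<open>x \<alpha>\<close> with it.\<close>
  have in_D: "x \<alpha> \<in> D n" if "C m (node \<alpha> m) \<subseteq> D n" for \<alpha> m n
  proof -
    have "decides U (D n)" by (rule U(3)) simp
    then obtain k where k: "\<And>i. U k i \<subseteq> D n \<or> U k i \<inter> D n = {}" unfolding decides_def by blast
    define p where "p = max m (Suc k)"
    have "C p (node \<alpha> p) \<subseteq> D n" "C p (node \<alpha> p) \<subseteq> U k (a \<alpha> k)"
      using dec[of m p \<alpha>] dec[of "Suc k" p \<alpha>] that a[of k \<alpha>] by (auto simp: p_def)
    moreover have "C p (node \<alpha> p) \<noteq> {}" using y[OF node_level[of \<alpha> p]] by auto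
    ultimately show ?thesis using k[of "a \<alpha> k"] x[of \<alpha> k] by blast
  qed
  have not_in_D: "x \<alpha> \<notin> D n" if "C m (node \<alpha> m) \<inter> D n = {}" for \<alpha> m n
  proof -
    have "decides U (D n)" by (rule U(3)) simp
    then obtain k where k: "\<And>i. U k i \<subseteq> D n \<or> U k i \<inter> D n = {}" unfolding decides_def by blast
    define p where "p = max m (Suc k)"
    have "C p (node \<alpha> p) \<inter> D n = {}" "C p (node \<alpha> p) \<subseteq> U k (a \<alpha> k)"
      using dec[of m p \<alpha>] dec[of "Suc k" p \<alpha>] that a[of k \<alpha>] by (auto simp: p_def)
    moreover have "C p (node \<alpha> p) \<noteq> {}" using y[OF node_level[of \<alpha> p]] by auto
    ultimately show ?thesis using k[of "a \<alpha> k"] x[of \<alpha> k] by blast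
  qed
  have neq: "x \<alpha> \<noteq> x \<beta>" if "node \<alpha> k = node \<beta> k" "\<alpha> k" "\<not> \<beta> k" for \<alpha> \<beta> k
  proof -
    have "C (Suc k) (node \<alpha> (Suc k)) \<subseteq> D (d k (node \<alpha> k))"
      using d(1)[OF node_level[of \<alpha> k]] that by (simp add: node_Suc)
    moreover have "C (Suc k) (node \<beta> (Suc k)) \<inter> D (d k (node \<alpha> k)) = {}"
      using d(2)[OF node_level[of \<beta> k]] that by (auto simp: node_Suc)
    ultimately show ?thesis using in_D not_in_D by metis
  qed
  have "inj x"
  proof (rule injI, rule ccontr)
    fix \<alpha> \<beta> assume eq: "x \<alpha> = x \<beta>" and "\<alpha> \<noteq> \<beta>"
    then have ex: "\<exists>k. \<alpha> k \<noteq> \<beta> k" by auto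
    define k where "k = (LEAST k. \<alpha> k \<noteq> \<beta> k)"
    have k: "\<alpha> k \<noteq> \<beta> k" unfolding k_def by (rule LeastI_ex[OF ex])
    have "\<alpha> i = \<beta> i" if "i < k" for i using not_less_Least that unfolding k_def by blast
    then have "node \<alpha> k = node \<beta> k" by (simp add: node_def)
    then show False using neq[of \<alpha> k \<beta>] neq[of \<beta> k \<alpha>] k eq by metis
  qed
  moreover have "range x \<subseteq> {z \<in> space M. f z = f (x (\<lambda>_. True))}" using xM same by blast
  moreover have "countable {z \<in> space M. f z = f (x (\<lambda>_. True))}"
    using fib measurable_space[OF f] xM by blast
  ultimately have "countable (UNIV :: (nat \<Rightarrow> bool) set)"
    using countable_image_inj_on countable_subset by blast
  then show False using uncountable_bool_sequences by simp
qed

end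

lemma emeasure_count_space_inj_le:
  assumes "inj_on f S" "f ` S \<subseteq> T"
  shows "emeasure (count_space UNIV) S \<le> emeasure (count_space UNIV) T"
proof (cases "finite T")
  case True
  then have "finite S" using assms inj_on_finite by blast
  then show ?thesis using True card_inj_on_le[OF assms True] by simp
qed (simp add: emeasure_count_space_infinite)

section \<open>The measure of a discrete measured groupoid\<close>

locale measured_groupoid =
  fixes G :: "'g groupoid" and \<mu> :: "'g measure"
  assumes dmg: "discrete_measured_groupoid G \<mu>"
begin

abbreviation "M \<equiv> borel_str G"
abbreviation "s \<equiv> src G"
abbreviation "t \<equiv> tgt G"
abbreviation prd (infixl "\<odot>" 70) where "g \<odot> h \<equiv> mul G g h"
abbreviation "inv' \<equiv> ginv G"
abbreviation "\<nu> \<equiv> mu_s G \<mu>"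

section \<open>Groupoid algebra and Borel structure\<close>

lemma dbg: "discrete_borel_groupoid G" and prob: "prob_space \<mu>"
  and sets_\<mu>: "sets \<mu> = sets (restrict_space M (units G))"
  and null_eq: "null_sets \<nu> = null_sets (mu_t G \<mu>)"
  using dmg unfolding discrete_measured_groupoid_def by auto

lemma grp: "is_groupoid G" and std: "standard_borel M" and units[measurable]: "units G \<in> sets M"
  using dbg unfolding discrete_borel_groupoid_def by auto

lemma
  shows units_carr: "u \<in> units G \<Longrightarrow> u \<in> carr G"
    and s_units[simp]: "g \<in> carr G \<Longrightarrow> s g \<in> units G"
    and t_units[simp]: "g \<in> carr G \<Longrightarrow> t g \<in> units G"
    and s_unit: "u \<in> units G \<Longrightarrow> s u = u"
    and t_unit: "u \<in> units G \<Longrightarrow> t u = u"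
    and inv_carr[simp]: "g \<in> carr G \<Longrightarrow> inv' g \<in> carr G"
    and s_inv[simp]: "g \<in> carr G \<Longrightarrow> s (inv' g) = t g"
    and t_inv[simp]: "g \<in> carr G \<Longrightarrow> t (inv' g) = s g"
    and inv_l[simp]: "g \<in> carr G \<Longrightarrow> inv' g \<odot> g = s g"
    and inv_r[simp]: "g \<in> carr G \<Longrightarrow> g \<odot> inv' g = t g"
    and mul_s[simp]: "g \<in> carr G \<Longrightarrow> g \<odot> s g = g"
    and mul_t[simp]: "g \<in> carr G \<Longrightarrow> t g \<odot> g = g"
  using grp unfolding is_groupoid_def by auto

lemma
  assumes "g \<in> carr G" "h \<in> carr G" "s g = t h"
  shows mul_carr[simp]: "g \<odot> h \<in> carr G" and s_mul[simp]: "s (g \<odot> h) = s h"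
    and t_mul[simp]: "t (g \<odot> h) = t g"
proof -
  have "(g, h) \<in> composable G" using assms by (simp add: composable_def)
  then show "g \<odot> h \<in> carr G" "s (g \<odot> h) = s h" "t (g \<odot> h) = t g"
    using grp unfolding is_groupoid_def by auto
qed

lemma mul_assoc:
  assumes "g \<in> carr G" "h \<in> carr G" "k \<in> carr G" "s g = t h" "s h = t k"
  shows "g \<odot> h \<odot> k = g \<odot> (h \<odot> k)"
proof -
  have "(g, h) \<in> composable G" "(h, k) \<in> composable G" using assms by (simp_all add: composable_def)
  then show ?thesis using grp unfolding is_groupoid_def by blast
qed

lemma inv_mul_cancel[simp]: "g \<in> carr G \<Longrightarrow> h \<in> carr G \<Longrightarrow> s g = t h \<Longrightarrow> inv' g \<odot> (g \<odot> h) = h"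
  by (simp add: mul_assoc[symmetric])

lemma mul_inv_cancel[simp]: "g \<in> carr G \<Longrightarrow> h \<in> carr G \<Longrightarrow> t g = t h \<Longrightarrow> g \<odot> (inv' g \<odot> h) = h"
  by (simp add: mul_assoc[symmetric])

lemma mul_mul_inv[simp]: "g \<in> carr G \<Longrightarrow> h \<in> carr G \<Longrightarrow> s h = t g \<Longrightarrow> h \<odot> g \<odot> inv' g = h"
  by (simp add: mul_assoc) (metis mul_s)

lemma mul_inv_mul[simp]: "g \<in> carr G \<Longrightarrow> h \<in> carr G \<Longrightarrow> s h = s g \<Longrightarrow> h \<odot> inv' g \<odot> g = h"
  by (simp add: mul_assoc) (metis mul_s)

lemma inv_inv[simp]:
  assumes g: "g \<in> carr G" shows "inv' (inv' g) = g"
proof -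
  have "inv' (inv' g) = inv' (inv' g) \<odot> (inv' g \<odot> g)"
    using g mul_s[of "inv' (inv' g)"] by (simp del: mul_s)
  also have "\<dots> = g" using g inv_mul_cancel[of "inv' g" g] by (simp del: inv_mul_cancel inv_l)
  finally show ?thesis .
qed

lemma space_\<mu>: "space \<mu> = units G"
  using sets_eq_imp_space_eq[OF sets_\<mu>] units_carr by (auto simp: space_restrict_space)

lemma sets_\<mu>_iff: "Y \<in> sets \<mu> \<longleftrightarrow> Y \<in> sets M \<and> Y \<subseteq> units G"
  unfolding sets_\<mu> using units sets.sets_into_space
  by (subst sets_restrict_space_iff) auto

lemma s_meas[measurable]: "s \<in> M \<rightarrow>\<^sub>M M" and t_meas[measurable]: "t \<in> M \<rightarrow>\<^sub>M M"
  and inv_meas[measurable]: "inv' \<in> M \<rightarrow>\<^sub>M M"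
  using dbg unfolding discrete_borel_groupoid_def
  by (auto intro: measurable_restrict_space2_iff[THEN iffD1, THEN conjunct2] simp: measurable_restrict_space2_iff)

lemma s_meas_\<mu>[measurable]: "s \<in> M \<rightarrow>\<^sub>M \<mu>" and t_meas_\<mu>[measurable]: "t \<in> M \<rightarrow>\<^sub>M \<mu>"
  using dbg unfolding discrete_borel_groupoid_def
  by (auto simp: measurable_cong_sets[OF refl sets_\<mu>])

lemma mul_meas:
  assumes "f \<in> N \<rightarrow>\<^sub>M M" "g \<in> N \<rightarrow>\<^sub>M M" "\<And>x. x \<in> space N \<Longrightarrow> s (f x) = t (g x)"
  shows "(\<lambda>x. f x \<odot> g x) \<in> N \<rightarrow>\<^sub>M M"
proof -
  have 1: "(\<lambda>x. (f x, g x)) \<in> N \<rightarrow>\<^sub>M restrict_space (M \<Otimes>\<^sub>M M) (composable G)"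
    using assms measurable_space[OF assms(1)] measurable_space[OF assms(2)]
    by (intro measurable_restrict_space2) (auto simp: composable_def)
  have "(\<lambda>(g, h). g \<odot> h) \<in> restrict_space (M \<Otimes>\<^sub>M M) (composable G) \<rightarrow>\<^sub>M M"
    using dbg unfolding discrete_borel_groupoid_def by blast
  from measurable_compose[OF 1 this] show ?thesis by simp
qed

lemma separated_self: "f \<in> M \<rightarrow>\<^sub>M M \<Longrightarrow> \<exists>V. separated_map M M f V"
proof -
  assume f: "f \<in> M \<rightarrow>\<^sub>M M"
  obtain V :: "nat \<Rightarrow> 'g set" where "\<And>n. V n \<in> sets M"
    "\<And>x y. x \<in> space M \<Longrightarrow> y \<in> space M \<Longrightarrow> x \<noteq> y \<Longrightarrow> \<exists>n. x \<in> V n \<and> y \<notin> V n"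
    using standard_borel_separating[OF std] by metis
  then have "separated_map M M f V" using std f by unfold_locales auto
  then show ?thesis by blast
qed

lemma inj_image_sets: "f \<in> M \<rightarrow>\<^sub>M M \<Longrightarrow> A \<in> sets M \<Longrightarrow> inj_on f A \<Longrightarrow> f ` A \<in> sets M"
  using separated_self separated_map.lusin_souslin by metis

lemma sets_carr: "A \<in> sets M \<Longrightarrow> x \<in> A \<Longrightarrow> x \<in> carr G"
  using sets.sets_into_space by blast

lemma Iso_sets[measurable]: "Iso G \<in> sets M"
proof -
  obtain V :: "nat \<Rightarrow> 'g set" where V[measurable]: "\<And>n. V n \<in> sets M"
    and sep: "\<And>x y. x \<in> space M \<Longrightarrow> y \<in> space M \<Longrightarrow> x \<noteq> y \<Longrightarrow> \<exists>n. x \<in> V n \<and> y \<notin> V n"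
    using standard_borel_separating[OF std] by metis
  have "Iso G = {g \<in> space M. \<forall>n. s g \<in> V n \<longleftrightarrow> t g \<in> V n}"
  proof (intro equalityI subsetI)
    fix g assume g: "g \<in> {g \<in> space M. \<forall>n. s g \<in> V n \<longleftrightarrow> t g \<in> V n}"
    then have "s g \<in> carr G" "t g \<in> carr G" using units_carr by auto
    then have "s g = t g" using sep[of "s g" "t g"] g by blast
    then show "g \<in> Iso G" using g by (simp add: Iso_def)
  qed (auto simp: Iso_def)
  also have "\<dots> \<in> sets M" by measurable
  finally show ?thesis .
qed

lemma countable_inj_cover:
  assumes "f \<in> M \<rightarrow>\<^sub>M M" "\<And>g. g \<in> carr G \<Longrightarrow> f g \<in> units G"
    "\<And>x. x \<in> units G \<Longrightarrow> countable {g \<in> carr G. f g = x}"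
  shows "\<exists>F. countable F \<and> (\<forall>B\<in>F. B \<in> sets M \<and> inj_on f B) \<and> \<Union>F = carr G"
proof -
  obtain V where "separated_map M M f V" using separated_self assms(1) by blast
  then interpret separated_map M M f V .
  have "countable {x \<in> space M. f x = y}" for y
  proof (cases "y \<in> units G")
    case False
    then have "{x \<in> space M. f x = y} = {}" using assms(2) by auto
    then show ?thesis by (simp only: countable_empty)
  qed (use assms(3) in auto)
  then show ?thesis by (rule lusin_novikov)
qed

text \<open>A cover by sets on which \<open>s\<close> is injective is intersected with one for
  \<open>t\<close>, and the result is made disjoint.\<close>

lemma bisection_cover:
  "\<exists>A::nat \<Rightarrow> 'g set. (\<forall>n. borel_bisection G (A n)) \<and> disjoint_family A \<and> (\<Union>n. A n) = carr G"
proof -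
  have c: "\<forall>x\<in>units G. countable {g \<in> carr G. s g = x} \<and> countable {g \<in> carr G. t g = x}"
    using dbg unfolding discrete_borel_groupoid_def by blast
  obtain F where F: "countable F" "\<forall>B\<in>F. B \<in> sets M \<and> inj_on s B" "\<Union>F = carr G"
    using countable_inj_cover[OF s_meas] c by (metis (no_types, lifting) s_units)
  obtain H where H: "countable H" "\<forall>B\<in>H. B \<in> sets M \<and> inj_on t B" "\<Union>H = carr G"
    using countable_inj_cover[OF t_meas] c by (metis (no_types, lifting) t_units)
  define K where "K = insert {} ((\<lambda>(B, C). B \<inter> C) ` (F \<times> H))"
  define B where "B = from_nat_into K"
  have r: "range B = K" unfolding B_def by (rule range_from_nat_into) (use F(1) H(1) in \<open>auto simp: K_def\<close>)
  have Kb: "borel_bisection G C" if "C \<in> K" for C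
    using that F(2) H(2) unfolding K_def borel_bisection_def
    by (auto intro: inj_on_subset)
  have Bb: "borel_bisection G (B n)" for n using Kb r by blast
  have "borel_bisection G (disjointed B n)" for n
  proof -
    have "disjointed B n \<subseteq> B n" by (rule disjointed_subset)
    moreover have "disjointed B n \<in> sets M"
      using sets.range_disjointed_sets[of B M] Bb by (auto simp: borel_bisection_def)
    ultimately show ?thesis using Bb[of n] inj_on_subset unfolding borel_bisection_def by blast
  qed
  moreover have "(\<Union>n. disjointed B n) = carr G"
  proof -
    have "(\<Union>n. disjointed B n) = \<Union>K" unfolding UN_disjointed_eq r ..
    also have "\<dots> = carr G"
    proof
      show "\<Union>K \<subseteq> carr G" using Kb sets.sets_into_space by (auto simp: borel_bisection_def) 
      show "carr G \<subseteq> \<Union>K"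
      proof
        fix x assume "x \<in> carr G"
        then obtain B C where "B \<in> F" "x \<in> B" "C \<in> H" "x \<in> C" using F(3) H(3) by blast
        then show "x \<in> \<Union>K" unfolding K_def by (intro UnionI[of "B \<inter> C"]) auto
      qed
    qed
    finally show ?thesis .
  qed
  ultimately show ?thesis using disjoint_family_disjointed by blast
qed

definition piece :: "nat \<Rightarrow> 'g set" where
  "piece = (SOME A. (\<forall>n. borel_bisection G (A n)) \<and> disjoint_family A \<and> (\<Union>n. A n) = carr G)"

lemma piece_bis: "borel_bisection G (piece n)" and piece_disj: "disjoint_family piece"
  and piece_Un: "(\<Union>n. piece n) = carr G"
  using someI_ex[OF bisection_cover] unfolding piece_def by blast+

lemma piece_meas[measurable]: "piece n \<in> sets M" and piece_inj_s: "inj_on s (piece n)"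
  and piece_inj_t: "inj_on t (piece n)"
  using piece_bis unfolding borel_bisection_def by auto

lemma piece_ex: "g \<in> carr G \<Longrightarrow> \<exists>n. g \<in> piece n"
  using piece_Un by blast

section \<open>Counting fibres and null sets\<close>

definition cnt :: "('g \<Rightarrow> 'g) \<Rightarrow> 'g set \<Rightarrow> 'g \<Rightarrow> ennreal" where
  "cnt f B x = emeasure (count_space UNIV) {g \<in> B. f g = x}"

lemma cnt_inj: "inj_on f B \<Longrightarrow> cnt f B x = indicator (f ` B) x"
proof (cases "x \<in> f ` B")
  case True
  assume i: "inj_on f B"
  from True obtain g where "g \<in> B" "x = f g" by blast
  then have "{g \<in> B. f g = x} = {g}" using i by (auto dest: inj_onD)
  then show ?thesis using True by (simp add: cnt_def)
next
  case False
  then have "{g \<in> B. f g = x} = {}" by auto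
  then show ?thesis using False by (simp only: cnt_def) simp
qed

lemma cnt_suminf:
  fixes B :: "nat \<Rightarrow> 'g set"
  assumes "disjoint_family B"
  shows "cnt f (\<Union>n. B n) x = (\<Sum>n. cnt f (B n) x)"
proof -
  have "{g \<in> (\<Union>n. B n). f g = x} = (\<Union>n. {g \<in> B n. f g = x})" by auto
  moreover have "disjoint_family (\<lambda>n. {g \<in> B n. f g = x})"
    using assms by (auto simp: disjoint_family_on_def)
  ultimately show ?thesis unfolding cnt_def by (simp add: suminf_emeasure[symmetric])
qed

text \<open>On a piece \<open>f\<close> is injective, so counting its fibres amounts to adding
  indicators of images. As these images are Borel for the source and target maps, the counting
  functions are Borel too.\<close>

lemma cnt_pieces:
  assumes "B \<in> sets M" "\<And>n. inj_on f (piece n)"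
  shows "cnt f B x = (\<Sum>n. indicator (f ` (B \<inter> piece n)) x)"
proof -
  have B: "B = (\<Union>n. B \<inter> piece n)" using piece_Un sets.sets_into_space[OF assms(1)] by blast
  have "disjoint_family (\<lambda>n. B \<inter> piece n)" using piece_disj by (auto simp: disjoint_family_on_def)
  then have "cnt f B x = (\<Sum>n. cnt f (B \<inter> piece n) x)" using cnt_suminf B by metis
  also have "\<dots> = (\<Sum>n. indicator (f ` (B \<inter> piece n)) x)"
    by (intro suminf_cong cnt_inj inj_on_subset[OF assms(2)]) auto
  finally show ?thesis .
qed

text \<open>One construction for \<open>mu_s\<close> and \<open>mu_t\<close>, so that the lemmas for
  source and target share their proofs.\<close>

definition mu_fib :: "('g \<Rightarrow> 'g) \<Rightarrow> 'g measure" where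
  "mu_fib f = measure_of (carr G) (sets M) (\<lambda>A. \<integral>\<^sup>+x. cnt f A x \<partial>\<mu>)"

lemma mu_s_fib: "\<nu> = mu_fib s" and mu_t_fib: "mu_t G \<mu> = mu_fib t"
  by (simp_all add: mu_s_def mu_t_def mu_fib_def cnt_def)

lemma sets_mu_fib: "sets (mu_fib f) = sets M" and space_mu_fib: "space (mu_fib f) = carr G"
  by (simp_all add: mu_fib_def sets.sigma_sets_eq sets.space_closed)

lemma sets_\<nu>[simp, measurable_cong]: "sets \<nu> = sets M" and space_\<nu>[simp]: "space \<nu> = carr G"
  by (simp_all add: mu_s_fib sets_mu_fib space_mu_fib)

context
  fixes f :: "'g \<Rightarrow> 'g"
  assumes f[measurable]: "f \<in> M \<rightarrow>\<^sub>M M" and f_units: "\<And>g. g \<in> carr G \<Longrightarrow> f g \<in> units G"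
    and f_inj: "\<And>n. inj_on f (piece n)"
begin

lemma image_piece: "B \<in> sets M \<Longrightarrow> f ` (B \<inter> piece n) \<in> sets \<mu>"
  using inj_image_sets[OF f, of "B \<inter> piece n"] inj_on_subset[OF f_inj, of "B \<inter> piece n" n] f_units sets_carr
  by (auto simp: sets_\<mu>_iff)

lemma image_sets_gen: "B \<in> sets M \<Longrightarrow> f ` B \<in> sets \<mu>"
proof -
  assume B: "B \<in> sets M"
  have "f ` B = (\<Union>n. f ` (B \<inter> piece n))" using piece_Un sets.sets_into_space[OF B] by blast
  also have "\<dots> \<in> sets \<mu>" using image_piece[OF B] by blast
  finally show ?thesis .
qed

lemma cnt_meas_gen: "B \<in> sets M \<Longrightarrow> cnt f B \<in> borel_measurable \<mu>"
proof -
  assume B: "B \<in> sets M"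
  have "cnt f B = (\<lambda>x. \<Sum>n. indicator (f ` (B \<inter> piece n)) x)"
    by (rule ext) (rule cnt_pieces[OF B f_inj])
  then show ?thesis using image_piece[OF B] by simp
qed

text \<open>The formula becomes available once the set function is known to be countably additive,
  since \<open>measure_of\<close> is the zero measure otherwise.\<close>

lemma emeasure_mu_fib: "B \<in> sets M \<Longrightarrow> emeasure (mu_fib f) B = (\<integral>\<^sup>+x. cnt f B x \<partial>\<mu>)"
proof (rule emeasure_measure_of[OF mu_fib_def])
  show "positive (sets (mu_fib f)) (\<lambda>A. \<integral>\<^sup>+x. cnt f A x \<partial>\<mu>)"
    by (simp add: positive_def cnt_def)
  show "countably_additive (sets (mu_fib f)) (\<lambda>A. \<integral>\<^sup>+x. cnt f A x \<partial>\<mu>)"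
    unfolding sets_mu_fib
  proof (rule countably_additiveI)
    fix A :: "nat \<Rightarrow> 'g set" assume A: "range A \<subseteq> sets M" "disjoint_family A"
    then show "(\<Sum>i. \<integral>\<^sup>+x. cnt f (A i) x \<partial>\<mu>) = (\<integral>\<^sup>+x. cnt f (\<Union>i. A i) x \<partial>\<mu>)"
      unfolding cnt_suminf[OF A(2)] by (intro nn_integral_suminf[symmetric] cnt_meas_gen) auto
  qed
qed (auto simp: sets_mu_fib sets.space_closed)

lemma emeasure_mu_fib_pieces:
  "B \<in> sets M \<Longrightarrow> emeasure (mu_fib f) B = (\<Sum>n. emeasure \<mu> (f ` (B \<inter> piece n)))"
  using image_piece f_inj by (simp add: emeasure_mu_fib cnt_pieces nn_integral_suminf)

lemma emeasure_mu_fib_inj: "B \<in> sets M \<Longrightarrow> inj_on f B \<Longrightarrow> emeasure (mu_fib f) B = emeasure \<mu> (f ` B)"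
  using image_sets_gen by (simp add: emeasure_mu_fib cnt_inj)

lemma null_mu_fib: "B \<in> null_sets (mu_fib f) \<longleftrightarrow> B \<in> sets M \<and> f ` B \<in> null_sets \<mu>"
proof (cases "B \<in> sets M")
  case B: True
  have eq: "f ` B = (\<Union>n. f ` (B \<inter> piece n))" using piece_Un sets.sets_into_space[OF B] by blast
  have "emeasure (mu_fib f) B = 0 \<longleftrightarrow> (\<forall>n. emeasure \<mu> (f ` (B \<inter> piece n)) = 0)"
    using B by (simp add: emeasure_mu_fib_pieces suminf_eq_zero_iff)
  also have "\<dots> \<longleftrightarrow> f ` B \<in> null_sets \<mu>"
  proof
    assume "\<forall>n. emeasure \<mu> (f ` (B \<inter> piece n)) = 0"
    then show "f ` B \<in> null_sets \<mu>" unfolding eq using image_piece[OF B]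
      by (intro null_sets_UN) (auto simp: null_sets_def)
  next
    assume n: "f ` B \<in> null_sets \<mu>"
    have "f ` (B \<inter> piece n) \<in> null_sets \<mu>" for n
      by (rule null_sets_subset[OF n image_piece[OF B]]) auto
    then show "\<forall>n. emeasure \<mu> (f ` (B \<inter> piece n)) = 0" by auto
  qed
  finally show ?thesis using B by (auto simp: null_sets_def sets_mu_fib)
qed (auto simp: null_sets_def sets_mu_fib)

end

lemmas s_fib = s_meas s_units piece_inj_s
lemmas t_fib = t_meas t_units piece_inj_t

lemma s_image: "B \<in> sets M \<Longrightarrow> s ` B \<in> sets \<mu>" and t_image: "B \<in> sets M \<Longrightarrow> t ` B \<in> sets \<mu>"
  using image_sets_gen[OF s_fib] image_sets_gen[OF t_fib] by blast+

lemma t_image_M: "B \<in> sets M \<Longrightarrow> t ` B \<in> sets M" and s_image_M: "B \<in> sets M \<Longrightarrow> s ` B \<in> sets M"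
  using s_image t_image sets_\<mu>_iff by blast+

lemma cnt_meas[measurable]: "B \<in> sets M \<Longrightarrow> cnt s B \<in> borel_measurable \<mu>"
  by (rule cnt_meas_gen[OF s_fib])

lemma emeasure_\<nu>: "B \<in> sets M \<Longrightarrow> emeasure \<nu> B = (\<integral>\<^sup>+x. cnt s B x \<partial>\<mu>)"
  unfolding mu_s_fib by (rule emeasure_mu_fib[OF s_fib])

lemma emeasure_\<nu>_pieces: "B \<in> sets M \<Longrightarrow> emeasure \<nu> B = (\<Sum>n. emeasure \<mu> (s ` (B \<inter> piece n)))"
  unfolding mu_s_fib by (rule emeasure_mu_fib_pieces[OF s_fib])

lemma emeasure_\<nu>_inj: "B \<in> sets M \<Longrightarrow> inj_on s B \<Longrightarrow> emeasure \<nu> B = emeasure \<mu> (s ` B)"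
  unfolding mu_s_fib by (rule emeasure_mu_fib_inj[OF s_fib])

lemma null_s: "B \<in> null_sets \<nu> \<longleftrightarrow> B \<in> sets M \<and> s ` B \<in> null_sets \<mu>"
  unfolding mu_s_fib by (rule null_mu_fib[OF s_fib])

text \<open>The equivalence of the two measures enters here: together with \<open>null_s\<close>,
  nullness of a set of arrows can be tested on sources or on targets.\<close>

lemma null_t: "B \<in> null_sets \<nu> \<longleftrightarrow> B \<in> sets M \<and> t ` B \<in> null_sets \<mu>"
  unfolding null_eq mu_t_fib by (rule null_mu_fib[OF t_fib])

lemma emeasure_\<nu>_le_1: "B \<in> sets M \<Longrightarrow> inj_on s B \<Longrightarrow> emeasure \<nu> B \<le> 1"
  using prob_space.emeasure_le_1[OF prob] by (simp add: emeasure_\<nu>_inj)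

text \<open>\<open>Y\<close> consists of the arrows that share a source with an element of
  \<open>B\<close>, and \<open>Z\<close> of the targets of \<open>Y\<close>. Nullness passes from
  the sources of \<open>B\<close> to \<open>Y\<close>, and from \<open>Y\<close> to its targets;
  composition and inversion make \<open>Z\<close> saturated.\<close>

lemma null_saturation:
  assumes "B \<in> null_sets \<nu>"
  obtains Z where "Z \<in> null_sets \<mu>" "\<And>g. g \<in> B \<Longrightarrow> s g \<in> Z"
    "\<And>g. g \<in> carr G \<Longrightarrow> s g \<in> Z \<longleftrightarrow> t g \<in> Z"
proof -
  define Y where "Y = {g \<in> space M. s g \<in> s ` B}"
  define Z where "Z = t ` Y"
  have B: "B \<in> sets M" "s ` B \<in> null_sets \<mu>" using assms by (auto simp: null_s)
  have Ym: "Y \<in> sets M" using s_image_M[OF B(1)] unfolding Y_def by measurable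
  have "s ` Y = s ` B" using sets_carr[OF B(1)] by (auto simp: Y_def)
  then have "Y \<in> null_sets \<nu>" using B Ym by (simp add: null_s)
  then have "Z \<in> null_sets \<mu>" by (simp add: null_t Z_def)
  moreover have "s g \<in> Z" if "g \<in> B" for g
  proof -
    have "s g \<in> Y" using that sets_carr[OF B(1)] units_carr by (auto simp: Y_def s_unit)
    then show ?thesis unfolding Z_def
      by (intro image_eqI[of _ _ "s g"]) (use that sets_carr[OF B(1)] in \<open>auto simp: t_unit\<close>)
  qed
  moreover have "t g \<in> Z" if g: "g \<in> carr G" "s g \<in> Z" for g
  proof -
    obtain h where h: "h \<in> Y" "s g = t h" using g by (auto simp: Z_def)
    then have "h \<in> carr G" by (auto simp: Y_def)
    then have "g \<odot> h \<in> Y" "t (g \<odot> h) = t g" using h g by (auto simp: Y_def)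
    then show ?thesis unfolding Z_def by (metis imageI)
  qed
  moreover have "s g \<in> Z" if g: "g \<in> carr G" "t g \<in> Z" for g
    using calculation(3)[of "inv' g"] g by simp
  ultimately show ?thesis using that by blast
qed

section \<open>Translations by bisections\<close>

text \<open>
  Translation maps are extended by the identity; their domains \<open>t g \<in> t ` A\<close> and \<open>s g \<in> t ` A\<close> appear
  as side conditions.
\<close>

definition sect :: "'g set \<Rightarrow> 'g \<Rightarrow> 'g" where
  "sect A x = the_inv_into A t x"

definition ltr :: "'g set \<Rightarrow> 'g \<Rightarrow> 'g" where
  "ltr A g = (if t g \<in> t ` A then inv' (sect A (t g)) \<odot> g else g)"

definition rtr :: "'g set \<Rightarrow> 'g \<Rightarrow> 'g" where
  "rtr A g = (if s g \<in> t ` A then g \<odot> sect A (s g) else g)"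

lemma bisD:
  assumes "borel_bisection G A"
  shows "A \<in> sets M" "inj_on s A" "inj_on t A" "\<And>a. a \<in> A \<Longrightarrow> a \<in> carr G"
  using assms sets_carr unfolding borel_bisection_def by auto

lemma bis_subset: "borel_bisection G A \<Longrightarrow> B \<in> sets M \<Longrightarrow> B \<subseteq> A \<Longrightarrow> borel_bisection G B"
  unfolding borel_bisection_def using inj_on_subset by blast

lemma sect_eq: "borel_bisection G A \<Longrightarrow> a \<in> A \<Longrightarrow> sect A (t a) = a"
  unfolding sect_def by (rule the_inv_into_f_f) (auto dest: bisD)

lemma sect_in: "borel_bisection G A \<Longrightarrow> x \<in> t ` A \<Longrightarrow> sect A x \<in> A" "borel_bisection G A \<Longrightarrow> x \<in> t ` A \<Longrightarrow> t (sect A x) = x"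
  by (auto simp: sect_eq)

lemma ltr_eq: "borel_bisection G A \<Longrightarrow> a \<in> A \<Longrightarrow> t g = t a \<Longrightarrow> ltr A g = inv' a \<odot> g"
  by (simp add: ltr_def sect_eq)

lemma rtr_eq: "borel_bisection G A \<Longrightarrow> a \<in> A \<Longrightarrow> s g = t a \<Longrightarrow> rtr A g = g \<odot> a"
  by (simp add: rtr_def sect_eq)

text \<open>The preimage of a Borel set under the section is an image under \<open>t\<close> of a
  Borel subset of \<open>A\<close>, so this rests on Borel images.\<close>

lemma sect_meas: "borel_bisection G A \<Longrightarrow> sect A \<in> restrict_space M (t ` A) \<rightarrow>\<^sub>M M"
proof (rule measurableI)
  assume A: "borel_bisection G A"
  have tA: "t ` A \<in> sets M" using t_image_M bisD(1)[OF A] by blast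
  then have tAc: "t ` A \<subseteq> carr G" using sets.sets_into_space by blast
  show "sect A x \<in> space M" if "x \<in> space (restrict_space M (t ` A))" for x
    using that sect_in[OF A] bisD(4)[OF A] by (auto simp: space_restrict_space)
  fix B assume B: "B \<in> sets M"
  have "sect A -` B \<inter> space (restrict_space M (t ` A)) = t ` (A \<inter> B)"
    using tAc sect_eq[OF A] by (auto simp: space_restrict_space)
  moreover have "t ` (A \<inter> B) \<in> sets M" using t_image_M bisD(1)[OF A] B by blast
  ultimately show "sect A -` B \<inter> space (restrict_space M (t ` A)) \<in> sets (restrict_space M (t ` A))"
    using tA tAc by (auto simp: sets_restrict_space_iff)
qed

lemma ltr_meas: assumes A: "borel_bisection G A" shows "ltr A \<in> M \<rightarrow>\<^sub>M M"
proof -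
  note [measurable] = t_image_M[OF bisD(1)[OF A]]
  define D where "D = {g \<in> space M. t g \<in> t ` A}"
  have D: "D \<in> sets M" "D \<inter> space M \<in> sets M" unfolding D_def by measurable
  have "(\<lambda>g. sect A (t g)) \<in> restrict_space M D \<rightarrow>\<^sub>M M"
  proof (rule measurable_compose[OF _ sect_meas[OF A]])
    show "t \<in> restrict_space M D \<rightarrow>\<^sub>M restrict_space M (t ` A)"
      by (rule measurable_restrict_space3) (auto simp: D_def)
  qed
  then have "(\<lambda>g. inv' (sect A (t g)) \<odot> g) \<in> restrict_space M D \<rightarrow>\<^sub>M M"
    using sect_in[OF A] bisD(4)[OF A]
    by (intro mul_meas measurable_compose[OF _ inv_meas])
       (auto simp: space_restrict_space D_def intro: measurable_restrict_space1)
  then have "(\<lambda>g. if g \<in> D then inv' (sect A (t g)) \<odot> g else g) \<in> M \<rightarrow>\<^sub>M M"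
    using D by (intro measurable_If_restrict_space_iff[THEN iffD2]) (auto intro: measurable_restrict_space1)
  then show ?thesis by (rule measurable_cong[THEN iffD1, rotated]) (simp add: D_def ltr_def)
qed

lemma rtr_meas: assumes A: "borel_bisection G A" shows "rtr A \<in> M \<rightarrow>\<^sub>M M"
proof -
  note [measurable] = t_image_M[OF bisD(1)[OF A]]
  define D where "D = {g \<in> space M. s g \<in> t ` A}"
  have D: "D \<in> sets M" "D \<inter> space M \<in> sets M" unfolding D_def by measurable
  have "(\<lambda>g. sect A (s g)) \<in> restrict_space M D \<rightarrow>\<^sub>M M"
  proof (rule measurable_compose[OF _ sect_meas[OF A]])
    show "s \<in> restrict_space M D \<rightarrow>\<^sub>M restrict_space M (t ` A)"
      by (rule measurable_restrict_space3) (auto simp: D_def)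
  qed
  then have "(\<lambda>g. g \<odot> sect A (s g)) \<in> restrict_space M D \<rightarrow>\<^sub>M M"
    using sect_in[OF A]
    by (intro mul_meas) (auto simp: space_restrict_space D_def intro: measurable_restrict_space1)
  then have "(\<lambda>g. if g \<in> D then g \<odot> sect A (s g) else g) \<in> M \<rightarrow>\<^sub>M M"
    using D by (intro measurable_If_restrict_space_iff[THEN iffD2]) (auto intro: measurable_restrict_space1)
  then show ?thesis by (rule measurable_cong[THEN iffD1, rotated]) (simp add: D_def rtr_def)
qed

lemma set_mul_eq:
  assumes A: "borel_bisection G A" and E: "E \<subseteq> carr G"
  shows "set_mul G A E = {g \<in> space M. t g \<in> t ` A \<and> ltr A g \<in> E}"
proof (intro equalityI subsetI)
  fix g assume "g \<in> set_mul G A E"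
  then obtain a h where h: "a \<in> A" "h \<in> E" "s a = t h" "g = a \<odot> h" by (auto simp: set_mul_def)
  then have "a \<in> carr G" "h \<in> carr G" using bisD(4)[OF A] E by auto
  then show "g \<in> {g \<in> space M. t g \<in> t ` A \<and> ltr A g \<in> E}" using h by (auto simp: ltr_eq[OF A])
next
  fix g assume "g \<in> {g \<in> space M. t g \<in> t ` A \<and> ltr A g \<in> E}"
  then obtain a where a: "a \<in> A" "t g = t a" "ltr A g \<in> E" "g \<in> carr G" by auto
  moreover have "a \<in> carr G" using a bisD(4)[OF A] by auto
  ultimately have "g = a \<odot> ltr A g" "s a = t (ltr A g)" by (auto simp: ltr_eq[OF A])
  then show "g \<in> set_mul G A E" using a unfolding set_mul_def by blast
qed

text \<open>Left translation keeps the source, so it maps each source fibre of the preimage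
  injectively into the same fibre of \<open>E\<close>, and the counts can be compared
  pointwise.\<close>

lemma ltr_emeasure:
  assumes A: "borel_bisection G A" and E: "E \<in> sets M"
  shows "emeasure \<nu> {g \<in> space M. t g \<in> t ` A \<and> ltr A g \<in> E} \<le> emeasure \<nu> E"
proof -
  note [measurable] = t_image_M[OF bisD(1)[OF A]] ltr_meas[OF A]
  define F where "F = {g \<in> space M. t g \<in> t ` A \<and> ltr A g \<in> E}"
  have F: "F \<in> sets M" using E unfolding F_def by measurable
  have "cnt s F x \<le> cnt s E x" for x
    unfolding cnt_def
  proof (rule emeasure_count_space_inj_le)
    have *: "\<exists>a\<in>A. a \<in> carr G \<and> g \<in> carr G \<and> t g = t a \<and> ltr A g = inv' a \<odot> g \<and> inv' a \<odot> g \<in> E" if "g \<in> F" for g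
      using that bisD(4)[OF A] ltr_eq[OF A] unfolding F_def by auto
    show "ltr A ` {g \<in> F. s g = x} \<subseteq> {g \<in> E. s g = x}"
      using * by (fastforce)
    show "inj_on (ltr A) {g \<in> F. s g = x}"
    proof (rule inj_onI)
      fix g h assume g: "g \<in> {g \<in> F. s g = x}" and h: "h \<in> {g \<in> F. s g = x}" and eq: "ltr A g = ltr A h"
      obtain a where a: "a \<in> A" "a \<in> carr G" "g \<in> carr G" "t g = t a" "ltr A g = inv' a \<odot> g" using * g by blast
      obtain b where b: "b \<in> A" "b \<in> carr G" "h \<in> carr G" "t h = t b" "ltr A h = inv' b \<odot> h" using * h by blast
      \<comment> \<open>Equal translates have equal targets, which are the sources of the
        translating elements; injectivity of \<open>s\<close> on \<open>A\<close> identifies these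
        elements.\<close>
      have "t (ltr A g) = s a" "t (ltr A h) = s b" using a b by simp_all
      with eq have "s a = s b" by simp
      then have "a = b" using a b bisD(2)[OF A] by (auto dest: inj_onD)
      then have "a \<odot> (inv' a \<odot> g) = a \<odot> (inv' a \<odot> h)" using a b eq by simp
      then show "g = h" using a b \<open>a = b\<close> mul_inv_cancel[of a g] mul_inv_cancel[of a h] by metis
    qed
  qed
  then show ?thesis unfolding F_def[symmetric] emeasure_\<nu>[OF F] emeasure_\<nu>[OF E]
    by (intro nn_integral_mono)
qed

text \<open>
  Left translations preserve \<open>\<mu>\<^sub>s\<close>; right translation by \<open>E\<close> changes it by a Radon-Nikodym
  derivative, and the bisections for which this derivative is bounded are the ones that act on \<open>L\<^sup>2\<close>.
\<close>

definition bdd_bisection :: "'g set \<Rightarrow> bool" where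
  "bdd_bisection E \<longleftrightarrow> borel_bisection G E \<and>
     (\<exists>C::nat. \<forall>Y\<in>sets \<mu>. emeasure \<mu> (t ` {g \<in> E. s g \<in> Y}) \<le> of_nat C * emeasure \<mu> Y)"

lemma bdd_bisection_units: "Y \<in> sets M \<Longrightarrow> Y \<subseteq> units G \<Longrightarrow> bdd_bisection Y"
  unfolding bdd_bisection_def borel_bisection_def
proof (intro conjI exI[of _ 1] ballI)
  assume Y: "Y \<in> sets M" "Y \<subseteq> units G"
  then show "inj_on s Y" "inj_on t Y" by (auto intro!: inj_onI simp: s_unit t_unit subset_iff)
  fix X assume X: "X \<in> sets \<mu>"
  have "t ` {g \<in> Y. s g \<in> X} \<subseteq> X" using Y by (auto simp: s_unit t_unit subset_iff)
  then show "emeasure \<mu> (t ` {g \<in> Y. s g \<in> X}) \<le> of_nat 1 * emeasure \<mu> X"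
    using X by (auto intro: emeasure_mono)
qed

lemma bis_units: "Y \<in> sets M \<Longrightarrow> Y \<subseteq> units G \<Longrightarrow> borel_bisection G Y"
  using bdd_bisection_units unfolding bdd_bisection_def by blast

text \<open>Translation by \<open>e\<close> carries the fibre over \<open>t e\<close> injectively
  into the fibre over \<open>s e\<close>. Integrating over targets instead of sources costs the
  constant of \<open>bdd_bisection\<close>. That constant is given for sets of units, so the count
  of \<open>F\<close> is first split into indicators of images of pieces.\<close>

lemma rtr_emeasure:
  assumes E: "bdd_bisection E"
  obtains C :: nat where "\<And>F. F \<in> sets M \<Longrightarrow>
    emeasure \<nu> {g \<in> space M. s g \<in> t ` E \<and> rtr E g \<in> F} \<le> of_nat C * emeasure \<nu> F"
proof -
  obtain C :: nat where C: "\<And>Y. Y \<in> sets \<mu> \<Longrightarrow> emeasure \<mu> (t ` {g \<in> E. s g \<in> Y}) \<le> of_nat C * emeasure \<mu> Y"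
    and B: "borel_bisection G E" using E unfolding bdd_bisection_def by blast
  note [measurable] = t_image_M[OF bisD(1)[OF B]] rtr_meas[OF B]
  have "emeasure \<nu> {g \<in> space M. s g \<in> t ` E \<and> rtr E g \<in> F} \<le> of_nat C * emeasure \<nu> F" if F: "F \<in> sets M" for F
  proof -
    define H where "H = {g \<in> space M. s g \<in> t ` E \<and> rtr E g \<in> F}"
    have H: "H \<in> sets M" using F unfolding H_def by measurable
    have Em: "{g \<in> E. s g \<in> Y} \<in> sets M" if "Y \<in> sets \<mu>" for Y
    proof -
      have "{g \<in> E. s g \<in> Y} = E \<inter> {g \<in> space M. s g \<in> Y}" using sets_carr[OF bisD(1)[OF B]] by auto
      moreover have "{g \<in> space M. s g \<in> Y} \<in> sets M" using that by measurable
      ultimately show ?thesis using bisD(1)[OF B] by simp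
    qed
    have "cnt s H x \<le> (\<Sum>n. indicator (t ` {g \<in> E. s g \<in> s ` (F \<inter> piece n)}) x)" for x
    proof (cases "x \<in> t ` E")
      case False
      then have "{g \<in> H. s g = x} = {}" by (auto simp: H_def)
      then show ?thesis by (simp only: cnt_def) simp
    next
      case True
      then obtain e where e: "e \<in> E" "x = t e" "e \<in> carr G" using bisD(4)[OF B] by auto
      have "cnt s H x \<le> cnt s F (s e)" unfolding cnt_def
      proof (rule emeasure_count_space_inj_le)
        have *: "rtr E g = g \<odot> e" if "g \<in> H" "s g = x" for g using that e rtr_eq[OF B] by auto
        show "rtr E ` {g \<in> H. s g = x} \<subseteq> {g \<in> F. s g = s e}"
        proof
          fix k assume "k \<in> rtr E ` {g \<in> H. s g = x}"
          then obtain g where g: "g \<in> H" "s g = x" "k = rtr E g" by blast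
          have "k = g \<odot> e" using *[OF g(1,2)] g(3) by simp
          moreover have "k \<in> F" "g \<in> carr G" using g by (auto simp: H_def)
          ultimately show "k \<in> {g \<in> F. s g = s e}" using g e by simp
        qed
        show "inj_on (rtr E) {g \<in> H. s g = x}"
        proof (rule inj_onI)
          fix g h assume gh: "g \<in> {g \<in> H. s g = x}" "h \<in> {g \<in> H. s g = x}" "rtr E g = rtr E h"
          then have "g \<odot> e \<odot> inv' e = h \<odot> e \<odot> inv' e" using * by simp
          then show "g = h" using gh e by (simp add: H_def)
        qed
      qed
      also have "\<dots> = (\<Sum>n. indicator (s ` (F \<inter> piece n)) (s e))" by (rule cnt_pieces[OF F piece_inj_s])
      also have "\<dots> = (\<Sum>n. indicator (t ` {g \<in> E. s g \<in> s ` (F \<inter> piece n)}) x)"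
      proof (rule suminf_cong)
        fix n
        have "x \<in> t ` {g \<in> E. s g \<in> s ` (F \<inter> piece n)} \<longleftrightarrow> s e \<in> s ` (F \<inter> piece n)"
          using e bisD(3)[OF B] by (auto dest: inj_onD)
        then show "indicator (s ` (F \<inter> piece n)) (s e) = (indicator (t ` {g \<in> E. s g \<in> s ` (F \<inter> piece n)}) x :: ennreal)"
          by (simp add: indicator_def)
      qed
      finally show ?thesis .
    qed
    then have "emeasure \<nu> H \<le> (\<integral>\<^sup>+x. (\<Sum>n. indicator (t ` {g \<in> E. s g \<in> s ` (F \<inter> piece n)}) x) \<partial>\<mu>)"
      unfolding emeasure_\<nu>[OF H] by (rule nn_integral_mono)
    also have "\<dots> = (\<Sum>n. emeasure \<mu> (t ` {g \<in> E. s g \<in> s ` (F \<inter> piece n)}))"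
    proof -
      have "t ` {g \<in> E. s g \<in> s ` (F \<inter> piece n)} \<in> sets \<mu>" for n
        using F by (intro t_image Em s_image) auto
      then show ?thesis by (simp add: nn_integral_suminf)
    qed
    also have "\<dots> \<le> (\<Sum>n. of_nat C * emeasure \<mu> (s ` (F \<inter> piece n)))"
      using F by (intro suminf_le C s_image) auto
    also have "\<dots> = of_nat C * emeasure \<nu> F" using F by (simp add: emeasure_\<nu>_pieces)
    finally show ?thesis unfolding H_def .
  qed
  then show ?thesis using that by blast
qed

text \<open>Transporting \<open>\<mu>\<close> from the targets of \<open>A\<close> to the sources
  gives a measure \<open>\<kappa>\<close>. It is absolutely continuous because null sets of arrows
  can be tested at either end, and its density is finite almost everywhere.\<close>

lemma bdd_bisection_cover_bis:
  assumes A: "borel_bisection G A"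
  shows "\<exists>E. (\<forall>n::nat. bdd_bisection (E n)) \<and> A - (\<Union>n. E n) \<in> null_sets \<nu>"
proof -
  interpret prob_space \<mu> by (rule prob)
  have tA[measurable]: "t ` A \<in> sets \<mu>" by (rule t_image[OF bisD(1)[OF A]])
  note [measurable] = bisD(1)[OF A]
  have Em: "{g \<in> A. s g \<in> Y} \<in> sets M" if "Y \<in> sets \<mu>" for Y
  proof -
    have "{g \<in> A. s g \<in> Y} = A \<inter> {g \<in> space M. s g \<in> Y}" using sets_carr[OF bisD(1)[OF A]] by auto
    moreover have "{g \<in> space M. s g \<in> Y} \<in> sets M" using that by measurable
    ultimately show ?thesis using bisD(1)[OF A] by simp
  qed
  define \<kappa> where "\<kappa> = measure_of (units G) (sets \<mu>) (\<lambda>Y. emeasure \<mu> (t ` {g \<in> A. s g \<in> Y}))"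
  have sets_\<kappa>: "sets \<kappa> = sets \<mu>" and space_\<kappa>: "space \<kappa> = units G"
    unfolding \<kappa>_def using sets.space_closed[of \<mu>] sets.sigma_sets_eq[of \<mu>] by (simp_all add: space_\<mu>)
  have em_\<kappa>: "emeasure \<kappa> Y = emeasure \<mu> (t ` {g \<in> A. s g \<in> Y})" if "Y \<in> sets \<mu>" for Y
  proof (rule emeasure_measure_of[OF \<kappa>_def])
    show "countably_additive (sets \<kappa>) (\<lambda>Y. emeasure \<mu> (t ` {g \<in> A. s g \<in> Y}))"
    proof (rule countably_additiveI)
      fix Y :: "nat \<Rightarrow> 'g set" assume Y: "range Y \<subseteq> sets \<kappa>" "disjoint_family Y"
      have eq: "t ` {g \<in> A. s g \<in> (\<Union>i. Y i)} = (\<Union>i. t ` {g \<in> A. s g \<in> Y i})" by auto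
      have "disjoint_family (\<lambda>i. t ` {g \<in> A. s g \<in> Y i})"
        using Y(2) bisD(3)[OF A] unfolding disjoint_family_on_def by (fastforce dest: inj_onD)
      moreover have "range (\<lambda>i. t ` {g \<in> A. s g \<in> Y i}) \<subseteq> sets \<mu>"
        using Y(1) sets_\<kappa> t_image Em by blast
      ultimately show "(\<Sum>i. emeasure \<mu> (t ` {g \<in> A. s g \<in> Y i})) = emeasure \<mu> (t ` {g \<in> A. s g \<in> (\<Union>i. Y i)})"
        unfolding eq by (intro suminf_emeasure) 
    qed
  qed (use that sets_\<kappa> sets.space_closed[of \<mu>] in \<open>auto simp: positive_def space_\<mu>\<close>)
  have "emeasure \<kappa> (space \<kappa>) \<noteq> \<infinity>"
  proof -
    have "units G \<in> sets \<mu>" using sets.top[of \<mu>] space_\<mu> by simp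
    then show ?thesis using em_\<kappa> space_\<kappa> by simp
  qed
  then interpret \<kappa>: finite_measure \<kappa> by (rule finite_measureI)
  have ac: "absolutely_continuous \<mu> \<kappa>"
    unfolding absolutely_continuous_def
  proof
    fix Y assume Y: "Y \<in> null_sets \<mu>"
    then have Ys: "Y \<in> sets \<mu>" by auto
    have "s ` {g \<in> A. s g \<in> Y} \<in> null_sets \<mu>"
      by (rule null_sets_subset[OF Y s_image[OF Em[OF Ys]]]) auto
    then have "{g \<in> A. s g \<in> Y} \<in> null_sets \<nu>" using Em[OF Ys] by (simp add: null_s)
    then have "t ` {g \<in> A. s g \<in> Y} \<in> null_sets \<mu>" by (simp add: null_t)
    then show "Y \<in> null_sets \<kappa>" using Ys by (auto simp: null_sets_def em_\<kappa> sets_\<kappa>)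
  qed
  define p where "p = RN_deriv \<mu> \<kappa>"
  have p[measurable]: "p \<in> borel_measurable \<mu>" unfolding p_def by simp
  have dens: "density \<mu> p = \<kappa>" unfolding p_def by (rule density_RN_deriv[OF ac sets_\<kappa>])
  have fin: "AE x in \<mu>. p x \<noteq> \<infinity>" unfolding p_def
    by (rule RN_deriv_finite[OF \<kappa>.sigma_finite_measure_axioms ac sets_\<kappa>])
  \<comment> \<open>Over the sources where the density is at most \<open>n\<close>, the bound of
    \<open>bdd_bisection\<close> holds with constant \<open>n\<close>.\<close>
  define E where "E n = {g \<in> A. s g \<in> {x \<in> space \<mu>. p x \<le> of_nat n}}" for n
  have Pm: "{x \<in> space \<mu>. p x \<le> of_nat n} \<in> sets \<mu>" for n by measurable
  have Eb: "borel_bisection G (E n)" for n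
    by (rule bis_subset[OF A]) (use Em[OF Pm] in \<open>auto simp: E_def\<close>)
  have "emeasure \<mu> (t ` {g \<in> E n. s g \<in> Y}) \<le> of_nat n * emeasure \<mu> Y" if Y[measurable]: "Y \<in> sets \<mu>" for Y n
  proof -
    let ?P = "{x \<in> space \<mu>. p x \<le> of_nat n}"
    have "{g \<in> E n. s g \<in> Y} = {g \<in> A. s g \<in> ?P \<inter> Y}" by (auto simp: E_def)
    then have "emeasure \<mu> (t ` {g \<in> E n. s g \<in> Y}) = emeasure (density \<mu> p) (?P \<inter> Y)"
      unfolding dens using Pm Y by (simp add: em_\<kappa>)
    also have "\<dots> = (\<integral>\<^sup>+x. p x * indicator (?P \<inter> Y) x \<partial>\<mu>)" by (rule emeasure_density) measurable
    also have "\<dots> \<le> (\<integral>\<^sup>+x. of_nat n * indicator Y x \<partial>\<mu>)"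
      by (intro nn_integral_mono) (auto simp: indicator_def)
    also have "\<dots> = of_nat n * emeasure \<mu> Y" by (simp add: nn_integral_cmult_indicator)
    finally show ?thesis .
  qed
  then have "bdd_bisection (E n)" for n unfolding bdd_bisection_def using Eb by blast
  moreover have "A - (\<Union>n. E n) \<in> null_sets \<nu>"
  proof -
    have m: "A - (\<Union>n. E n) \<in> sets M" using bisD(1)[OF Eb] bisD(1)[OF A] by blast
    have "{x \<in> space \<mu>. p x = \<infinity>} \<in> null_sets \<mu>"
      using fin by (subst (asm) AE_iff_null) auto
    moreover have "s ` (A - (\<Union>n. E n)) \<subseteq> {x \<in> space \<mu>. p x = \<infinity>}"
    proof
      fix x assume "x \<in> s ` (A - (\<Union>n. E n))"
      then obtain g where g: "x = s g" "g \<in> A" "\<And>n. g \<notin> E n" by blast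
      have x: "x \<in> space \<mu>" using g bisD(4)[OF A] by (simp add: space_\<mu>)
      then have "\<not> p x \<le> of_nat n" for n using g by (auto simp: E_def)
      have "p x = \<infinity>"
      proof (rule ccontr)
        assume "p x \<noteq> \<infinity>"
        then obtain n where "p x < of_nat n" using ennreal_Ex_less_of_nat[of "p x"] by (auto simp: less_top)
        then show False using \<open>\<And>n. \<not> p x \<le> of_nat n\<close>[of n] by simp
      qed
      then show "x \<in> {x \<in> space \<mu>. p x = \<infinity>}" using x by simp
    qed
    ultimately have "s ` (A - (\<Union>n. E n)) \<in> null_sets \<mu>"
      using s_image[OF m] null_sets_subset by blast
    then show ?thesis using m by (simp add: null_s)
  qed
  ultimately show ?thesis by blast
qed

lemma bdd_bisection_cover:
  obtains E :: "nat \<Rightarrow> 'g set" where "\<And>n. bdd_bisection (E n)" "carr G - (\<Union>n. E n) \<in> null_sets \<nu>"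
proof -
  have "\<exists>E. (\<forall>n::nat. bdd_bisection (E n)) \<and> piece m - (\<Union>n. E n) \<in> null_sets \<nu>" for m
    by (rule bdd_bisection_cover_bis[OF piece_bis])
  then obtain E where E: "\<And>m n::nat. bdd_bisection (E m n)" "\<And>m. piece m - (\<Union>n. E m n) \<in> null_sets \<nu>"
    by metis
  define E' where "E' k = E (fst (prod_decode k)) (snd (prod_decode k))" for k
  have "(\<Union>k. E' k) = (\<Union>m n. E m n)"
  proof (intro equalityI subsetI)
    fix x assume "x \<in> (\<Union>m n. E m n)"
    then obtain m n where "x \<in> E' (prod_encode (m, n))" by (auto simp: E'_def)
    then show "x \<in> (\<Union>k. E' k)" by blast
  qed (auto simp: E'_def)
  then have "carr G - (\<Union>k. E' k) \<subseteq> (\<Union>m. piece m - (\<Union>n. E m n))"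
    using piece_ex by fastforce
  moreover have "(\<Union>m. piece m - (\<Union>n. E m n)) \<in> null_sets \<nu>" using E(2) by (intro null_sets_UN) auto
  moreover have "E' k \<in> sets M" for k using E(1) bisD(1) by (simp add: E'_def bdd_bisection_def)
  then have "carr G - (\<Union>k. E' k) \<in> sets \<nu>" by simp
  ultimately have "carr G - (\<Union>k. E' k) \<in> null_sets \<nu>" using null_sets_subset by blast
  moreover have "bdd_bisection (E' k)" for k using E(1) by (simp add: E'_def)
  ultimately show ?thesis using that by blast
qed

section \<open>Conjugation on the isotropy\<close>

definition cj :: "'g \<Rightarrow> 'g \<Rightarrow> 'g" where
  "cj g h = g \<odot> h \<odot> inv' g"

lemma IsoD: "h \<in> Iso G \<Longrightarrow> h \<in> carr G" "h \<in> Iso G \<Longrightarrow> s h = t h"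
  by (auto simp: Iso_def)

lemma cj_Iso:
  assumes "h \<in> Iso G" "g \<in> carr G" "s g = t h"
  shows "cj g h \<in> Iso G" "s (cj g h) = t g" "t (cj g h) = t g" "cj (inv' g) (cj g h) = h"
    "cj g h \<odot> g = g \<odot> h"
  using assms IsoD[OF assms(1)] mul_s[of h] by (auto simp: cj_def Iso_def mul_assoc)

text \<open>Both sides have the same product with \<open>k \<odot> g\<close> on the right, and this
  factor cancels.\<close>

lemma cj_comp:
  assumes "h \<in> Iso G" "g \<in> carr G" "s g = t h" "k \<in> carr G" "s k = t g"
  shows "cj k (cj g h) = cj (k \<odot> g) h"
proof -
  have kg: "k \<odot> g \<in> carr G" "s (k \<odot> g) = t h" using assms by auto
  note a = cj_Iso[OF assms(1,2,3)] note b = cj_Iso[OF a(1) assms(4)] note c = cj_Iso[OF assms(1) kg]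
  have "cj k (cj g h) \<odot> (k \<odot> g) = (cj k (cj g h) \<odot> k) \<odot> g"
    using assms a b by (intro mul_assoc[symmetric]) (auto simp: Iso_def)
  also have "\<dots> = k \<odot> cj g h \<odot> g" using a b assms by simp
  also have "\<dots> = k \<odot> (cj g h \<odot> g)" using a b assms by (intro mul_assoc) (auto simp: Iso_def)
  also have "\<dots> = k \<odot> (g \<odot> h)" using a by simp
  also have "\<dots> = cj (k \<odot> g) h \<odot> (k \<odot> g)" using c(5) assms IsoD[OF assms(1)] by (simp add: mul_assoc)
  finally have eq: "cj k (cj g h) \<odot> (k \<odot> g) = cj (k \<odot> g) h \<odot> (k \<odot> g)" .
  have "cj k (cj g h) = cj k (cj g h) \<odot> (k \<odot> g) \<odot> inv' (k \<odot> g)"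
    using a b assms kg by (intro mul_mul_inv[symmetric]) (auto simp: Iso_def)
  also have "\<dots> = cj (k \<odot> g) h"
    unfolding eq using c assms kg by (intro mul_mul_inv) (auto simp: Iso_def)
  finally show ?thesis .
qed

lemma conj_class_eq: "A \<subseteq> Iso G \<Longrightarrow> conj_class G A = {cj g a |g a. a \<in> A \<and> g \<in> carr G \<and> s g = t a}"
  by (simp add: conj_class_def cj_def)

lemma conj_class_Iso: "A \<subseteq> Iso G \<Longrightarrow> conj_class G A \<subseteq> Iso G"
  using cj_Iso by (auto simp: conj_class_eq)

lemma conj_class_super: "A \<subseteq> Iso G \<Longrightarrow> A \<subseteq> conj_class G A"
proof
  fix a assume "A \<subseteq> Iso G" "a \<in> A"
  moreover then have a: "a \<in> carr G" "s a = t a" using IsoD by auto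
  moreover have "inv' (t a) = t a"
  proof -
    have u: "t a \<in> units G" "t a \<in> carr G" using a units_carr by auto
    then have "inv' (t a) \<odot> t a = t a" using inv_l[of "t a"] by (simp add: s_unit)
    moreover have "inv' (t a) \<odot> t a = inv' (t a)" using u mul_s[of "inv' (t a)"] by (simp add: t_unit)
    ultimately show ?thesis by simp
  qed
  then have "cj (t a) a = a" using a mul_s[of a] by (simp add: cj_def)
  moreover have "t a \<in> carr G" "s (t a) = t a" using a units_carr by (auto simp: s_unit)
  ultimately show "a \<in> conj_class G A" unfolding conj_class_eq[OF \<open>A \<subseteq> Iso G\<close>]
    by (intro CollectI exI[of _ "t a"] exI[of _ a]) simp
qed

lemma conj_class_invariant:
  assumes "A \<subseteq> Iso G" "h \<in> conj_class G A" "g \<in> carr G" "s g = t h"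
  shows "cj g h \<in> conj_class G A"
proof -
  obtain k a where k: "h = cj k a" "a \<in> A" "k \<in> carr G" "s k = t a" using assms by (auto simp: conj_class_eq)
  have a: "a \<in> Iso G" using k assms by auto
  have "s g = t k" using assms(4) k cj_Iso(3)[OF a] by simp
  then have "cj g h = cj (g \<odot> k) a" "g \<odot> k \<in> carr G" "s (g \<odot> k) = t a"
    using k cj_comp[OF a] assms by auto
  then show ?thesis unfolding conj_class_eq[OF assms(1)] using k by blast
qed

text \<open>Within one piece the conjugating arrow is determined by its target, hence is a Borel
  function of \<open>h\<close>. The class thus becomes a countable union of Borel preimages of
  \<open>A\<close>, instead of an image.\<close>

lemma conj_class_sets:
  assumes A: "A \<in> sets M" "A \<subseteq> Iso G"
  shows "conj_class G A \<in> sets M"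
proof -
  note [measurable] = A(1) t_image_M[OF piece_meas] ltr_meas[OF piece_bis] rtr_meas[OF piece_bis]
  have "conj_class G A = (\<Union>n. {h \<in> space M. h \<in> Iso G \<and> t h \<in> t ` piece n \<and> rtr (piece n) (ltr (piece n) h) \<in> A})"
  proof (intro equalityI subsetI)
    fix h assume "h \<in> conj_class G A"
    then obtain g a where g: "h = cj g a" "a \<in> A" "g \<in> carr G" "s g = t a" using A by (auto simp: conj_class_eq)
    have a: "a \<in> Iso G" using g A by auto
    note h = cj_Iso[OF a g(3,4)]
    obtain n where n: "g \<in> piece n" using piece_ex g by blast
    have "ltr (piece n) h = inv' g \<odot> h" using g n h by (intro ltr_eq[OF piece_bis]) auto
    moreover have "s (inv' g \<odot> h) = t g" using g h IsoD[OF h(1)] by simp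
    then have "rtr (piece n) (inv' g \<odot> h) = inv' g \<odot> h \<odot> g" by (rule rtr_eq[OF piece_bis n])
    moreover have "\<dots> = a" using h(4) g by (simp add: cj_def)
    ultimately have "rtr (piece n) (ltr (piece n) h) \<in> A" using g by simp
    then show "h \<in> (\<Union>n. {h \<in> space M. h \<in> Iso G \<and> t h \<in> t ` piece n \<and> rtr (piece n) (ltr (piece n) h) \<in> A})"
      using g h n IsoD[OF h(1)] by auto
  next
    fix h assume "h \<in> (\<Union>n. {h \<in> space M. h \<in> Iso G \<and> t h \<in> t ` piece n \<and> rtr (piece n) (ltr (piece n) h) \<in> A})"
    then obtain n g where h: "h \<in> Iso G" "g \<in> piece n" "t h = t g" "rtr (piece n) (ltr (piece n) h) \<in> A" by auto
    have g: "g \<in> carr G" using h sets_carr[OF piece_meas] by blast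
    note hh = IsoD[OF h(1)]
    have "ltr (piece n) h = inv' g \<odot> h" using h by (intro ltr_eq[OF piece_bis]) auto
    moreover have sh: "s (inv' g \<odot> h) = t g" using g h hh by simp
    then have "rtr (piece n) (inv' g \<odot> h) = inv' g \<odot> h \<odot> g" by (rule rtr_eq[OF piece_bis h(2)])
    ultimately have a: "inv' g \<odot> h \<odot> g \<in> A" using h by simp
    have "cj (inv' g) h = inv' g \<odot> h \<odot> g" using g by (simp add: cj_def)
    moreover have "cj g (cj (inv' g) h) = h" using cj_Iso(4)[OF h(1), of "inv' g"] g h by simp
    moreover have "t (cj (inv' g) h) = s g" using cj_Iso(3)[OF h(1), of "inv' g"] g h by simp
    ultimately show "h \<in> conj_class G A" unfolding conj_class_eq[OF A(2)]
      using a g by (intro CollectI exI[of _ g] exI[of _ "inv' g \<odot> h \<odot> g"]) simp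
  qed
  also have "\<dots> \<in> sets M" by measurable
  finally show ?thesis .
qed

text \<open>Conjugation by \<open>g\<close> maps the fibre over \<open>s g\<close> injectively into
  the one over \<open>t g\<close>, and the inverse of \<open>g\<close> leads back.\<close>

lemma cnt_conj_invariant:
  assumes K: "K \<subseteq> Iso G" and inv: "\<And>h g. h \<in> K \<Longrightarrow> g \<in> carr G \<Longrightarrow> s g = t h \<Longrightarrow> cj g h \<in> K"
    and g: "g \<in> carr G"
  shows "cnt s K (s g) = cnt s K (t g)"
proof -
  have le: "cnt s K (s g) \<le> cnt s K (t g)" if g: "g \<in> carr G" for g
    unfolding cnt_def
  proof (rule emeasure_count_space_inj_le)
    have *: "h \<in> Iso G" "s g = t h" if "h \<in> K" "s h = s g" for h 
    proof -
      show "h \<in> Iso G" using that K by blast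
      then show "s g = t h" using that IsoD(2)[of h] by simp
    qed
    show "cj g ` {h \<in> K. s h = s g} \<subseteq> {h \<in> K. s h = t g}"
      using * inv g cj_Iso by auto
    show "inj_on (cj g) {h \<in> K. s h = s g}"
      by (rule inj_on_inverseI[of _ "cj (inv' g)"]) (use * g cj_Iso in auto)
  qed
  show ?thesis using le[OF g] le[of "inv' g"] g by (simp add: antisym)
qed

end

section \<open>Operators on square integrable functions\<close>

lemma sq_integrableI:
  assumes "f \<in> borel_measurable N" "g \<in> sq_integrable N" "AE x in N. cmod (f x) \<le> c * cmod (g x)"
  shows "f \<in> sq_integrable N"
proof -
  have "integrable N (\<lambda>x. c\<^sup>2 * (cmod (g x))\<^sup>2)" using assms(2) by (simp add: sq_integrable_def)
  moreover have "AE x in N. norm ((cmod (f x))\<^sup>2) \<le> norm (c\<^sup>2 * (cmod (g x))\<^sup>2)"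
    using assms(3)
  proof eventually_elim
    case (elim x)
    then have "(cmod (f x))\<^sup>2 \<le> (c * cmod (g x))\<^sup>2" by (intro power_mono) auto
    then show ?case by (simp add: power_mult_distrib)
  qed
  moreover have "(\<lambda>x. (cmod (f x))\<^sup>2) \<in> borel_measurable N" using assms(1) by simp
  ultimately show ?thesis using assms(1) Bochner_Integration.integrable_bound
    unfolding sq_integrable_def by blast
qed

lemma sq_meas: "f \<in> sq_integrable N \<Longrightarrow> f \<in> borel_measurable N"
  and sq_int: "f \<in> sq_integrable N \<Longrightarrow> integrable N (\<lambda>x. (cmod (f x))\<^sup>2)"
  by (simp_all add: sq_integrable_def)

text \<open>Takes the place of the triangle inequality in squared norms; the factor 2 is harmless
  where only boundedness and limits matter.\<close>

lemma cmod_add_sq: "(cmod (a + b))\<^sup>2 \<le> 2 * (cmod a)\<^sup>2 + 2 * (cmod b)\<^sup>2"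
proof -
  have "(cmod (a + b))\<^sup>2 \<le> (cmod a + cmod b)\<^sup>2" by (intro power_mono norm_triangle_ineq) auto
  moreover have "0 \<le> (cmod a - cmod b)\<^sup>2" by simp
  ultimately show ?thesis by (simp add: power2_sum power2_diff)
qed

lemma sq_add: assumes "f \<in> sq_integrable N" "g \<in> sq_integrable N"
  shows "(\<lambda>x. f x + g x) \<in> sq_integrable N"
proof -
  note [measurable] = sq_meas[OF assms(1)] sq_meas[OF assms(2)]
  have "integrable N (\<lambda>x. 2 * (cmod (f x))\<^sup>2 + 2 * (cmod (g x))\<^sup>2)" using assms by (simp add: sq_int)
  then have "integrable N (\<lambda>x. (cmod (f x + g x))\<^sup>2)"
    by (rule Bochner_Integration.integrable_bound) (use cmod_add_sq in auto)
  then show ?thesis unfolding sq_integrable_def by simp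
qed

lemma sq_scale:
  assumes f: "f \<in> sq_integrable N" shows "(\<lambda>x. c * f x) \<in> sq_integrable N"
proof -
  note [measurable] = sq_meas[OF f]
  show ?thesis by (rule sq_integrableI[OF _ f, of _ "cmod c"]) (auto simp: norm_mult)
qed

lemma sq_diff: "f \<in> sq_integrable N \<Longrightarrow> g \<in> sq_integrable N \<Longrightarrow> (\<lambda>x. f x - g x) \<in> sq_integrable N"
  using sq_add[of f N "\<lambda>x. (- 1) * g x"] sq_scale[of g N "-1"] by simp

lemma sq_zero: "(\<lambda>x. 0) \<in> sq_integrable N"
  by (simp add: sq_integrable_def)

lemma sq_sum: "(\<And>i. i \<in> I \<Longrightarrow> f i \<in> sq_integrable N) \<Longrightarrow> (\<lambda>x. \<Sum>i\<in>I. f i x) \<in> sq_integrable N"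
  by (induction I rule: infinite_finite_induct) (auto intro: sq_add sq_zero)

lemma sq_indicator: "E \<in> sets N \<Longrightarrow> emeasure N E < \<infinity> \<Longrightarrow> indicator E \<in> sq_integrable N"
proof -
  assume E: "E \<in> sets N" "emeasure N E < \<infinity>"
  have "(\<lambda>x. (cmod (indicator E x))\<^sup>2) = (indicator E :: _ \<Rightarrow> real)" by (auto simp: indicator_def)
  then show ?thesis using E by (simp add: sq_integrable_def)
qed

lemma equiv_ae: "equiv (sq_integrable N) (ae_rel N)"
proof (rule equivI)
  show "ae_rel N \<subseteq> sq_integrable N \<times> sq_integrable N" by (auto simp: ae_rel_def)
  show "refl_on (sq_integrable N) (ae_rel N)" by (auto simp: refl_on_def ae_rel_def)
  show "sym (ae_rel N)" by (auto simp: sym_def ae_rel_def elim: eventually_mono)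
  show "trans (ae_rel N)" unfolding trans_def ae_rel_def
    by (auto elim: eventually_elim2)
qed

lemma in_cls: "g \<in> L2_class N f \<longleftrightarrow> f \<in> sq_integrable N \<and> g \<in> sq_integrable N \<and> (AE x in N. f x = g x)"
  by (auto simp: L2_class_def ae_rel_def)

lemma cls_eq_iff:
  "f \<in> sq_integrable N \<Longrightarrow> g \<in> sq_integrable N \<Longrightarrow> L2_class N f = L2_class N g \<longleftrightarrow> (AE x in N. f x = g x)"
  unfolding L2_class_def by (subst eq_equiv_class_iff[OF equiv_ae]) (auto simp: ae_rel_def)

lemma cls_L2: "f \<in> sq_integrable N \<Longrightarrow> L2_class N f \<in> L2 N"
  unfolding L2_def L2_class_def by (rule quotientI)

lemma L2_cases:
  assumes "\<xi> \<in> L2 N" obtains f where "f \<in> sq_integrable N" "\<xi> = L2_class N f"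
  using assms unfolding L2_def L2_class_def by (auto elim: quotientE)

lemma UN_cls:
  assumes f: "f \<in> sq_integrable N" and eq: "\<And>g. g \<in> L2_class N f \<Longrightarrow> F g = F f"
  shows "(\<Union>g\<in>L2_class N f. F g) = F f"
proof -
  have "f \<in> L2_class N f" using f by (simp add: in_cls)
  then show ?thesis using eq by blast
qed

lemma L2_add_cls:
  assumes f: "f \<in> sq_integrable N" and g: "g \<in> sq_integrable N"
  shows "L2_add N (L2_class N f) (L2_class N g) = L2_class N (\<lambda>x. f x + g x)"
proof -
  have 1: "(\<Union>g'\<in>L2_class N g. L2_class N (\<lambda>x. f' x + g' x)) = L2_class N (\<lambda>x. f' x + g x)"
    if f': "f' \<in> sq_integrable N" for f'
  proof (rule UN_cls[OF g])
    fix g' assume "g' \<in> L2_class N g"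
    then have "g' \<in> sq_integrable N" "AE x in N. g x = g' x" by (auto simp: in_cls)
    then show "L2_class N (\<lambda>x. f' x + g' x) = L2_class N (\<lambda>x. f' x + g x)"
      using f' g by (subst cls_eq_iff) (auto intro: sq_add)
  qed
  have "L2_add N (L2_class N f) (L2_class N g) = (\<Union>f'\<in>L2_class N f. L2_class N (\<lambda>x. f' x + g x))"
    unfolding L2_add_def by (intro SUP_cong refl 1) (simp add: in_cls)
  also have "\<dots> = L2_class N (\<lambda>x. f x + g x)"
  proof (rule UN_cls[OF f])
    fix f' assume "f' \<in> L2_class N f"
    then have "f' \<in> sq_integrable N" "AE x in N. f x = f' x" by (auto simp: in_cls)
    then show "L2_class N (\<lambda>x. f' x + g x) = L2_class N (\<lambda>x. f x + g x)"
      using f g by (subst cls_eq_iff) (auto intro: sq_add)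
  qed
  finally show ?thesis .
qed

lemma L2_scale_cls:
  assumes f: "f \<in> sq_integrable N"
  shows "L2_scale N c (L2_class N f) = L2_class N (\<lambda>x. c * f x)"
  unfolding L2_scale_def
proof (rule UN_cls[OF f])
  fix f' assume "f' \<in> L2_class N f"
  then have "f' \<in> sq_integrable N" "AE x in N. f x = f' x" by (auto simp: in_cls)
  moreover from this(2) have "AE x in N. c * f' x = c * f x" by eventually_elim simp
  ultimately show "L2_class N (\<lambda>x. c * f' x) = L2_class N (\<lambda>x. c * f x)"
    using f by (subst cls_eq_iff) (auto intro: sq_scale)
qed

definition sqn :: "'a measure \<Rightarrow> ('a \<Rightarrow> complex) \<Rightarrow> real" where
  "sqn N f = (\<integral>x. (cmod (f x))\<^sup>2 \<partial>N)"

lemma sqn_nonneg: "0 \<le> sqn N f"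
  by (simp add: sqn_def)

lemma sqn_cong: "f \<in> borel_measurable N \<Longrightarrow> g \<in> borel_measurable N \<Longrightarrow> AE x in N. f x = g x \<Longrightarrow> sqn N f = sqn N g"
  unfolding sqn_def by (intro integral_cong_AE) auto

lemma L2_norm_cls:
  assumes f: "f \<in> sq_integrable N"
  shows "L2_norm N (L2_class N f) = sqrt (sqn N f)"
proof -
  have "(\<lambda>f. sqrt (\<integral>x. (cmod (f x))\<^sup>2 \<partial>N)) ` L2_class N f = {sqrt (sqn N f)}"
  proof (intro equalityI subsetI)
    fix r assume "r \<in> (\<lambda>f. sqrt (\<integral>x. (cmod (f x))\<^sup>2 \<partial>N)) ` L2_class N f"
    then obtain g where g: "g \<in> L2_class N f" "r = sqrt (sqn N g)" by (auto simp: sqn_def)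
    then have "sqn N g = sqn N f" by (intro sqn_cong) (auto simp: in_cls sq_meas elim: eventually_mono)
    then show "r \<in> {sqrt (sqn N f)}" using g by simp
  next
    fix r assume "r \<in> {sqrt (sqn N f)}"
    then show "r \<in> (\<lambda>f. sqrt (\<integral>x. (cmod (f x))\<^sup>2 \<partial>N)) ` L2_class N f"
      using f by (intro image_eqI[of _ _ f]) (auto simp: in_cls sqn_def)
  qed
  then show ?thesis by (simp add: L2_norm_def)
qed

lemma sqn_eq_0: "f \<in> sq_integrable N \<Longrightarrow> sqn N f = 0 \<Longrightarrow> AE x in N. f x = 0"
  unfolding sqn_def by (subst (asm) integral_nonneg_eq_0_iff_AE) (auto simp: sq_int)

lemma sqn_add_le:
  assumes "f \<in> sq_integrable N" "g \<in> sq_integrable N"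
  shows "sqn N (\<lambda>x. f x + g x) \<le> 2 * sqn N f + 2 * sqn N g"
proof -
  have "sqn N (\<lambda>x. f x + g x) \<le> (\<integral>x. 2 * (cmod (f x))\<^sup>2 + 2 * (cmod (g x))\<^sup>2 \<partial>N)"
    unfolding sqn_def using assms sq_add[OF assms] by (intro integral_mono cmod_add_sq) (auto simp: sq_int)
  also have "\<dots> = 2 * sqn N f + 2 * sqn N g" using assms by (simp add: sqn_def sq_int)
  finally show ?thesis .
qed

section \<open>Bounded operators in terms of representatives\<close>

lemma op_cases:
  assumes "T \<in> bounded_ops N" "h \<in> sq_integrable N"
  obtains k where "k \<in> sq_integrable N" "T (L2_class N h) = L2_class N k"
proof -
  have "T (L2_class N h) \<in> L2 N" using assms cls_L2 unfolding bounded_ops_def by blast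
  then show ?thesis using that by (elim L2_cases)
qed

lemma op_add:
  assumes "T \<in> bounded_ops N" "h \<in> sq_integrable N" "h' \<in> sq_integrable N"
    "k \<in> sq_integrable N" "k' \<in> sq_integrable N"
    "T (L2_class N h) = L2_class N k" "T (L2_class N h') = L2_class N k'"
  shows "T (L2_class N (\<lambda>x. h x + h' x)) = L2_class N (\<lambda>x. k x + k' x)"
proof -
  have "T (L2_add N (L2_class N h) (L2_class N h')) = L2_add N (T (L2_class N h)) (T (L2_class N h'))"
    using assms(1) cls_L2[OF assms(2)] cls_L2[OF assms(3)] unfolding bounded_ops_def by blast
  then show ?thesis using assms by (simp add: L2_add_cls)
qed

lemma op_scale:
  assumes "T \<in> bounded_ops N" "h \<in> sq_integrable N" "k \<in> sq_integrable N"
    "T (L2_class N h) = L2_class N k"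
  shows "T (L2_class N (\<lambda>x. c * h x)) = L2_class N (\<lambda>x. c * k x)"
proof -
  have "T (L2_scale N c (L2_class N h)) = L2_scale N c (T (L2_class N h))"
    using assms(1) cls_L2[OF assms(2)] unfolding bounded_ops_def by blast
  then show ?thesis using assms by (simp add: L2_scale_cls)
qed

lemma op_diff:
  assumes "T \<in> bounded_ops N" "h \<in> sq_integrable N" "h' \<in> sq_integrable N"
    "k \<in> sq_integrable N" "k' \<in> sq_integrable N"
    "T (L2_class N h) = L2_class N k" "T (L2_class N h') = L2_class N k'"
  shows "T (L2_class N (\<lambda>x. h x - h' x)) = L2_class N (\<lambda>x. k x - k' x)"
  using op_add[OF assms(1,2) sq_scale[OF assms(3)] assms(4) sq_scale[OF assms(5)] assms(6)
    op_scale[OF assms(1,3,5,7)], of "-1"] by simp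

lemma op_sum:
  assumes T: "T \<in> bounded_ops N" and I: "finite I"
    and "\<And>i. i \<in> I \<Longrightarrow> h i \<in> sq_integrable N" "\<And>i. i \<in> I \<Longrightarrow> k i \<in> sq_integrable N"
    and "\<And>i. i \<in> I \<Longrightarrow> T (L2_class N (h i)) = L2_class N (k i)"
  shows "T (L2_class N (\<lambda>x. \<Sum>i\<in>I. c i * h i x)) = L2_class N (\<lambda>x. \<Sum>i\<in>I. c i * k i x)"
  using I assms(3-5)
proof (induction I rule: finite_induct)
  case empty
  \<comment> \<open>That \<open>T\<close> vanishes at 0 comes from homogeneity with factor 0,
    applied to an arbitrary representative of the value.\<close>
  obtain k where k: "k \<in> sq_integrable N" "T (L2_class N (\<lambda>_. 0)) = L2_class N k"
    using op_cases[OF T sq_zero] .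
  from op_scale[OF T sq_zero k, of 0] show ?case by simp
next
  case (insert i I)
  then show ?case
    by (simp, intro op_add[OF T] op_scale[OF T] sq_scale sq_sum) auto
qed

lemma op_bound:
  assumes "T \<in> bounded_ops N"
  shows "\<exists>C. \<forall>h k. h \<in> sq_integrable N \<longrightarrow> k \<in> sq_integrable N \<longrightarrow>
    T (L2_class N h) = L2_class N k \<longrightarrow> sqn N k \<le> C * sqn N h"
proof -
  obtain C where C: "\<forall>\<xi>\<in>L2 N. L2_norm N (T \<xi>) \<le> C * L2_norm N \<xi>"
    using assms unfolding bounded_ops_def by blast
  have "sqn N k \<le> C\<^sup>2 * sqn N h"
    if "h \<in> sq_integrable N" "k \<in> sq_integrable N" "T (L2_class N h) = L2_class N k" for h k
  proof -
    have "sqrt (sqn N k) \<le> C * sqrt (sqn N h)"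
      using C[rule_format, OF cls_L2[OF that(1)]] that by (simp add: L2_norm_cls)
    then have "(sqrt (sqn N k))\<^sup>2 \<le> (C * sqrt (sqn N h))\<^sup>2"
      by (intro power_mono) (simp_all add: sqn_nonneg)
    then show ?thesis by (simp add: power_mult_distrib sqn_nonneg)
  qed
  then show ?thesis by blast
qed

lemma sqn_dominated:
  assumes [measurable]: "\<And>i::nat. h i \<in> borel_measurable N" "f \<in> borel_measurable N"
    and w: "w \<in> sq_integrable N" and le: "\<And>i. AE x in N. cmod (h i x) \<le> cmod (w x)"
    and lim: "AE x in N. (\<lambda>i. h i x) \<longlonglongrightarrow> f x"
  shows "f \<in> sq_integrable N" "\<And>i. h i \<in> sq_integrable N"
    "(\<lambda>i. sqn N (\<lambda>x. h i x - f x)) \<longlonglongrightarrow> 0"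
proof -
  have le': "AE x in N. \<forall>i. cmod (h i x) \<le> cmod (w x)" using le by (simp add: AE_all_countable)
  with lim have f_le: "AE x in N. cmod (f x) \<le> cmod (w x)"
  proof eventually_elim
    case (elim x)
    then show ?case by (intro LIMSEQ_le_const2[OF tendsto_norm[OF elim(1)]]) auto
  qed
  show "f \<in> sq_integrable N" by (rule sq_integrableI[of _ _ w 1]) (use f_le w in auto)
  show "h i \<in> sq_integrable N" for i by (rule sq_integrableI[of _ _ w 1]) (use le w in auto)
  have "(\<lambda>i. \<integral>x. (cmod (h i x - f x))\<^sup>2 \<partial>N) \<longlonglongrightarrow> (\<integral>x. 0 \<partial>N)"
  \<comment> \<open>\<open>h i\<close> and the limit are both bounded by \<open>w\<close>, so their
    distance is at most twice that, which is squared here.\<close>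
  proof (rule integral_dominated_convergence[where w = "\<lambda>x. 4 * (cmod (w x))\<^sup>2"])
    show "integrable N (\<lambda>x. 4 * (cmod (w x))\<^sup>2)" using w by (simp add: sq_int)
    show "AE x in N. (\<lambda>i. (cmod (h i x - f x))\<^sup>2) \<longlonglongrightarrow> 0"
      using lim
    proof eventually_elim
      case (elim x)
      have "(\<lambda>i. (cmod (h i x - f x))\<^sup>2) \<longlonglongrightarrow> (cmod (f x - f x))\<^sup>2" by (intro tendsto_intros elim)
      then show ?case by simp
    qed
    show "AE x in N. norm ((cmod (h i x - f x))\<^sup>2) \<le> 4 * (cmod (w x))\<^sup>2" for i
      using le[of i] f_le
    proof eventually_elim
      case (elim x)
      have "cmod (h i x - f x) \<le> cmod (w x) + cmod (w x)"
        using norm_triangle_ineq4[of "h i x" "f x"] elim by simp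
      then have "(cmod (h i x - f x))\<^sup>2 \<le> (2 * cmod (w x))\<^sup>2" by (intro power_mono) auto
      then show ?case by (simp add: power_mult_distrib)
    qed
  qed auto
  then show "(\<lambda>i. sqn N (\<lambda>x. h i x - f x)) \<longlonglongrightarrow> 0" by (simp add: sqn_def)
qed

text \<open>Boundedness in the form of a closed graph: \<open>k i\<close> tends to \<open>g\<close>
  by assumption, and to the value of \<open>T\<close> at \<open>f\<close> because \<open>h i\<close>
  tends to \<open>f\<close>.\<close>

lemma op_limit:
  assumes T: "T \<in> bounded_ops N"
    and h: "\<And>i::nat. h i \<in> borel_measurable N" "f \<in> borel_measurable N" "w \<in> sq_integrable N"
      "\<And>i. AE x in N. cmod (h i x) \<le> cmod (w x)" "AE x in N. (\<lambda>i. h i x) \<longlonglongrightarrow> f x"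
    and k: "\<And>i. k i \<in> borel_measurable N" "g \<in> borel_measurable N" "w' \<in> sq_integrable N"
      "\<And>i. AE x in N. cmod (k i x) \<le> cmod (w' x)" "AE x in N. (\<lambda>i. k i x) \<longlonglongrightarrow> g x"
    and eq: "\<And>i. T (L2_class N (h i)) = L2_class N (k i)"
  shows "T (L2_class N f) = L2_class N g"
proof -
  note H = sqn_dominated[OF h] note K = sqn_dominated[OF k]
  obtain m where m: "m \<in> sq_integrable N" "T (L2_class N f) = L2_class N m"
    using op_cases[OF T H(1)] .
  obtain C where C: "\<And>h k. h \<in> sq_integrable N \<Longrightarrow> k \<in> sq_integrable N \<Longrightarrow>
    T (L2_class N h) = L2_class N k \<Longrightarrow> sqn N k \<le> C * sqn N h" using op_bound[OF T] by blast
  have le: "sqn N (\<lambda>x. g x - m x) \<le> 2 * (C * sqn N (\<lambda>x. h i x - f x)) + 2 * sqn N (\<lambda>x. k i x - g x)" for i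
  proof -
    have "sqn N (\<lambda>x. (k i x - m x) + (g x - k i x)) \<le> 2 * sqn N (\<lambda>x. k i x - m x) + 2 * sqn N (\<lambda>x. g x - k i x)"
      using K m by (intro sqn_add_le sq_diff) auto
    moreover have "sqn N (\<lambda>x. k i x - m x) \<le> C * sqn N (\<lambda>x. h i x - f x)"
      using H K m eq by (intro C op_diff[OF T] sq_diff) auto
    moreover have "sqn N (\<lambda>x. g x - k i x) = sqn N (\<lambda>x. k i x - g x)"
      by (simp add: sqn_def norm_minus_commute)
    ultimately show ?thesis by simp
  qed
  have "(\<lambda>i. 2 * (C * sqn N (\<lambda>x. h i x - f x)) + 2 * sqn N (\<lambda>x. k i x - g x)) \<longlonglongrightarrow> 2 * (C * 0) + 2 * 0"
    by (intro tendsto_intros H K)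
  then have "sqn N (\<lambda>x. g x - m x) \<le> 0" by (intro LIMSEQ_le_const) (use le in auto)
  then have "sqn N (\<lambda>x. g x - m x) = 0" using sqn_nonneg[of N "\<lambda>x. g x - m x"] by simp
  then have "AE x in N. g x - m x = 0" using sqn_eq_0 sq_diff[OF K(1) m(1)] by blast
  then have "L2_class N g = L2_class N m" using K(1) m(1) by (subst cls_eq_iff) auto
  then show ?thesis using m by simp
qed

text \<open>Here the values at \<open>F i\<close> come without any dominated convergence. A common
  representative of the values of \<open>T\<close> and \<open>T'\<close> at \<open>F i\<close> is
  compared with both \<open>m\<close> and \<open>m'\<close>.\<close>

lemma op_eq_limit:
  assumes T: "T \<in> bounded_ops N" and T': "T' \<in> bounded_ops N"
    and F: "\<And>i::nat. F i \<in> borel_measurable N" "f \<in> borel_measurable N" "w \<in> sq_integrable N"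
      "\<And>i. AE x in N. cmod (F i x) \<le> cmod (w x)" "AE x in N. (\<lambda>i. F i x) \<longlonglongrightarrow> f x"
    and F_eq: "\<And>i. T (L2_class N (F i)) = T' (L2_class N (F i))"
  shows "T (L2_class N f) = T' (L2_class N f)"
proof -
  note f = sqn_dominated(1)[OF F] and Fs = sqn_dominated(2)[OF F] and lim = sqn_dominated(3)[OF F]
  obtain m where m: "m \<in> sq_integrable N" "T (L2_class N f) = L2_class N m" using op_cases[OF T f] .
  obtain m' where m': "m' \<in> sq_integrable N" "T' (L2_class N f) = L2_class N m'" using op_cases[OF T' f] .
  obtain C where C: "\<And>h k. h \<in> sq_integrable N \<Longrightarrow> k \<in> sq_integrable N \<Longrightarrow>
    T (L2_class N h) = L2_class N k \<Longrightarrow> sqn N k \<le> C * sqn N h" using op_bound[OF T] by blast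
  obtain C' where C': "\<And>h k. h \<in> sq_integrable N \<Longrightarrow> k \<in> sq_integrable N \<Longrightarrow>
    T' (L2_class N h) = L2_class N k \<Longrightarrow> sqn N k \<le> C' * sqn N h" using op_bound[OF T'] by blast
  have le: "sqn N (\<lambda>x. m x - m' x) \<le> 2 * (C * sqn N (\<lambda>x. F i x - f x)) + 2 * (C' * sqn N (\<lambda>x. F i x - f x))" for i
  proof -
    obtain k where k: "k \<in> sq_integrable N" "T (L2_class N (F i)) = L2_class N k" using op_cases[OF T Fs] .
    have "sqn N (\<lambda>x. (m x - k x) + (k x - m' x)) \<le> 2 * sqn N (\<lambda>x. m x - k x) + 2 * sqn N (\<lambda>x. k x - m' x)"
      using k m m' by (intro sqn_add_le sq_diff)
    moreover have "sqn N (\<lambda>x. m x - k x) = sqn N (\<lambda>x. k x - m x)" by (simp add: sqn_def norm_minus_commute)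
    moreover have "sqn N (\<lambda>x. k x - m x) \<le> C * sqn N (\<lambda>x. F i x - f x)"
      using k m f Fs by (intro C op_diff[OF T] sq_diff) auto
    moreover have "sqn N (\<lambda>x. k x - m' x) \<le> C' * sqn N (\<lambda>x. F i x - f x)"
      using k m' f Fs F_eq by (intro C' op_diff[OF T'] sq_diff) auto
    ultimately show ?thesis by simp
  qed
  have "(\<lambda>i. 2 * (C * sqn N (\<lambda>x. F i x - f x)) + 2 * (C' * sqn N (\<lambda>x. F i x - f x))) \<longlonglongrightarrow> 2 * (C * 0) + 2 * (C' * 0)"
    by (intro tendsto_intros lim)
  then have "sqn N (\<lambda>x. m x - m' x) \<le> 0" by (intro LIMSEQ_le_const) (use le in auto)
  then have "sqn N (\<lambda>x. m x - m' x) = 0" using sqn_nonneg[of N "\<lambda>x. m x - m' x"] by simp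
  then have "AE x in N. m x - m' x = 0" using sqn_eq_0 sq_diff[OF m(1) m'(1)] by blast
  then show ?thesis using m m' by (simp add: cls_eq_iff)
qed

lemma bounded_op_eqI:
  assumes "T \<in> bounded_ops N" "T' \<in> bounded_ops N"
    "\<And>f. f \<in> sq_integrable N \<Longrightarrow> T (L2_class N f) = T' (L2_class N f)"
  shows "T = T'"
proof (rule PiE_ext)
  show "T \<in> L2 N \<rightarrow>\<^sub>E L2 N" "T' \<in> L2 N \<rightarrow>\<^sub>E L2 N" using assms(1,2) unfolding bounded_ops_def by blast+
  show "T \<xi> = T' \<xi>" if "\<xi> \<in> L2 N" for \<xi> using that assms(3) by (auto elim: L2_cases)
qed

lemma simple_sum_eq:
  assumes "simple_function N (F :: 'a \<Rightarrow> complex)" "x \<in> space N"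
  shows "F x = (\<Sum>y\<in>F ` space N. y * indicator (F -` {y} \<inter> space N) x)"
proof -
  have "(\<Sum>y\<in>F ` space N. y * indicator (F -` {y} \<inter> space N) x) = (\<Sum>y\<in>F ` space N. if y = F x then y else 0)"
    using assms by (intro sum.cong) (auto simp: indicator_def)
  then show ?thesis using assms by (simp add: simple_function_def)
qed

text \<open>This is the uniqueness behind the definite description in \<open>lambda_op\<close>.
  Square integrable simple functions are combinations of such indicators, and \<open>f\<close> is a
  limit of simple functions bounded by \<open>2 * cmod (f x)\<close>.\<close>

lemma bounded_op_eq_on_indicators:
  assumes T: "T \<in> bounded_ops N" and T': "T' \<in> bounded_ops N"
    and eq: "\<And>E. E \<in> sets N \<Longrightarrow> emeasure N E < \<infinity> \<Longrightarrow>
      T (L2_class N (indicator E)) = T' (L2_class N (indicator E))"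
  shows "T = T'"
proof (rule bounded_op_eqI[OF T T'])
  fix f assume f: "f \<in> sq_integrable N"
  obtain F where F: "\<And>i. simple_function N (F i)" "\<And>x. x \<in> space N \<Longrightarrow> (\<lambda>i. F i x) \<longlonglongrightarrow> f x"
    "\<And>i x. x \<in> space N \<Longrightarrow> cmod (F i x) \<le> 2 * cmod (f x)"
    using borel_measurable_implies_sequence_metric[OF sq_meas[OF f], of 0] by simp metis
  have Fm: "F i \<in> borel_measurable N" for i using F(1) by (rule borel_measurable_simple_function)
  have Fs: "F i \<in> sq_integrable N" for i
    by (rule sq_integrableI[OF Fm f, of _ 2]) (use F(3) in auto)
  have F_eq: "T (L2_class N (F i)) = T' (L2_class N (F i))" for i
  proof -
    \<comment> \<open>The level set of 0 may have infinite measure; it contributes nothing to the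
      sum and is left out.\<close>
    define Y where "Y = F i ` space N - {0}"
    define A where "A y = F i -` {y} \<inter> space N" for y
    have finY: "finite Y" using F(1)[of i] by (simp add: Y_def simple_function_def)
    have A: "A y \<in> sets N" for y unfolding A_def using Fm[of i] by measurable
    have A_fin: "emeasure N (A y) < \<infinity>" if "y \<noteq> 0" for y
    proof -
      have "integrable N (\<lambda>x. (cmod (F i x))\<^sup>2)" by (rule sq_int[OF Fs])
      moreover have "(\<lambda>x. (cmod y)\<^sup>2 * indicator (A y) x) \<in> borel_measurable N" using A by measurable
      moreover have "AE x in N. norm ((cmod y)\<^sup>2 * indicator (A y) x) \<le> norm ((cmod (F i x))\<^sup>2)"
        by (auto simp: A_def indicator_def)
      ultimately have "integrable N (\<lambda>x. (cmod y)\<^sup>2 * indicator (A y) x)"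
        by (rule Bochner_Integration.integrable_bound)
      then have "integrable N (\<lambda>x. indicator (A y) x :: real)" using that by simp
      then show ?thesis using A by (simp add: integrable_indicator_iff sets.Int_space_eq2 less_top)
    qed
    have As: "indicator (A y) \<in> sq_integrable N" if "y \<in> Y" for y
      using A A_fin that by (intro sq_indicator) (auto simp: Y_def)
    define S where "S x = (\<Sum>y\<in>Y. y * indicator (A y) x)" for x
    have Ss: "S \<in> sq_integrable N" unfolding S_def[abs_def] by (intro sq_sum sq_scale As)
    have "F i x = S x" if x: "x \<in> space N" for x
    proof -
      have "F i x = (\<Sum>y\<in>F i ` space N. y * indicator (A y) x)"
        unfolding A_def by (rule simple_sum_eq[OF F(1) x])
      also have "\<dots> = S x" unfolding S_def Y_def using F(1)[of i]
        by (intro sum.mono_neutral_right) (auto simp: simple_function_def)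
      finally show ?thesis .
    qed
    then have cl: "L2_class N (F i) = L2_class N S" using Fs Ss by (subst cls_eq_iff) auto
    have "\<exists>k. k \<in> sq_integrable N \<and> T (L2_class N (indicator (A y))) = L2_class N k" if "y \<in> Y" for y
      using op_cases[OF T As[OF that]] by metis
    then obtain k where k: "\<And>y. y \<in> Y \<Longrightarrow> k y \<in> sq_integrable N"
      "\<And>y. y \<in> Y \<Longrightarrow> T (L2_class N (indicator (A y))) = L2_class N (k y)" by metis
    have k': "T' (L2_class N (indicator (A y))) = L2_class N (k y)" if "y \<in> Y" for y
      using k(2)[OF that] eq[OF A, of y] A_fin[of y] that by (auto simp: Y_def)
    have "T (L2_class N S) = L2_class N (\<lambda>x. \<Sum>y\<in>Y. y * k y x)"
      unfolding S_def[abs_def] by (rule op_sum[OF T finY As k])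
    moreover have "T' (L2_class N S) = L2_class N (\<lambda>x. \<Sum>y\<in>Y. y * k y x)"
      unfolding S_def[abs_def] by (rule op_sum[OF T' finY As k(1) k'])
    ultimately show ?thesis using cl by simp
  qed
  have w: "(\<lambda>x. 2 * f x) \<in> sq_integrable N" by (rule sq_scale[OF f])
  show "T (L2_class N f) = T' (L2_class N f)"
    by (rule op_eq_limit[where F = F, OF T T' Fm sq_meas[OF f] w _ _ F_eq]) (use F in \<open>auto simp: norm_mult\<close>)
qed

section \<open>Operators given by linear maps on functions\<close>

definition op_of :: "'a measure \<Rightarrow> (('a \<Rightarrow> complex) \<Rightarrow> ('a \<Rightarrow> complex)) \<Rightarrow> 'a L2_op" where
  "op_of N \<Phi> = (\<lambda>\<xi>\<in>L2 N. \<Union>h\<in>\<xi>. L2_class N (\<Phi> h))"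

text \<open>Linearity is asked pointwise and the bound as an inequality of nonnegative integrals, so
  both can be checked before integrability is known. Compatibility with classes then follows from
  the bound.\<close>

definition L2_kernel :: "'a measure \<Rightarrow> (('a \<Rightarrow> complex) \<Rightarrow> ('a \<Rightarrow> complex)) \<Rightarrow> bool" where
  "L2_kernel N \<Phi> \<longleftrightarrow> (\<forall>h\<in>borel_measurable N. \<Phi> h \<in> borel_measurable N) \<and>
     (\<forall>h k. \<Phi> (\<lambda>x. h x + k x) = (\<lambda>x. \<Phi> h x + \<Phi> k x)) \<and>
     (\<forall>c h. \<Phi> (\<lambda>x. c * h x) = (\<lambda>x. c * \<Phi> h x)) \<and>
     (\<exists>C::real. 0 \<le> C \<and> (\<forall>h\<in>borel_measurable N.
        (\<integral>\<^sup>+x. (cmod (\<Phi> h x))\<^sup>2 \<partial>N) \<le> ennreal C * (\<integral>\<^sup>+x. (cmod (h x))\<^sup>2 \<partial>N)))"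

lemma kernelD:
  assumes "L2_kernel N \<Phi>"
  shows "h \<in> borel_measurable N \<Longrightarrow> \<Phi> h \<in> borel_measurable N"
    and "\<Phi> (\<lambda>x. h x + k x) = (\<lambda>x. \<Phi> h x + \<Phi> k x)" and "\<Phi> (\<lambda>x. c * h x) = (\<lambda>x. c * \<Phi> h x)"
  using assms by (simp_all add: L2_kernel_def)

lemma kernel_sq:
  assumes "L2_kernel N \<Phi>"
  shows "h \<in> sq_integrable N \<Longrightarrow> \<Phi> h \<in> sq_integrable N"
    and "\<exists>C\<ge>0. \<forall>h\<in>sq_integrable N. sqn N (\<Phi> h) \<le> C * sqn N h"
proof -
  obtain C :: real where C: "0 \<le> C" "\<And>h. h \<in> borel_measurable N \<Longrightarrow>
      (\<integral>\<^sup>+x. (cmod (\<Phi> h x))\<^sup>2 \<partial>N) \<le> ennreal C * (\<integral>\<^sup>+x. (cmod (h x))\<^sup>2 \<partial>N)"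
    using assms unfolding L2_kernel_def by blast
  have m: "\<Phi> h \<in> borel_measurable N" if "h \<in> borel_measurable N" for h
    by (rule kernelD(1)[OF assms that])
  have le: "(\<integral>\<^sup>+x. (cmod (\<Phi> h x))\<^sup>2 \<partial>N) \<le> ennreal (C * sqn N h)" if h: "h \<in> sq_integrable N" for h
  proof -
    have "(\<integral>\<^sup>+x. (cmod (h x))\<^sup>2 \<partial>N) = ennreal (sqn N h)"
      unfolding sqn_def by (intro nn_integral_eq_integral sq_int h) auto
    then show ?thesis using C(2)[OF sq_meas[OF h]] C(1) by (simp add: ennreal_mult sqn_nonneg)
  qed
  show sq: "\<Phi> h \<in> sq_integrable N" if h: "h \<in> sq_integrable N" for h
  proof -
    have "integrable N (\<lambda>x. (cmod (\<Phi> h x))\<^sup>2)"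
      using m[OF sq_meas[OF h]] le[OF h] by (intro integrableI_bounded) (auto simp: order_le_less_trans)
    then show ?thesis using m[OF sq_meas[OF h]] by (simp add: sq_integrable_def)
  qed
  have "sqn N (\<Phi> h) \<le> C * sqn N h" if h: "h \<in> sq_integrable N" for h
  proof -
    have "(\<integral>\<^sup>+x. (cmod (\<Phi> h x))\<^sup>2 \<partial>N) = ennreal (sqn N (\<Phi> h))"
      unfolding sqn_def by (intro nn_integral_eq_integral sq_int sq h) auto
    then show ?thesis using le[OF h] C(1) by (simp add: sqn_nonneg ennreal_le_iff)
  qed
  then show "\<exists>C\<ge>0. \<forall>h\<in>sq_integrable N. sqn N (\<Phi> h) \<le> C * sqn N h" using C(1) by blast
qed

text \<open>Two representatives differ by a function \<open>d\<close> of norm 0. The bound makes the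
  image of \<open>d\<close> vanish almost everywhere, and by linearity this image is the difference
  of the two images.\<close>

lemma op_of_cls:
  assumes K: "L2_kernel N \<Phi>" and h: "h \<in> sq_integrable N"
  shows "op_of N \<Phi> (L2_class N h) = L2_class N (\<Phi> h)"
proof -
  have "(\<Union>k\<in>L2_class N h. L2_class N (\<Phi> k)) = L2_class N (\<Phi> h)"
  proof (rule UN_cls[OF h])
    fix k assume k: "k \<in> L2_class N h"
    then have ks: "k \<in> sq_integrable N" and ae: "AE x in N. h x = k x" by (auto simp: in_cls)
    obtain C where C: "\<And>h. h \<in> sq_integrable N \<Longrightarrow> sqn N (\<Phi> h) \<le> C * sqn N h"
      using kernel_sq(2)[OF K] by blast
    define d where "d x = k x + (- 1) * h x" for x
    have ds: "d \<in> sq_integrable N" unfolding d_def[abs_def] by (intro sq_add sq_scale ks h)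
    have "sqn N d = sqn N (\<lambda>_. 0)" by (rule sqn_cong) (use sq_meas[OF ds] ae in \<open>auto simp: d_def elim: eventually_mono\<close>)
    then have "sqn N d = 0" by (simp add: sqn_def)
    then have "sqn N (\<Phi> d) = 0" using C[OF ds] sqn_nonneg[of N "\<Phi> d"] by simp
    then have "AE x in N. \<Phi> d x = 0" using sqn_eq_0 kernel_sq(1)[OF K ds] by blast
    moreover have "\<Phi> d = (\<lambda>x. \<Phi> k x + (- 1) * \<Phi> h x)"
    proof -
      show ?thesis unfolding d_def[abs_def] kernelD(2)[OF K, of k "\<lambda>x. - 1 * h x"] kernelD(3)[OF K, of "-1" h] ..
    qed
    ultimately have "AE x in N. \<Phi> k x = \<Phi> h x" by (auto elim: eventually_mono)
    then show "L2_class N (\<Phi> k) = L2_class N (\<Phi> h)"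
      using kernel_sq(1)[OF K] ks h by (subst cls_eq_iff) auto
  qed
  then show ?thesis using cls_L2[OF h] by (simp add: op_of_def)
qed

lemma op_of_bounded:
  assumes K: "L2_kernel N \<Phi>"
  shows "op_of N \<Phi> \<in> bounded_ops N"
proof -
  note sq = kernel_sq(1)[OF K]
  obtain C where C: "0 \<le> C" "\<And>h. h \<in> sq_integrable N \<Longrightarrow> sqn N (\<Phi> h) \<le> C * sqn N h"
    using kernel_sq(2)[OF K] by blast
  have add: "\<Phi> (\<lambda>x. h x + k x) = (\<lambda>x. \<Phi> h x + \<Phi> k x)" and scale: "\<Phi> (\<lambda>x. c * h x) = (\<lambda>x. c * \<Phi> h x)" for h k c
    by (rule kernelD[OF K])+
  show ?thesis unfolding bounded_ops_def
  proof (intro CollectI conjI ballI allI)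
    show "op_of N \<Phi> \<in> L2 N \<rightarrow>\<^sub>E L2 N"
    proof (rule PiE_I)
      show "op_of N \<Phi> \<xi> \<in> L2 N" if "\<xi> \<in> L2 N" for \<xi>
        using that by (elim L2_cases) (simp add: op_of_cls[OF K] cls_L2 sq)
    qed (simp add: op_of_def)
    show "op_of N \<Phi> (L2_add N \<xi> \<eta>) = L2_add N (op_of N \<Phi> \<xi>) (op_of N \<Phi> \<eta>)" if "\<xi> \<in> L2 N" "\<eta> \<in> L2 N" for \<xi> \<eta>
      using that by (elim L2_cases) (simp add: op_of_cls[OF K] L2_add_cls sq sq_add add)
    show "op_of N \<Phi> (L2_scale N c \<xi>) = L2_scale N c (op_of N \<Phi> \<xi>)" if "\<xi> \<in> L2 N" for \<xi> c
      using that by (elim L2_cases) (simp add: op_of_cls[OF K] L2_scale_cls sq sq_scale scale)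
    have "L2_norm N (op_of N \<Phi> \<xi>) \<le> sqrt C * L2_norm N \<xi>" if "\<xi> \<in> L2 N" for \<xi>
      using that
    proof (elim L2_cases)
      fix f assume f: "f \<in> sq_integrable N" "\<xi> = L2_class N f"
      have "sqrt (sqn N (\<Phi> f)) \<le> sqrt (C * sqn N f)" using C(2)[OF f(1)] by (rule real_sqrt_le_mono)
      then show ?thesis using f by (simp add: op_of_cls[OF K] L2_norm_cls sq real_sqrt_mult)
    qed
    then show "\<exists>C. \<forall>\<xi>\<in>L2 N. L2_norm N (op_of N \<Phi> \<xi>) \<le> C * L2_norm N \<xi>" by blast
  qed
qed

lemma kernel_add:
  assumes K: "L2_kernel N \<Phi>" and K': "L2_kernel N \<Psi>"
  shows "L2_kernel N (\<lambda>h x. \<Phi> h x + \<Psi> h x)"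
proof -
  obtain C :: real where C: "0 \<le> C" "\<And>h. h \<in> borel_measurable N \<Longrightarrow>
      (\<integral>\<^sup>+x. (cmod (\<Phi> h x))\<^sup>2 \<partial>N) \<le> ennreal C * (\<integral>\<^sup>+x. (cmod (h x))\<^sup>2 \<partial>N)"
    using K unfolding L2_kernel_def by blast
  obtain D :: real where D: "0 \<le> D" "\<And>h. h \<in> borel_measurable N \<Longrightarrow>
      (\<integral>\<^sup>+x. (cmod (\<Psi> h x))\<^sup>2 \<partial>N) \<le> ennreal D * (\<integral>\<^sup>+x. (cmod (h x))\<^sup>2 \<partial>N)"
    using K' unfolding L2_kernel_def by blast
  have m: "\<Phi> h \<in> borel_measurable N" "\<Psi> h \<in> borel_measurable N" if "h \<in> borel_measurable N" for h
    by (rule kernelD(1)[OF K that] kernelD(1)[OF K' that])+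
  have "(\<integral>\<^sup>+x. (cmod (\<Phi> h x + \<Psi> h x))\<^sup>2 \<partial>N) \<le> ennreal (2 * C + 2 * D) * (\<integral>\<^sup>+x. (cmod (h x))\<^sup>2 \<partial>N)"
    if h: "h \<in> borel_measurable N" for h
  proof -
    note [measurable] = m[OF h]
    have "(\<integral>\<^sup>+x. (cmod (\<Phi> h x + \<Psi> h x))\<^sup>2 \<partial>N) \<le> (\<integral>\<^sup>+x. 2 * ennreal ((cmod (\<Phi> h x))\<^sup>2) + 2 * ennreal ((cmod (\<Psi> h x))\<^sup>2) \<partial>N)"
    proof (rule nn_integral_mono)
      fix x
      have "ennreal ((cmod (\<Phi> h x + \<Psi> h x))\<^sup>2) \<le> ennreal (2 * (cmod (\<Phi> h x))\<^sup>2 + 2 * (cmod (\<Psi> h x))\<^sup>2)"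
        by (intro ennreal_leI cmod_add_sq)
      then show "ennreal ((cmod (\<Phi> h x + \<Psi> h x))\<^sup>2) \<le> 2 * ennreal ((cmod (\<Phi> h x))\<^sup>2) + 2 * ennreal ((cmod (\<Psi> h x))\<^sup>2)"
        by (simp add: ennreal_plus ennreal_mult)
    qed
    also have "\<dots> = 2 * (\<integral>\<^sup>+x. (cmod (\<Phi> h x))\<^sup>2 \<partial>N) + 2 * (\<integral>\<^sup>+x. (cmod (\<Psi> h x))\<^sup>2 \<partial>N)"
      by (simp add: nn_integral_add nn_integral_cmult)
    also have "\<dots> \<le> 2 * (ennreal C * (\<integral>\<^sup>+x. (cmod (h x))\<^sup>2 \<partial>N)) + 2 * (ennreal D * (\<integral>\<^sup>+x. (cmod (h x))\<^sup>2 \<partial>N))"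
      using C(2)[OF h] D(2)[OF h] by (intro add_mono mult_left_mono) auto
    also have "\<dots> = ennreal (2 * C + 2 * D) * (\<integral>\<^sup>+x. (cmod (h x))\<^sup>2 \<partial>N)"
      using C(1) D(1) by (simp add: ennreal_plus ennreal_mult distrib_right mult.assoc)
    finally show ?thesis .
  qed
  moreover have "0 \<le> 2 * C + 2 * D" using C(1) D(1) by simp
  moreover have "\<Phi> (\<lambda>x. h x + k x) = (\<lambda>x. \<Phi> h x + \<Phi> k x)" "\<Psi> (\<lambda>x. h x + k x) = (\<lambda>x. \<Psi> h x + \<Psi> k x)"
     "\<Phi> (\<lambda>x. c * h x) = (\<lambda>x. c * \<Phi> h x)" "\<Psi> (\<lambda>x. c * h x) = (\<lambda>x. c * \<Psi> h x)" for h k c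
    by (rule kernelD[OF K] kernelD[OF K'])+
  ultimately show ?thesis unfolding L2_kernel_def using m
    by (intro conjI exI[of _ "2 * C + 2 * D"]) (auto simp: algebra_simps)
qed

lemma kernel_zero: "L2_kernel N (\<lambda>h x. 0)"
  unfolding L2_kernel_def by auto

lemma kernel_sum: "(\<And>i. i \<in> I \<Longrightarrow> L2_kernel N (\<Phi> i)) \<Longrightarrow> L2_kernel N (\<lambda>h x. \<Sum>i\<in>I. \<Phi> i h x)"
  by (induction I rule: infinite_finite_induct) (auto intro: kernel_add kernel_zero)

lemma kernel_mult:
  assumes [measurable]: "f \<in> borel_measurable N" and C: "AE x in N. cmod (f x) \<le> C"
  shows "L2_kernel N (\<lambda>h x. f x * h x)"
  unfolding L2_kernel_def
proof (intro conjI exI[of _ "C\<^sup>2"] ballI allI)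
  fix h :: "'a \<Rightarrow> complex" assume [measurable]: "h \<in> borel_measurable N"
  have "(\<integral>\<^sup>+x. (cmod (f x * h x))\<^sup>2 \<partial>N) \<le> (\<integral>\<^sup>+x. ennreal (C\<^sup>2) * (cmod (h x))\<^sup>2 \<partial>N)"
  proof (rule nn_integral_mono_AE)
    show "AE x in N. ennreal ((cmod (f x * h x))\<^sup>2) \<le> ennreal (C\<^sup>2) * ennreal ((cmod (h x))\<^sup>2)"
      using C
    proof eventually_elim
      case (elim x)
      have "(cmod (f x * h x))\<^sup>2 \<le> C\<^sup>2 * (cmod (h x))\<^sup>2"
        unfolding norm_mult power_mult_distrib by (intro mult_right_mono power_mono elim) auto
      then have "ennreal ((cmod (f x * h x))\<^sup>2) \<le> ennreal (C\<^sup>2 * (cmod (h x))\<^sup>2)" by (rule ennreal_leI)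
      then show ?case by (simp add: ennreal_mult)
    qed
  qed
  also have "\<dots> = ennreal (C\<^sup>2) * (\<integral>\<^sup>+x. (cmod (h x))\<^sup>2 \<partial>N)" by (simp add: nn_integral_cmult)
  finally show "(\<integral>\<^sup>+x. (cmod (f x * h x))\<^sup>2 \<partial>N) \<le> ennreal (C\<^sup>2) * (\<integral>\<^sup>+x. (cmod (h x))\<^sup>2 \<partial>N)" .
qed (auto simp: algebra_simps)

text \<open>The estimate on sets says that the image under \<open>L\<close> of the measure
  restricted to \<open>D\<close> is at most \<open>C\<close> times \<open>N\<close>. Monotonicity of
  the integral in the measure extends it to the functions
  \<open>(cmod (h x))\<^sup>2\<close>.\<close>

lemma kernel_translation:
  assumes D[measurable]: "D \<in> sets N" and L[measurable]: "L \<in> N \<rightarrow>\<^sub>M N"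
    and C: "\<And>E. E \<in> sets N \<Longrightarrow> emeasure N {x \<in> D. L x \<in> E} \<le> of_nat C * emeasure N E"
  shows "L2_kernel N (\<lambda>h x. if x \<in> D then h (L x) else 0)"
  unfolding L2_kernel_def
proof (intro conjI exI[of _ "of_nat C"] ballI allI)
  have Dsp: "D \<subseteq> space N" using D sets.sets_into_space by blast
  fix h :: "'a \<Rightarrow> complex" assume h[measurable]: "h \<in> borel_measurable N"
  define u where "u x = ennreal ((cmod (h x))\<^sup>2)" for x
  have [measurable]: "u \<in> borel_measurable N" unfolding u_def[abs_def] by measurable
  define K where "K = distr (density N (indicator D)) N L"
  have K: "sets K = sets N" by (simp add: K_def)
  have "K \<le> scale_measure (of_nat C) N"
  proof (subst le_measure, simp add: K, intro ballI)
    fix E assume "E \<in> sets K"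
    then have E[measurable]: "E \<in> sets N" by (simp add: K)
    have "emeasure K E = emeasure (density N (indicator D)) (L -` E \<inter> space N)"
      by (simp add: K_def emeasure_distr)
    also have "\<dots> = emeasure N (D \<inter> (L -` E \<inter> space N))"
      by (subst emeasure_density) (auto simp: nn_integral_indicator indicator_inter_arith[symmetric] intro!: measurable_sets)
    also have "D \<inter> (L -` E \<inter> space N) = {x \<in> D. L x \<in> E}" using Dsp by auto
    finally show "emeasure K E \<le> emeasure (scale_measure (of_nat C) N) E" using C[OF E] by simp
  qed
  then have "(\<integral>\<^sup>+x. u x \<partial>K) \<le> (\<integral>\<^sup>+x. u x \<partial>scale_measure (of_nat C) N)"
    by (intro nn_integral_mono_measure) (auto simp: K)
  also have "\<dots> = of_nat C * (\<integral>\<^sup>+x. u x \<partial>N)" by (rule nn_integral_scale_measure) simp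
  finally have "(\<integral>\<^sup>+x. indicator D x * u (L x) \<partial>N) \<le> of_nat C * (\<integral>\<^sup>+x. u x \<partial>N)"
    by (simp add: K_def nn_integral_distr nn_integral_density)
  moreover have "(\<lambda>x. ennreal ((cmod (if x \<in> D then h (L x) else 0))\<^sup>2)) = (\<lambda>x. indicator D x * u (L x))"
    by (auto simp: u_def)
  ultimately show "(\<integral>\<^sup>+x. (cmod (if x \<in> D then h (L x) else 0))\<^sup>2 \<partial>N) \<le> ennreal (of_nat C) * (\<integral>\<^sup>+x. (cmod (h x))\<^sup>2 \<partial>N)"
    by (simp add: u_def ennreal_of_nat_eq_real_of_nat)
  show "(\<lambda>x. if x \<in> D then h (L x) else 0) \<in> borel_measurable N" by measurable
qed auto

section \<open>Commutants\<close>

lemma commutant_iff: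
  assumes "S \<subseteq> bounded_ops N"
  shows "T \<in> commutant N S \<longleftrightarrow> T \<in> bounded_ops N \<and>
    (\<forall>R\<in>S. \<forall>f\<in>sq_integrable N. T (R (L2_class N f)) = R (T (L2_class N f)))"
proof -
  have "compose (L2 N) T R = compose (L2 N) R T \<longleftrightarrow>
    (\<forall>f\<in>sq_integrable N. T (R (L2_class N f)) = R (T (L2_class N f)))" for R
  proof
    assume eq: "compose (L2 N) T R = compose (L2 N) R T"
    show "\<forall>f\<in>sq_integrable N. T (R (L2_class N f)) = R (T (L2_class N f))"
      using fun_cong[OF eq] cls_L2 by (metis compose_eq)
  next
    assume *: "\<forall>f\<in>sq_integrable N. T (R (L2_class N f)) = R (T (L2_class N f))"
    show "compose (L2 N) T R = compose (L2 N) R T"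
    proof
      fix \<xi> show "compose (L2 N) T R \<xi> = compose (L2 N) R T \<xi>"
        using * by (cases "\<xi> \<in> L2 N") (auto simp: compose_def elim: L2_cases)
    qed
  qed
  then show ?thesis unfolding commutant_def by auto
qed

lemma commutant_bounded: "commutant N S \<subseteq> bounded_ops N"
  by (auto simp: commutant_def)

text \<open>Commutants reverse inclusions, so the third commutant is the first one.\<close>

lemma center_bicommutant:
  assumes S: "S \<subseteq> bounded_ops N"
  shows "center N (commutant N (commutant N S)) = commutant N (commutant N S) \<inter> commutant N S"
proof -
  have "S \<subseteq> commutant N (commutant N S)"
    using S unfolding commutant_def by (auto simp: eq_commute)
  then have "commutant N (commutant N (commutant N S)) \<subseteq> commutant N S"
    unfolding commutant_def by blast
  moreover have "commutant N S \<subseteq> commutant N (commutant N (commutant N S))"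
    unfolding commutant_def by (auto simp: eq_commute)
  ultimately show ?thesis unfolding center_def by blast
qed

context measured_groupoid
begin

section \<open>The center of the groupoid von Neumann algebra\<close>

abbreviation "SQ \<equiv> sq_integrable \<nu>"
abbreviation "cls \<equiv> L2_class \<nu>"

section \<open>Left and right translations as operators\<close>

definition lam :: "'g set \<Rightarrow> ('g \<Rightarrow> complex) \<Rightarrow> 'g \<Rightarrow> complex" where
  "lam A h g = (if g \<in> {g \<in> space M. t g \<in> t ` A} then h (ltr A g) else 0)"

text \<open>Unlike in the usual right regular representation, no square root of a Radon-Nikodym
  derivative is included. This keeps \<open>rho E\<close> of an indicator an indicator, at the price
  that boundedness has to come from \<open>bdd_bisection\<close>.\<close>

definition rho :: "'g set \<Rightarrow> ('g \<Rightarrow> complex) \<Rightarrow> 'g \<Rightarrow> complex" where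
  "rho E h g = (if g \<in> {g \<in> space M. s g \<in> t ` E} then h (rtr E g) else 0)"

lemma meas_\<nu>[simp]: "measurable \<nu> N = measurable M N" "measurable N \<nu> = measurable N M"
  by (rule measurable_cong_sets[OF sets_\<nu> refl], rule measurable_cong_sets[OF refl sets_\<nu>])

lemma lam_kernel: assumes A: "borel_bisection G A" shows "L2_kernel \<nu> (lam A)"
proof -
  note [measurable] = t_image_M[OF bisD(1)[OF A]] ltr_meas[OF A]
  have "L2_kernel \<nu> (\<lambda>h g. if g \<in> {g \<in> space M. t g \<in> t ` A} then h (ltr A g) else 0)"
  proof (rule kernel_translation[where C = 1])
    show "{g \<in> space M. t g \<in> t ` A} \<in> sets \<nu>" by simp
    show "ltr A \<in> \<nu> \<rightarrow>\<^sub>M \<nu>" by (simp add: ltr_meas[OF A])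
    show "emeasure \<nu> {x \<in> {g \<in> space M. t g \<in> t ` A}. ltr A x \<in> E} \<le> of_nat 1 * emeasure \<nu> E" if "E \<in> sets \<nu>" for E
      using ltr_emeasure[OF A, of E] that by (simp add: conj_assoc)
  qed
  then show ?thesis by (simp add: lam_def[abs_def])
qed

lemma rho_kernel: assumes E: "bdd_bisection E" shows "L2_kernel \<nu> (rho E)"
proof -
  have B: "borel_bisection G E" using E by (simp add: bdd_bisection_def)
  note [measurable] = t_image_M[OF bisD(1)[OF B]] rtr_meas[OF B]
  obtain C :: nat where C: "\<And>F. F \<in> sets M \<Longrightarrow>
    emeasure \<nu> {g \<in> space M. s g \<in> t ` E \<and> rtr E g \<in> F} \<le> of_nat C * emeasure \<nu> F"
    using rtr_emeasure[OF E] by blast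
  have "L2_kernel \<nu> (\<lambda>h g. if g \<in> {g \<in> space M. s g \<in> t ` E} then h (rtr E g) else 0)"
  proof (rule kernel_translation[where C = C])
    show "{g \<in> space M. s g \<in> t ` E} \<in> sets \<nu>" by simp
    show "rtr E \<in> \<nu> \<rightarrow>\<^sub>M \<nu>" by (simp add: rtr_meas[OF B])
    show "emeasure \<nu> {x \<in> {g \<in> space M. s g \<in> t ` E}. rtr E x \<in> F} \<le> of_nat C * emeasure \<nu> F" if "F \<in> sets \<nu>" for F
      using C[of F] that by (simp add: conj_assoc)
  qed
  then show ?thesis by (simp add: rho_def[abs_def])
qed

lemma lam_indicator:
  assumes A: "borel_bisection G A" and E: "E \<subseteq> carr G"
  shows "lam A (indicator E) = indicator (set_mul G A E)"
  unfolding set_mul_eq[OF A E] by (rule ext) (auto simp add: lam_def indicator_def)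

lemma lambda_op_eq:
  assumes A: "borel_bisection G A"
  shows "lambda_op G \<mu> A = op_of \<nu> (lam A)"
  unfolding lambda_op_def
proof (rule the_equality)
  have eq: "op_of \<nu> (lam A) (cls (indicator E)) = cls (indicator (set_mul G A E))"
    if "E \<in> sets M" "emeasure \<nu> E < \<infinity>" for E
    using op_of_cls[OF lam_kernel[OF A] sq_indicator[of E \<nu>]] lam_indicator[OF A, of E]
      sets.sets_into_space[OF that(1)] that by simp
  then show "op_of \<nu> (lam A) \<in> bounded_ops \<nu> \<and> (\<forall>E\<in>sets M. emeasure \<nu> E < \<infinity> \<longrightarrow>
     op_of \<nu> (lam A) (cls (indicator E)) = cls (indicator (set_mul G A E)))"
    using op_of_bounded[OF lam_kernel[OF A]] by blast
  fix T assume T: "T \<in> bounded_ops \<nu> \<and> (\<forall>E\<in>sets M. emeasure \<nu> E < \<infinity> \<longrightarrow>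
     T (cls (indicator E)) = cls (indicator (set_mul G A E)))"
  show "T = op_of \<nu> (lam A)"
    by (rule bounded_op_eq_on_indicators) (use T eq op_of_bounded[OF lam_kernel[OF A]] in auto)
qed

definition Lam :: "'g L2_op set" where
  "Lam = {lambda_op G \<mu> A |A. borel_bisection G A}"

lemma Lam_bounded: "Lam \<subseteq> bounded_ops \<nu>"
  using lambda_op_eq op_of_bounded[OF lam_kernel] by (auto simp: Lam_def)

lemma center_eq:
  "center \<nu> (groupoid_vN G \<mu>) = commutant \<nu> (commutant \<nu> Lam) \<inter> commutant \<nu> Lam"
  using center_bicommutant[OF Lam_bounded] unfolding groupoid_vN_def Lam_def .

lemma Lam_commutantD:
  assumes "R \<in> commutant \<nu> Lam" "borel_bisection G A" "f \<in> SQ" "k \<in> SQ" "R (cls f) = cls k"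
  shows "R (cls (lam A f)) = cls (lam A k)"
proof -
  have "lambda_op G \<mu> A \<in> Lam" using assms(2) by (auto simp: Lam_def)
  then have "R (lambda_op G \<mu> A (cls f)) = lambda_op G \<mu> A (R (cls f))"
    using assms(1,3) unfolding commutant_iff[OF Lam_bounded] by blast
  then show ?thesis
    using assms(3-5) by (simp add: lambda_op_eq[OF assms(2)] op_of_cls[OF lam_kernel[OF assms(2)]])
qed

lemma Lam_commutantI:
  assumes K: "L2_kernel \<nu> \<Phi>"
    and comm: "\<And>A f. borel_bisection G A \<Longrightarrow> f \<in> SQ \<Longrightarrow> AE g in \<nu>. \<Phi> (lam A f) g = lam A (\<Phi> f) g"
  shows "op_of \<nu> \<Phi> \<in> commutant \<nu> Lam"
  unfolding commutant_iff[OF Lam_bounded]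
proof (intro conjI ballI op_of_bounded[OF K])
  fix R f assume "R \<in> Lam" and f: "f \<in> SQ"
  then obtain A where A: "borel_bisection G A" "R = op_of \<nu> (lam A)" using lambda_op_eq by (auto simp: Lam_def)
  note L = lam_kernel[OF A(1)]
  have "cls (\<Phi> (lam A f)) = cls (lam A (\<Phi> f))"
    using comm[OF A(1) f] f kernel_sq(1)[OF K] kernel_sq(1)[OF L] by (subst cls_eq_iff) auto
  then show "op_of \<nu> \<Phi> (R (cls f)) = R (op_of \<nu> \<Phi> (cls f))"
    using f A(2) kernel_sq(1)[OF K] kernel_sq(1)[OF L] by (simp add: op_of_cls[OF K] op_of_cls[OF L])
qed

lemma ltr_carr:
  assumes "borel_bisection G A" "g \<in> carr G" "t g \<in> t ` A"
  obtains a where "a \<in> A" "a \<in> carr G" "t a = t g" "ltr A g = inv' a \<odot> g" "ltr A g \<in> carr G"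
    "s (ltr A g) = s g" "t (ltr A g) = s a"
proof -
  obtain a where a: "a \<in> A" "t g = t a" using assms by auto
  have "a \<in> carr G" using bisD(4)[OF assms(1) a(1)] .
  then show ?thesis using that[of a] a assms ltr_eq[OF assms(1) a] by simp
qed

lemma rtr_carr:
  assumes "borel_bisection G A" "g \<in> carr G" "s g \<in> t ` A"
  obtains a where "a \<in> A" "a \<in> carr G" "t a = s g" "rtr A g = g \<odot> a" "rtr A g \<in> carr G"
    "s (rtr A g) = s a" "t (rtr A g) = t g"
proof -
  obtain a where a: "a \<in> A" "s g = t a" using assms by auto
  have "a \<in> carr G" using bisD(4)[OF assms(1) a(1)] .
  then show ?thesis using that[of a] a assms rtr_eq[OF assms(1) a] by simp
qed

text \<open>Associativity: multiplying \<open>g\<close> on the left and on the right can be done in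
  either order. Left translation keeps the source and right translation the target, so the two
  domain conditions do not interfere.\<close>

lemma lam_rho:
  assumes A: "borel_bisection G A" and E: "borel_bisection G E" and g: "g \<in> carr G"
  shows "rho E (lam A f) g = lam A (rho E f) g"
proof (cases "t g \<in> t ` A \<and> s g \<in> t ` E")
  case True
  obtain a where a: "a \<in> A" "a \<in> carr G" "t a = t g" "ltr A g = inv' a \<odot> g" "ltr A g \<in> carr G"
    "s (ltr A g) = s g" using ltr_carr[OF A g] True by blast
  obtain e where e: "e \<in> E" "e \<in> carr G" "t e = s g" "rtr E g = g \<odot> e" "rtr E g \<in> carr G"
    "t (rtr E g) = t g" using rtr_carr[OF E g] True by blast
  have "ltr A (rtr E g) = inv' a \<odot> (g \<odot> e)" using a e by (subst ltr_eq[OF A a(1)]) auto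
  also have "\<dots> = inv' a \<odot> g \<odot> e" using a e g by (simp add: mul_assoc)
  also have "\<dots> = rtr E (ltr A g)" using a e by (subst rtr_eq[OF E e(1)]) auto
  finally show ?thesis using True a e g by (simp add: lam_def rho_def)
next
  case False
  then consider "t g \<notin> t ` A" | "s g \<notin> t ` E" by blast
  then show ?thesis
  proof cases
    case 1
    have "rho E (lam A f) g = 0"
    proof (cases "s g \<in> t ` E")
      case True
      have "t (rtr E g) = t g" by (rule rtr_carr[OF E g True])
      then show ?thesis using 1 by (simp add: rho_def lam_def)
    qed (simp add: rho_def)
    then show ?thesis using 1 by (simp add: lam_def)
  next
    case 2
    have "lam A (rho E f) g = 0"
    proof (cases "t g \<in> t ` A")
      case True
      have "s (ltr A g) = s g" by (rule ltr_carr[OF A g True])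
      then show ?thesis using 2 by (simp add: rho_def lam_def)
    qed (simp add: lam_def)
    then show ?thesis using 2 by (simp add: rho_def)
  qed
qed

lemma rho_commutant: "bdd_bisection E \<Longrightarrow> op_of \<nu> (rho E) \<in> commutant \<nu> Lam"
  using lam_rho by (intro Lam_commutantI rho_kernel) (auto simp: bdd_bisection_def)

section \<open>Almost everywhere identities and test functions\<close>

lemma AE_outside:
  assumes "Z \<in> null_sets \<mu>" "\<And>g. g \<in> carr G \<Longrightarrow> s g \<notin> Z \<Longrightarrow> P g"
  shows "AE g in \<nu>. P g"
proof -
  have Z: "Z \<in> sets \<mu>" using assms(1) by auto
  then have m: "{g \<in> space M. s g \<in> Z} \<in> sets M" by measurable
  have "s ` {g \<in> space M. s g \<in> Z} \<in> null_sets \<mu>"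
    by (rule null_sets_subset[OF assms(1) s_image[OF m]]) auto
  then have "{g \<in> space M. s g \<in> Z} \<in> null_sets \<nu>" using m by (simp add: null_s)
  then show ?thesis by (rule AE_I') (use assms(2) in auto)
qed

text \<open>Off a saturated null set of units \<open>P\<close> holds at every arrow, so it can be
  used simultaneously at arrows obtained from each other by multiplication.\<close>

lemma AE_saturated:
  assumes "AE g in \<nu>. P g"
  obtains Z where "Z \<in> null_sets \<mu>" "\<And>g. g \<in> carr G \<Longrightarrow> s g \<notin> Z \<Longrightarrow> P g"
    "\<And>g. g \<in> carr G \<Longrightarrow> s g \<in> Z \<longleftrightarrow> t g \<in> Z"
proof -
  obtain B where B: "{g \<in> space \<nu>. \<not> P g} \<subseteq> B" "emeasure \<nu> B = 0" "B \<in> sets \<nu>"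
    using assms by (rule AE_E)
  then have "B \<in> null_sets \<nu>" by auto
  from null_saturation[OF this] obtain Z where Z: "Z \<in> null_sets \<mu>" "\<And>g. g \<in> B \<Longrightarrow> s g \<in> Z"
    "\<And>g. g \<in> carr G \<Longrightarrow> s g \<in> Z \<longleftrightarrow> t g \<in> Z" by metis
  then show ?thesis using that[of Z] B(1) by auto
qed

lemma units_sq: "indicator (units G) \<in> SQ"
proof (rule sq_indicator)
  have "inj_on s (units G)" by (auto intro: inj_onI simp: s_unit)
  then show "emeasure \<nu> (units G) < \<infinity>"
    using emeasure_\<nu>_le_1[OF units] by (simp add: order_le_less_trans[of _ 1])
qed simp

lemma bis_sq: "borel_bisection G A \<Longrightarrow> indicator A \<in> SQ"
proof (rule sq_indicator)
  assume A: "borel_bisection G A"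
  show "A \<in> sets \<nu>" using bisD(1)[OF A] by simp
  show "emeasure \<nu> A < \<infinity>"
    using emeasure_\<nu>_le_1[OF bisD(1,2)[OF A]] by (simp add: order_le_less_trans[of _ 1])
qed

lemma set_mul_units: "borel_bisection G A \<Longrightarrow> set_mul G A (units G) = A"
proof (intro equalityI subsetI)
  assume A: "borel_bisection G A"
  show "g \<in> A" if "g \<in> set_mul G A (units G)" for g
    using that bisD(4)[OF A] by (auto simp: set_mul_def t_unit)
  show "g \<in> set_mul G A (units G)" if "g \<in> A" for g
    using that bisD(4)[OF A that] unfolding set_mul_def
    by (intro CollectI exI[of _ g] exI[of _ "s g"]) (simp add: t_unit)
qed

lemma lam_units: "borel_bisection G A \<Longrightarrow> lam A (indicator (units G)) = indicator A"
  using lam_indicator[of A "units G"] units_carr set_mul_units by (simp add: subset_iff)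

lemma bis_inv:
  assumes E: "borel_bisection G E"
  shows "borel_bisection G (inv' ` E)"
proof -
  have c: "E \<subseteq> carr G" using bisD(4)[OF E] by blast
  have "inj_on inv' E" by (rule inj_on_inverseI[of _ inv']) (use c in auto)
  then have "inv' ` E \<in> sets M" by (rule inj_image_sets[OF inv_meas bisD(1)[OF E]])
  moreover have "inj_on s (inv' ` E)" "inj_on t (inv' ` E)"
    using bisD(2,3)[OF E] c by (auto simp: inj_on_def subset_iff)
  ultimately show ?thesis by (simp add: borel_bisection_def)
qed

lemma lam_inv:
  assumes E: "borel_bisection G E" and e: "e \<in> E" and g: "g \<in> carr G" "t g = s e"
  shows "lam (inv' ` E) f g = f (e \<odot> g)"
proof -
  have ec: "e \<in> carr G" using bisD(4)[OF E e] .
  then have "t g = t (inv' e)" using g by simp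
  moreover have "t (inv' e) \<in> t ` inv' ` E" using e by blast
  ultimately show ?thesis using ltr_eq[OF bis_inv[OF E], of "inv' e" g] e ec g by (simp add: lam_def)
qed

lemma lam_inv_0:
  assumes E: "borel_bisection G E" and g: "t g \<notin> s ` E"
  shows "lam (inv' ` E) f g = 0"
proof -
  have "t ` inv' ` E = s ` E" using bisD(4)[OF E] by (force simp: image_iff)
  then show ?thesis using g by (simp add: lam_def)
qed

lemma rho_eq:
  assumes E: "borel_bisection G E" and e: "e \<in> E" and g: "g \<in> carr G" "s g = t e"
  shows "rho E f g = f (g \<odot> e)"
  using rtr_eq[OF E e g(2)] e g by (auto simp: rho_def)

text \<open>\<open>g \<odot> e\<close> is a unit exactly if \<open>g\<close> is the inverse of
  \<open>e\<close>. With \<open>lam_units\<close>, a left and a right translate of the indicator of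
  the units become the same function.\<close>

lemma rho_units:
  assumes E: "borel_bisection G E" and g: "g \<in> carr G"
  shows "rho E (indicator (units G)) g = indicator (inv' ` E) g"
proof (cases "s g \<in> t ` E")
  case True
  then obtain e where e: "e \<in> E" "s g = t e" by auto
  have ec: "e \<in> carr G" using bisD(4)[OF E e(1)] .
  have "g \<odot> e \<in> units G \<longleftrightarrow> g \<in> inv' ` E"
  proof
    assume u: "g \<odot> e \<in> units G"
    have "g \<odot> e = s e" using s_unit[OF u] g ec e by simp
    then have "g = s e \<odot> inv' e" using mul_mul_inv[of e g] g ec e by simp
    also have "\<dots> = inv' e" using ec mul_t[of "inv' e"] by simp
    finally show "g \<in> inv' ` E" using e by blast
  next
    assume "g \<in> inv' ` E"
    then obtain e' where e': "e' \<in> E" "g = inv' e'" by blast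
    have "e' \<in> carr G" using bisD(4)[OF E e'(1)] .
    then have "t e' = t e" using e e' by simp
    then have "e' = e" using e e' bisD(3)[OF E] by (auto dest: inj_onD)
    then show "g \<odot> e \<in> units G" using e' ec by simp
  qed
  then show ?thesis using rho_eq[OF E e(1) g e(2)] by (simp add: indicator_def)
next
  case False
  have "g \<notin> inv' ` E"
  proof
    assume "g \<in> inv' ` E"
    then obtain e where e: "e \<in> E" "g = inv' e" by blast
    then have "s g = t e" using bisD(4)[OF E] by simp
    then show False using False e by blast
  qed
  then show ?thesis using False by (simp add: rho_def)
qed

text \<open>A set of finite measure is cut along the pieces, and its finite partial unions converge
  to it under the bound by its own indicator.\<close>

lemma bounded_op_eq_on_bisections:
  assumes T: "T \<in> bounded_ops \<nu>" and T': "T' \<in> bounded_ops \<nu>"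
    and eq: "\<And>A. borel_bisection G A \<Longrightarrow> T (cls (indicator A)) = T' (cls (indicator A))"
  shows "T = T'"
proof (rule bounded_op_eq_on_indicators[OF T T'])
  fix E assume E: "E \<in> sets \<nu>" "emeasure \<nu> E < \<infinity>"
  define A where "A i = E \<inter> piece i" for i
  have A: "borel_bisection G (A i)" for i
    by (rule bis_subset[OF piece_bis]) (use E in \<open>auto simp: A_def\<close>)
  define F where "F n x = (\<Sum>i<n. 1 * (indicator (A i) x :: complex))" for n x
  have dA: "disjoint_family A" using piece_disj by (auto simp: A_def disjoint_family_on_def)
  have F_ind: "F n x = indicator (\<Union>i<n. A i) x" for n x
    unfolding F_def using dA by (subst indicator_UN_disjoint) (auto simp: disjoint_family_on_def)
  have EA: "E = (\<Union>i. A i)" using piece_Un sets.sets_into_space[OF E(1)] by (auto simp: A_def)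
  have Am: "A i \<in> sets M" for i by (rule bisD(1)[OF A])
  show "T (cls (indicator E)) = T' (cls (indicator E))"
  proof (rule op_eq_limit[OF T T', where F = F and w = "indicator E"])
    show "F n \<in> borel_measurable \<nu>" for n unfolding F_def[abs_def] using Am by simp
    show "indicator E \<in> borel_measurable \<nu>" using E by simp
    show "indicator E \<in> SQ" by (rule sq_indicator[OF E])
    show "AE x in \<nu>. cmod (F n x) \<le> cmod (indicator E x)" for n
      unfolding F_ind EA by (auto simp: indicator_def)
    show "AE x in \<nu>. (\<lambda>n. F n x) \<longlonglongrightarrow> indicator E x"
      unfolding F_ind EA by (intro AE_I2 LIMSEQ_indicator_UN)
    fix n
    have "\<exists>k. k \<in> SQ \<and> T (cls (indicator (A i))) = cls k" for i
      using op_cases[OF T bis_sq[OF A]] by metis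
    then obtain k where k: "\<And>i. k i \<in> SQ" "\<And>i. T (cls (indicator (A i))) = cls (k i)" by metis
    have k': "T' (cls (indicator (A i))) = cls (k i)" for i using k(2) eq[OF A] by simp
    have "T (cls (F n)) = cls (\<lambda>x. \<Sum>i<n. 1 * k i x)"
      unfolding F_def[abs_def] by (rule op_sum[OF T finite_lessThan bis_sq[OF A] k])
    moreover have "T' (cls (F n)) = cls (\<lambda>x. \<Sum>i<n. 1 * k i x)"
      unfolding F_def[abs_def] by (rule op_sum[OF T' finite_lessThan bis_sq[OF A] k(1) k'])
    ultimately show "T (cls (F n)) = T' (cls (F n))" by simp
  qed
qed

section \<open>Functions on the unit space as operators\<close>

lemma AE_tgt:
  assumes "AE x in \<mu>. P x"
  shows "AE g in \<nu>. P (t g)"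
proof -
  obtain B where B: "{x \<in> space \<mu>. \<not> P x} \<subseteq> B" "emeasure \<mu> B = 0" "B \<in> sets \<mu>"
    using assms by (rule AE_E)
  note [measurable] = B(3)
  have m: "{g \<in> space M. t g \<in> B} \<in> sets M" by measurable
  have "t ` {g \<in> space M. t g \<in> B} \<in> null_sets \<mu>"
    using B(2,3) by (intro null_sets_subset[OF _ t_image[OF m], of B]) auto
  then have "{g \<in> space M. t g \<in> B} \<in> null_sets \<nu>" using m by (simp add: null_t)
  then show ?thesis by (rule AE_I') (use B(1) in \<open>auto simp: space_\<mu>\<close>)
qed

lemma Linf_kernel:
  assumes f: "f \<in> Linf \<mu>"
  shows "L2_kernel \<nu> (\<lambda>h g. f (t g) * h g)"
proof -
  obtain C where C: "AE x in \<mu>. cmod (f x) \<le> C" and [measurable]: "f \<in> borel_measurable \<mu>"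
    using f by (auto simp: Linf_def)
  have "AE g in \<nu>. cmod (f (t g)) \<le> C" by (rule AE_tgt[OF C])
  moreover have "(\<lambda>g. f (t g)) \<in> borel_measurable \<nu>" by simp
  ultimately show ?thesis by (intro kernel_mult)
qed

lemma Linf_op_eq: "Linf_op G \<mu> f = op_of \<nu> (\<lambda>h g. f (t g) * h g)"
  by (simp add: Linf_op_def op_of_def)

lemma lam_unit_set:
  assumes Y: "Y \<in> sets M" "Y \<subseteq> units G" and g: "g \<in> carr G"
  shows "lam Y h g = indicator Y (t g) * h g"
proof (cases "t g \<in> Y")
  case True
  have "t (t g) = t g" "t g \<in> units G" "t g \<in> carr G" using g units_carr by (auto simp: t_unit)
  moreover have "inv' (t g) \<odot> g = g"
    using inv_mul_cancel[of "t g" g] calculation g by (simp add: s_unit)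
  ultimately have "ltr Y g = g" using ltr_eq[OF bis_units[OF Y] True, of g] by simp
  moreover have "t g \<in> t ` Y" using True \<open>t (t g) = t g\<close> by (metis imageI)
  ultimately show ?thesis using True g by (simp add: lam_def)
next
  case False
  have "t ` Y = Y" using Y(2) by (force simp: t_unit image_iff subset_iff)
  then show ?thesis using False by (simp add: lam_def)
qed

text \<open>If \<open>f\<close> takes finitely many values, multiplication by
  \<open>f \<circ> t\<close> is a combination of the operators \<open>lam (Y y)\<close> for its
  level sets \<open>Y y\<close>, with which \<open>R\<close> commutes. A bounded \<open>f\<close> is
  a limit of such functions.\<close>

lemma Linf_op_bicommutant:
  assumes f: "f \<in> Linf \<mu>" and R: "R \<in> commutant \<nu> Lam" and h: "h \<in> SQ" "k \<in> SQ" "R (cls h) = cls k"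
  shows "R (cls (\<lambda>g. f (t g) * h g)) = cls (\<lambda>g. f (t g) * k g)"
proof -
  have Rb: "R \<in> bounded_ops \<nu>" using R commutant_bounded by blast
  obtain C where C: "AE x in \<mu>. cmod (f x) \<le> C" and [measurable]: "f \<in> borel_measurable \<mu>"
    using f by (auto simp: Linf_def)
  \<comment> \<open>The bound \<open>C\<close> holds almost everywhere, while \<open>f'\<close> is
    bounded everywhere, which bounds the approximating simple functions uniformly. The absolute
    value below covers a negative \<open>C\<close>.\<close>
  define f' where "f' x = (if cmod (f x) \<le> C then f x else 0)" for x
  have f'm[measurable]: "f' \<in> borel_measurable \<mu>" unfolding f'_def[abs_def] by measurable
  obtain F where F: "\<And>i. simple_function \<mu> (F i)" "\<And>x. x \<in> space \<mu> \<Longrightarrow> (\<lambda>i. F i x) \<longlonglongrightarrow> f' x"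
    "\<And>i x. x \<in> space \<mu> \<Longrightarrow> cmod (F i x) \<le> 2 * cmod (f' x)"
    using borel_measurable_implies_sequence_metric[OF f'm, of 0] by simp metis
  have Fm[measurable]: "F i \<in> borel_measurable \<mu>" for i using F(1) by (rule borel_measurable_simple_function)
  have f'C: "cmod (f' x) \<le> \<bar>C\<bar>" for x by (auto simp: f'_def)
  have FC: "cmod (F i x) \<le> 2 * \<bar>C\<bar>" if "x \<in> space \<mu>" for i x using F(3)[OF that, of i] f'C[of x] by linarith
  note [measurable] = sq_meas[OF h(1)] sq_meas[OF h(2)]
  have FC': "cmod (F i (t g) * u g) \<le> cmod (of_real (2 * \<bar>C\<bar>) * u g)" if "g \<in> carr G" for i g u
    using FC[of "t g" i] that unfolding norm_mult by (intro mult_right_mono) (auto simp: space_\<mu>)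
  have step: "R (cls (\<lambda>g. F i (t g) * h g)) = cls (\<lambda>g. F i (t g) * k g)" for i
  proof -
    define Y where "Y y = F i -` {y} \<inter> space \<mu>" for y
    have Y\<mu>: "Y y \<in> sets \<mu>" for y unfolding Y_def using Fm[of i] by measurable
    then have Y: "Y y \<in> sets M" "Y y \<subseteq> units G" for y by (auto simp: sets_\<mu>_iff)
    have B: "borel_bisection G (Y y)" for y using bis_units Y by blast
    note K = kernel_sq(1)[OF lam_kernel[OF B]]
    have fin: "finite (F i ` space \<mu>)" using F(1)[of i] by (simp add: simple_function_def)
    have eq: "F i (t g) * u g = (\<Sum>y\<in>F i ` space \<mu>. y * lam (Y y) u g)" if g: "g \<in> carr G" for g u
    proof -
      have "F i (t g) = (\<Sum>y\<in>F i ` space \<mu>. y * indicator (Y y) (t g))"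
        unfolding Y_def by (rule simple_sum_eq[OF F(1)]) (use g in \<open>simp add: space_\<mu>\<close>)
      then show ?thesis by (simp add: lam_unit_set[OF Y g] sum_distrib_right mult.assoc)
    qed
    have sq: "(\<lambda>g. F i (t g) * u g) \<in> SQ" if u: "u \<in> SQ" for u
    proof (rule sq_integrableI[OF _ u, of _ "2 * \<bar>C\<bar>"])
      note [measurable] = sq_meas[OF u]
      show "(\<lambda>g. F i (t g) * u g) \<in> borel_measurable \<nu>" by simp
      show "AE g in \<nu>. cmod (F i (t g) * u g) \<le> 2 * \<bar>C\<bar> * cmod (u g)"
        using FC' by (auto simp: norm_mult)
    qed
    have cl: "cls (\<lambda>g. F i (t g) * u g) = cls (\<lambda>g. \<Sum>y\<in>F i ` space \<mu>. y * lam (Y y) u g)" if u: "u \<in> SQ" for u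
      using eq u sq[OF u] by (subst cls_eq_iff) (auto intro!: sq_sum sq_scale K)
    show ?thesis unfolding cl[OF h(1)] cl[OF h(2)]
      by (rule op_sum[OF Rb fin K[OF h(1)] K[OF h(2)] Lam_commutantD[OF R B h]])
  qed
  have lim: "R (cls (\<lambda>g. f' (t g) * h g)) = cls (\<lambda>g. f' (t g) * k g)"
  proof (rule op_limit[OF Rb, where h = "\<lambda>i g. F i (t g) * h g" and k = "\<lambda>i g. F i (t g) * k g"])
    show "(\<lambda>x. of_real (2 * \<bar>C\<bar>) * h x) \<in> SQ" "(\<lambda>x. of_real (2 * \<bar>C\<bar>) * k x) \<in> SQ" by (rule sq_scale, fact)+
    show "AE x in \<nu>. cmod (F i (t x) * h x) \<le> cmod (of_real (2 * \<bar>C\<bar>) * h x)" for i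
      by (rule AE_I2) (rule FC', simp)
    show "AE x in \<nu>. cmod (F i (t x) * k x) \<le> cmod (of_real (2 * \<bar>C\<bar>) * k x)" for i
      by (rule AE_I2) (rule FC', simp)
    show "AE x in \<nu>. (\<lambda>i. F i (t x) * h x) \<longlonglongrightarrow> f' (t x) * h x" "AE x in \<nu>. (\<lambda>i. F i (t x) * k x) \<longlonglongrightarrow> f' (t x) * k x"
      by (auto intro!: tendsto_intros F(2) simp: space_\<mu>)
  qed (simp_all add: step)
  have "AE x in \<mu>. f' x = f x" using C by eventually_elim (simp add: f'_def)
  then have ae: "AE g in \<nu>. f' (t g) = f (t g)" by (rule AE_tgt)
  have "cls (\<lambda>g. f' (t g) * u g) = cls (\<lambda>g. f (t g) * u g)" if u: "u \<in> SQ" for u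
  proof -
    note [measurable] = sq_meas[OF u]
    have 1: "(\<lambda>g. f (t g) * u g) \<in> SQ" by (rule kernel_sq(1)[OF Linf_kernel[OF f] u])
    have 2: "(\<lambda>g. f' (t g) * u g) \<in> SQ"
      by (rule sq_integrableI[OF _ 1, of _ 1]) (use ae in \<open>auto elim: eventually_mono\<close>)
    show ?thesis using ae by (subst cls_eq_iff[OF 2 1]) (auto elim: eventually_mono)
  qed
  then show ?thesis using lim h by simp
qed

lemma Linf_inv_subset_center: "Linf_inv G \<mu> \<subseteq> center \<nu> (groupoid_vN G \<mu>)"
proof
  fix T assume "T \<in> Linf_inv G \<mu>"
  then obtain f where f: "f \<in> Linf \<mu>" "AE g in \<nu>. f (t g) = f (s g)" and T: "T = op_of \<nu> (\<lambda>h g. f (t g) * h g)"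
    by (auto simp: Linf_inv_def Linf_op_eq)
  note K = Linf_kernel[OF f(1)]
  obtain Z where Z: "Z \<in> null_sets \<mu>" "\<And>g. g \<in> carr G \<Longrightarrow> s g \<notin> Z \<Longrightarrow> f (t g) = f (s g)"
    "\<And>g. g \<in> carr G \<Longrightarrow> s g \<in> Z \<longleftrightarrow> t g \<in> Z" using AE_saturated[OF f(2)] by metis
  have "T \<in> commutant \<nu> Lam"
    unfolding T
  proof (rule Lam_commutantI[OF K])
    fix A h assume A: "borel_bisection G A"
    show "AE g in \<nu>. f (t g) * lam A h g = lam A (\<lambda>g. f (t g) * h g) g"
    proof (rule AE_outside[OF Z(1)])
      fix g assume g: "g \<in> carr G" "s g \<notin> Z"
      show "f (t g) * lam A h g = lam A (\<lambda>g. f (t g) * h g) g"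
      proof (cases "t g \<in> t ` A")
        case True
        \<comment> \<open>Invariance of \<open>f\<close> is used along \<open>a\<close>, which joins
          the targets of \<open>g\<close> and of its translate. Saturation of \<open>Z\<close> keeps
          \<open>a\<close> outside the exceptional set.\<close>
        obtain a where a: "a \<in> carr G" "t a = t g" "t (ltr A g) = s a"
          using ltr_carr[OF A g(1) True] by metis
        then have "s a \<notin> Z" using Z(3)[OF a(1)] Z(3)[OF g(1)] g(2) by simp
        then have "f (t g) = f (t (ltr A g))" using Z(2)[OF a(1)] a by simp
        then show ?thesis by (simp add: lam_def)
      qed (simp add: lam_def)
    qed
  qed
  moreover have "T \<in> commutant \<nu> (commutant \<nu> Lam)"
    unfolding commutant_iff[OF commutant_bounded]
  proof (intro conjI ballI)
    show "T \<in> bounded_ops \<nu>" unfolding T by (rule op_of_bounded[OF K])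
    fix R h assume R: "R \<in> commutant \<nu> Lam" and h: "h \<in> SQ"
    obtain k where k: "k \<in> SQ" "R (cls h) = cls k"
      using op_cases[OF _ h] R commutant_bounded by blast
    show "T (R (cls h)) = R (T (cls h))"
      unfolding T using k h by (simp add: op_of_cls[OF K] Linf_op_bicommutant[OF f(1) R h k])
  qed
  ultimately show "T \<in> center \<nu> (groupoid_vN G \<mu>)" by (simp add: center_eq)
qed

section \<open>From icc to the center\<close>

lemma bicommutantD:
  assumes T: "T \<in> commutant \<nu> (commutant \<nu> Lam)" and R: "R \<in> commutant \<nu> Lam" and h: "h \<in> SQ"
  shows "T (R (cls h)) = R (T (cls h))"
  using T R h unfolding commutant_iff[OF commutant_bounded] by blast

lemma unit_iff_mul: "g \<in> carr G \<Longrightarrow> a \<in> carr G \<Longrightarrow> t a = t g \<Longrightarrow> inv' a \<odot> g \<in> units G \<Longrightarrow> g = a"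
proof -
  assume a: "g \<in> carr G" "a \<in> carr G" "t a = t g" "inv' a \<odot> g \<in> units G"
  have "inv' a \<odot> g = s a" using t_unit[OF a(4)] a by simp
  then show ?thesis using mul_inv_cancel[of a g] a by simp
qed

lemma icc_imp_center_subset:
  assumes icc: "icc G \<mu>"
  shows "center \<nu> (groupoid_vN G \<mu>) \<subseteq> Linf_inv G \<mu>"
proof
  fix T assume "T \<in> center \<nu> (groupoid_vN G \<mu>)"
  then have T1: "T \<in> commutant \<nu> (commutant \<nu> Lam)" and T2: "T \<in> commutant \<nu> Lam"
    by (simp_all add: center_eq)
  have Tb: "T \<in> bounded_ops \<nu>" using T2 commutant_bounded by blast
  obtain \<xi> where \<xi>: "\<xi> \<in> SQ" "T (cls (indicator (units G))) = cls \<xi>"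
    using op_cases[OF Tb units_sq] .
  note [measurable] = sq_meas[OF \<xi>(1)]
  \<comment> \<open>Both sides represent \<open>T\<close> applied to the indicator of \<open>E\<^sup>-\<^sup>1\<close>.\<close>
  have lam_rho_\<xi>: "AE g in \<nu>. lam (inv' ` E) \<xi> g = rho E \<xi> g" if E: "bdd_bisection E" for E
  proof -
    have B: "borel_bisection G E" using E by (simp add: bdd_bisection_def)
    note L = lam_kernel[OF bis_inv[OF B]] and K = rho_kernel[OF E]
    have "cls (lam (inv' ` E) \<xi>) = T (cls (lam (inv' ` E) (indicator (units G))))"
      by (rule Lam_commutantD[OF T2 bis_inv[OF B] units_sq \<xi>, symmetric])
    also have "lam (inv' ` E) (indicator (units G)) = indicator (inv' ` E)" by (rule lam_units[OF bis_inv[OF B]])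
    also have "cls (indicator (inv' ` E)) = cls (rho E (indicator (units G)))"
      using rho_units[OF B] kernel_sq(1)[OF K units_sq] bis_sq[OF bis_inv[OF B]] by (subst cls_eq_iff) auto
    also have "T \<dots> = T (op_of \<nu> (rho E) (cls (indicator (units G))))" by (simp add: op_of_cls[OF K units_sq])
    also have "\<dots> = op_of \<nu> (rho E) (T (cls (indicator (units G))))"
      by (rule bicommutantD[OF T1 rho_commutant[OF E] units_sq])
    also have "\<dots> = cls (rho E \<xi>)" using \<xi> by (simp add: op_of_cls[OF K])
    finally show ?thesis using kernel_sq(1)[OF L \<xi>(1)] kernel_sq(1)[OF K \<xi>(1)] by (simp add: cls_eq_iff)
  qed
  obtain E :: "nat \<Rightarrow> 'g set" where E: "\<And>n. bdd_bisection (E n)" "carr G - (\<Union>n. E n) \<in> null_sets \<nu>"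
    using bdd_bisection_cover by metis
  have EB: "borel_bisection G (E n)" for n using E(1) by (simp add: bdd_bisection_def)
  obtain V :: "nat \<Rightarrow> 'g set" where V: "\<And>n. V n \<in> sets M"
    and sep: "\<And>x y. x \<in> space M \<Longrightarrow> y \<in> space M \<Longrightarrow> x \<noteq> y \<Longrightarrow> \<exists>n. x \<in> V n \<and> y \<notin> V n"
    using standard_borel_separating[OF std] by metis
  \<comment> \<open>For a set of units, the left translate of \<open>\<xi>\<close> cuts it down by a
    condition on \<open>t g\<close> and the right translate by the same condition on
    \<open>s g\<close>. Since the \<open>V n\<close> separate points, equality of the translates
    forces \<open>s g = t g\<close> wherever \<open>\<xi>\<close> is nonzero, off a null
    set.\<close>
  define Y where "Y n = V n \<inter> units G" for n
  have Y: "Y n \<in> sets M" "Y n \<subseteq> units G" for n using V by (auto simp: Y_def)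
  have YB: "borel_bisection G (Y n)" for n using bis_units Y by blast
  have "AE g in \<nu>. g \<in> (\<Union>n. E n)" by (rule AE_I'[OF E(2)]) auto
  moreover have "AE g in \<nu>. \<forall>n. lam (inv' ` E n) \<xi> g = rho (E n) \<xi> g"
    unfolding AE_all_countable using lam_rho_\<xi>[OF E(1)] by blast
  moreover have "AE g in \<nu>. \<forall>n. lam (inv' ` Y n) \<xi> g = rho (Y n) \<xi> g"
    unfolding AE_all_countable using lam_rho_\<xi>[OF bdd_bisection_units[OF Y]] by blast
  ultimately have "AE g in \<nu>. g \<in> (\<Union>n. E n) \<and> (\<forall>n. lam (inv' ` E n) \<xi> g = rho (E n) \<xi> g) \<and>
    (\<forall>n. lam (inv' ` Y n) \<xi> g = rho (Y n) \<xi> g)" by eventually_elim simp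
  then obtain Z where Z: "Z \<in> null_sets \<mu>" "\<And>g. g \<in> carr G \<Longrightarrow> s g \<notin> Z \<Longrightarrow>
      g \<in> (\<Union>n. E n) \<and> (\<forall>n. lam (inv' ` E n) \<xi> g = rho (E n) \<xi> g) \<and>
      (\<forall>n. lam (inv' ` Y n) \<xi> g = rho (Y n) \<xi> g)"
    "\<And>g. g \<in> carr G \<Longrightarrow> s g \<in> Z \<longleftrightarrow> t g \<in> Z" by (rule AE_saturated) blast
  have Zm[measurable]: "Z \<in> sets \<mu>" using Z(1) by auto
  have supp_Iso: "g \<in> Iso G" if g: "g \<in> carr G" "s g \<notin> Z" "\<xi> g \<noteq> 0" for g
  proof (rule ccontr)
    assume "g \<notin> Iso G"
    then have ne: "s g \<noteq> t g" using g by (simp add: Iso_def)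
    have u: "s g \<in> units G" "t g \<in> units G" "s g \<in> carr G" "t g \<in> carr G" using g units_carr by auto
    then obtain n where n: "s g \<in> V n" "t g \<notin> V n" using sep[of "s g" "t g"] ne by blast
    have "s ` Y n = Y n" using Y(2)[of n] by (force simp: s_unit image_iff subset_iff)
    then have "lam (inv' ` Y n) \<xi> g = 0" using lam_inv_0[OF YB, of g n] n by (simp add: Y_def)
    moreover have "rho (Y n) \<xi> g = \<xi> (g \<odot> s g)"
      by (rule rho_eq[OF YB]) (use g n u in \<open>auto simp: Y_def t_unit\<close>)
    ultimately show False using Z(2)[OF g(1,2)] g by simp
  qed
  have conj_inv: "\<xi> (cj e h) = \<xi> h" if h: "h \<in> Iso G" "e \<in> carr G" "s e = t h" "s h \<notin> Z" for e h
  proof -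
    note hh = IsoD[OF h(1)]
    \<comment> \<open>At this \<open>g\<close> the equality of left and right translates of \<open>\<xi>\<close> compares \<open>e h e\<^sup>-\<^sup>1\<close> with \<open>h\<close>.\<close>
    define g where "g = h \<odot> inv' e"
    have g: "g \<in> carr G" "s g = t e" "t g = s e" using hh h by (simp_all add: g_def)
    have "s e \<notin> Z" using h hh by simp
    then obtain n where n: "e \<in> E n" using Z(2)[OF h(2)] by blast
    have "s g \<notin> Z" using Z(3)[OF h(2)] \<open>s e \<notin> Z\<close> g by simp
    then have "lam (inv' ` E n) \<xi> g = rho (E n) \<xi> g" using Z(2)[OF g(1)] by blast
    moreover have "lam (inv' ` E n) \<xi> g = \<xi> (e \<odot> g)" by (rule lam_inv[OF EB n g(1,3)])
    moreover have "rho (E n) \<xi> g = \<xi> (g \<odot> e)" by (rule rho_eq[OF EB n g(1,2)])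
    moreover have "e \<odot> g = cj e h" using h hh by (simp add: g_def cj_def mul_assoc)
    moreover have "g \<odot> e = h" using h hh mul_inv_mul[of e h] by (simp add: g_def)
    ultimately show ?thesis by simp
  qed
  have level_null: "{h \<in> space M. h \<in> Iso G \<and> \<epsilon> < cmod (\<xi> h) \<and> s h \<notin> Z} - units G \<in> null_sets \<nu>"
    (is "?A - _ \<in> _") if \<epsilon>: "\<epsilon> > 0" for \<epsilon> :: real
  proof -
    have \<xi>M[measurable]: "\<xi> \<in> borel_measurable M" using sq_meas[OF \<xi>(1)] by simp
    have Am[measurable]: "?A \<in> sets M" by measurable
    \<comment> \<open>Chebyshev's inequality for the integrable function
      \<open>(cmod (\<xi> h))\<^sup>2\<close>.\<close>
    have "emeasure \<nu> ?A < \<infinity>"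
    proof -
      have "integrable \<nu> (\<lambda>h. (\<epsilon>\<^sup>2) * indicator ?A h :: real)"
      proof (rule Bochner_Integration.integrable_bound[OF sq_int[OF \<xi>(1)]])
        show "(\<lambda>h. (\<epsilon>\<^sup>2) * indicator ?A h :: real) \<in> borel_measurable \<nu>" using Am by simp
        show "AE h in \<nu>. norm (\<epsilon>\<^sup>2 * indicator ?A h :: real) \<le> norm ((cmod (\<xi> h))\<^sup>2)"
          using \<epsilon> by (auto simp: indicator_def intro!: power_mono)
      qed
      then have "integrable \<nu> (\<lambda>h. indicator ?A h :: real)" using \<epsilon> by simp
      then show ?thesis using Am by (simp add: integrable_indicator_iff less_top)
    qed
    \<comment> \<open>The icc condition concerns bisections, so \<open>?A\<close> is cut along the
      pieces. The conditions defining \<open>?A\<close> are invariant under conjugation, so the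
      class of each part stays in \<open>?A\<close> and has finite measure.\<close>
    have "(?A - units G) \<inter> piece m \<in> null_sets \<nu>" for m
    proof -
      let ?B = "(?A - units G) \<inter> piece m"
      have Bm: "?B \<in> sets M" by measurable
      then have Bb: "borel_bisection G ?B" by (rule bis_subset[OF piece_bis]) auto
      have BI: "?B \<subseteq> Iso G" by auto
      have "conj_class G ?B \<subseteq> ?A"
      proof
        fix h assume "h \<in> conj_class G ?B"
        then obtain g a where g: "h = cj g a" "a \<in> ?B" "g \<in> carr G" "s g = t a"
          unfolding conj_class_eq[OF BI] by blast
        then have a: "a \<in> Iso G" "s a \<notin> Z" "\<epsilon> < cmod (\<xi> a)" by auto
        note c = cj_Iso[OF a(1) g(3,4)]
        have "s a = s g" using g IsoD(2)[OF a(1)] by simp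
        then have "s (cj g a) \<notin> Z" using c(2) a(2) Z(3)[OF g(3)] by simp
        then show "h \<in> ?A" using c(1) IsoD(1)[OF c(1)] conj_inv[OF a(1) g(3,4) a(2)] a(3) g(1) by simp
      qed
      then have "emeasure \<nu> (conj_class G ?B) \<le> emeasure \<nu> ?A"
        by (rule emeasure_mono) (use Am in simp)
      then have "emeasure \<nu> (conj_class G ?B) < \<infinity>"
        using \<open>emeasure \<nu> ?A < \<infinity>\<close> by (rule le_less_trans)
      then have *: "0 < emeasure \<nu> ?B \<Longrightarrow> ?B - units G \<in> null_sets \<nu>"
        using icc[unfolded icc_def, rule_format, OF Bb BI] by simp
      have "?B - units G = ?B" by blast
      with * have "0 < emeasure \<nu> ?B \<Longrightarrow> ?B \<in> null_sets \<nu>" by (simp only:)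
      moreover have "emeasure \<nu> ?B = 0 \<Longrightarrow> ?B \<in> null_sets \<nu>"
        by (rule null_setsI) (use Bm in \<open>simp_all only: sets_\<nu>\<close>)
      ultimately show ?thesis by (meson not_gr_zero)
    qed
    then have "(\<Union>m. (?A - units G) \<inter> piece m) \<in> null_sets \<nu>" by (intro null_sets_UN) auto
    moreover have "(\<Union>m. (?A - units G) \<inter> piece m) = ?A - units G" using piece_Un by auto
    ultimately show ?thesis by simp
  qed
  have "(\<Union>n::nat. {h \<in> space M. h \<in> Iso G \<and> 1 / Suc n < cmod (\<xi> h) \<and> s h \<notin> Z} - units G) \<in> null_sets \<nu>"
    by (intro null_sets_UN level_null) simp
  then obtain Z' where Z': "Z' \<in> null_sets \<mu>" "\<And>g n. g \<in> {h \<in> space M. h \<in> Iso G \<and> 1 / Suc n < cmod (\<xi> h) \<and> s h \<notin> Z} - units G \<Longrightarrow> s g \<in> Z'"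
    "\<And>g. g \<in> carr G \<Longrightarrow> s g \<in> Z' \<longleftrightarrow> t g \<in> Z'" by (rule null_saturation) blast
  define Z'' where "Z'' = Z \<union> Z'"
  have Z'': "Z'' \<in> null_sets \<mu>" "\<And>g. g \<in> carr G \<Longrightarrow> s g \<in> Z'' \<longleftrightarrow> t g \<in> Z''"
    using Z Z' by (auto simp: Z''_def)
  have supp: "g \<in> units G" if g: "g \<in> carr G" "s g \<notin> Z''" "\<xi> g \<noteq> 0" for g
  proof (rule ccontr)
    assume nu: "g \<notin> units G"
    have "g \<in> Iso G" using supp_Iso g by (simp add: Z''_def)
    moreover obtain n where "1 / real (Suc n) < cmod (\<xi> g)" using g(3) by (meson nat_approx_posE zero_less_norm_iff)
    ultimately show False using Z'(2)[of g n] g nu by (simp add: Z''_def)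
  qed
  have inv: "\<xi> (t g) = \<xi> (s g)" if g: "g \<in> carr G" "s g \<notin> Z''" for g
  proof -
    have u: "s g \<in> units G" "s g \<in> carr G" using g units_carr by auto
    then have "s g \<in> Iso G" by (simp add: Iso_def s_unit t_unit)
    then have "\<xi> (cj g (s g)) = \<xi> (s g)"
      by (rule conj_inv) (use g u in \<open>auto simp: s_unit t_unit Z''_def\<close>)
    then show ?thesis using g by (simp add: cj_def)
  qed
  \<comment> \<open>The value on the left is that of \<open>\<xi>\<close> at
    \<open>inv' a \<odot> g\<close> for some \<open>a\<close> in \<open>A\<close>. It can be nonzero
    only if this product is a unit, which means \<open>a = g\<close>; then it is the value at
    \<open>s g\<close>, equal to that at \<open>t g\<close>.\<close>
  have lam_\<xi>: "lam A \<xi> g = \<xi> (t g) * indicator A g"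
    if A: "borel_bisection G A" and g: "g \<in> carr G" "s g \<notin> Z''" for A g
  proof (cases "t g \<in> t ` A")
    case True
    obtain a where a: "a \<in> A" "a \<in> carr G" "t a = t g" "ltr A g = inv' a \<odot> g" "ltr A g \<in> carr G"
      "s (ltr A g) = s g" using ltr_carr[OF A g(1) True] by metis
    show ?thesis
    proof (cases "g \<in> A")
      case ga: True
      then have "a = g" using a bisD(3)[OF A] by (auto dest: inj_onD)
      then show ?thesis using a ga inv[OF g] g True by (simp add: lam_def)
    next
      case False
      then have "ltr A g \<notin> units G" using unit_iff_mul[OF g(1) a(2,3)] a by metis
      then have "\<xi> (ltr A g) = 0" using supp[OF a(5)] a g by auto
      then show ?thesis using False by (simp add: lam_def)
    qed
  next
    case False
    then have "g \<notin> A" by blast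
    then show ?thesis using False by (simp add: lam_def)
  qed
  have \<xi>m: "\<xi> \<in> borel_measurable \<mu>"
  proof -
    have "\<xi> \<in> borel_measurable M" using sq_meas[OF \<xi>(1)] by simp
    then have "\<xi> \<in> borel_measurable (restrict_space M (units G))" by (rule measurable_restrict_space1)
    then show ?thesis by (simp add: measurable_cong_sets[OF sets_\<mu> refl])
  qed
  have T_ind: "\<exists>k. k \<in> SQ \<and> T (cls (indicator A)) = cls k \<and> (AE g in \<nu>. k g = \<xi> (t g) * indicator A g)"
    if A: "borel_bisection G A" for A
  proof (intro exI[of _ "lam A \<xi>"] conjI)
    show "lam A \<xi> \<in> SQ" by (rule kernel_sq(1)[OF lam_kernel[OF A] \<xi>(1)])
    show "T (cls (indicator A)) = cls (lam A \<xi>)"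
      using Lam_commutantD[OF T2 A units_sq \<xi>] by (simp add: lam_units[OF A])
    show "AE g in \<nu>. lam A \<xi> g = \<xi> (t g) * indicator A g" by (rule AE_outside[OF Z''(1)]) (rule lam_\<xi>[OF A])
  qed
  have bdd: "\<exists>C. AE x in \<mu>. cmod (\<xi> x) \<le> C"
  proof -
    obtain C where C: "\<And>h k. h \<in> SQ \<Longrightarrow> k \<in> SQ \<Longrightarrow> T (cls h) = cls k \<Longrightarrow> sqn \<nu> k \<le> C * sqn \<nu> h"
      using op_bound[OF Tb] by blast
    \<comment> \<open>\<open>C\<close> bounds \<open>T\<close> in squared norms. Tested on the
      indicator of \<open>Q\<close>, it makes the integral of \<open>w\<close> nonpositive although
      \<open>w\<close> is nonnegative almost everywhere and positive on \<open>Q\<close>, so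
      \<open>Q\<close> is null and \<open>sqrt C\<close> bounds \<open>\<xi>\<close>.\<close>
    define Q where "Q = {x \<in> space \<mu>. C < (cmod (\<xi> x))\<^sup>2}"
    have "Q \<in> sets \<mu>" unfolding Q_def using \<xi>m by measurable
    then have Q: "Q \<in> sets M" "Q \<subseteq> units G" by (auto simp: sets_\<mu>_iff)
    note B = bis_units[OF Q]
    obtain k where k: "k \<in> SQ" "T (cls (indicator Q)) = cls k" "AE g in \<nu>. k g = \<xi> (t g) * indicator Q g"
      using T_ind[OF B] by blast
    have le: "sqn \<nu> k \<le> C * sqn \<nu> (indicator Q)" by (rule C[OF bis_sq[OF B] k(1,2)])
    define w where "w g = (cmod (k g))\<^sup>2 - C * (cmod (indicator Q g))\<^sup>2" for g
    have wi: "integrable \<nu> w" unfolding w_def[abs_def]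
      by (intro Bochner_Integration.integrable_diff integrable_mult_right sq_int k bis_sq[OF B])
    have w: "AE g in \<nu>. 0 \<le> w g \<and> (g \<in> Q \<longrightarrow> 0 < w g)" using k(3) AE_space
    proof eventually_elim
      case (elim g)
      then show ?case using Q(2) by (auto simp: w_def Q_def indicator_def t_unit)
    qed
    have "integral\<^sup>L \<nu> w = sqn \<nu> k - C * sqn \<nu> (indicator Q)"
      unfolding w_def[abs_def] sqn_def
      by (subst Bochner_Integration.integral_diff) (auto intro: sq_int k bis_sq[OF B] integrable_mult_right)
    then have "integral\<^sup>L \<nu> w \<le> 0" using le by simp
    moreover have "0 \<le> integral\<^sup>L \<nu> w" using w by (intro integral_nonneg_AE) auto
    ultimately have "integral\<^sup>L \<nu> w = 0" by simp
    then have "AE g in \<nu>. w g = 0" using w by (subst (asm) integral_nonneg_eq_0_iff_AE[OF wi]) auto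
    then have "AE g in \<nu>. g \<notin> Q" using w by eventually_elim auto
    then have "Q \<in> null_sets \<nu>" using Q sets_carr[OF Q(1)] by (subst (asm) AE_iff_null) (auto simp: Collect_conj_eq Int_absorb1 subset_iff)
    moreover have "s ` Q = Q" using Q(2) by (force simp: s_unit image_iff subset_iff)
    ultimately have "Q \<in> null_sets \<mu>" by (simp add: null_s)
    then have "AE x in \<mu>. (cmod (\<xi> x))\<^sup>2 \<le> C"
      by (rule AE_I') (auto simp: Q_def)
    then have "AE x in \<mu>. cmod (\<xi> x) \<le> sqrt C" by eventually_elim (simp add: real_le_rsqrt)
    then show ?thesis by blast
  qed
  then have Linf: "\<xi> \<in> Linf \<mu>" using \<xi>m by (simp add: Linf_def)
  have "T = Linf_op G \<mu> \<xi>"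
  proof (rule bounded_op_eq_on_bisections[OF Tb])
    show "Linf_op G \<mu> \<xi> \<in> bounded_ops \<nu>" unfolding Linf_op_eq by (rule op_of_bounded[OF Linf_kernel[OF Linf]])
    fix A assume A: "borel_bisection G A"
    obtain k where k: "k \<in> SQ" "T (cls (indicator A)) = cls k" "AE g in \<nu>. k g = \<xi> (t g) * indicator A g"
      using T_ind[OF A] by blast
    then show "T (cls (indicator A)) = Linf_op G \<mu> \<xi> (cls (indicator A))"
      using kernel_sq(1)[OF Linf_kernel[OF Linf] bis_sq[OF A]]
      by (simp add: Linf_op_eq op_of_cls[OF Linf_kernel[OF Linf] bis_sq[OF A]] cls_eq_iff)
  qed
  moreover have "AE g in \<nu>. \<xi> (t g) = \<xi> (s g)" by (rule AE_outside[OF Z''(1)]) (rule inv)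
  ultimately show "T \<in> Linf_inv G \<mu>" using Linf unfolding Linf_inv_def by blast
qed

text \<open>The set \<open>B j\<close> collects the \<open>j\<close>-th element of every fibre, ordered by the index of its piece.\<close>

lemma bisection_decomposition:
  assumes K: "K \<in> sets M" "K \<subseteq> Iso G" and fin: "\<And>h. h \<in> K \<Longrightarrow> cnt s K (s h) \<le> of_nat n"
  obtains B where "\<And>j. borel_bisection G (B j)" "disjoint_family B" "(\<Union>j<n. B j) = K"
proof -
  define idx where "idx h = (THE m. h \<in> piece m)" for h
  have idx: "idx h = m" if "h \<in> piece m" for h m
    unfolding idx_def
  proof (rule the_equality)
    show "m' = m" if "h \<in> piece m'" for m'
      using that \<open>h \<in> piece m\<close> piece_disj by (auto simp: disjoint_family_on_def)
  qed fact
  have idx_in: "h \<in> piece (idx h)" if "h \<in> K" for h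
    using piece_ex[OF sets_carr[OF K(1) that]] idx by metis
  \<comment> \<open>Indices of the earlier pieces that meet \<open>K\<close> over \<open>x\<close>.
    A piece has at most one element in each source fibre, so their number ranks the elements of a
    fibre.\<close>
  define occ where "occ x m = {i. i < m \<and> x \<in> s ` (K \<inter> piece i)}" for x m
  have fin_occ: "finite (occ x m)" for x m by (simp add: occ_def)
  define rk where "rk h = card (occ (s h) (idx h))" for h
  define B where "B j = {h \<in> K. rk h = j}" for j
  have inj: "h = h'" if h: "h \<in> K" "h' \<in> K" "s h = s h'" "rk h = rk h'" for h h'
  proof -
    \<comment> \<open>A smaller index gives a smaller rank, as the index of \<open>h\<close> is
      itself counted for \<open>h'\<close>. Equal ranks in a fibre thus force the same piece, where
      \<open>s\<close> is injective.\<close>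
    have less: False if h: "h \<in> K" "h' \<in> K" "s h = s h'" "rk h = rk h'" and "idx h < idx h'" for h h'
    proof -
      have "occ (s h) (idx h) \<subseteq> occ (s h') (idx h')" using that by (auto simp: occ_def)
      moreover have "idx h \<in> occ (s h') (idx h')" 
      proof -
        have "s h' \<in> s ` (K \<inter> piece (idx h))" using h(1) idx_in[OF h(1)] by (simp add: h(3)[symmetric])
        then show ?thesis using that(5) by (simp add: occ_def)
      qed
      moreover have "idx h \<notin> occ (s h) (idx h)" by (simp add: occ_def)
      ultimately have "rk h < rk h'" unfolding rk_def by (intro psubset_card_mono fin_occ) blast
      then show False using h by simp
    qed
    then have "idx h = idx h'" using less[of h h'] less[of h' h] h by (metis linorder_neqE_nat)
    then show ?thesis using idx_in[OF h(1)] idx_in[OF h(2)] piece_inj_s h(3) by (auto dest: inj_onD)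
  qed
  have rk_less: "rk h < n" if h: "h \<in> K" for h
  proof -
    let ?F = "{h' \<in> K. s h' = s h}"
    have c: "emeasure (count_space UNIV) ?F \<le> of_nat n" using fin[OF h] by (simp add: cnt_def)
    have f: "finite ?F"
    proof (rule ccontr)
      assume "infinite ?F"
      then have "emeasure (count_space UNIV) ?F = \<infinity>" by (simp add: emeasure_count_space_infinite)
      then show False using c by (simp add: top_unique)
    qed
    then have cn: "card ?F \<le> n" using c by simp
    \<comment> \<open>The earlier indices together with that of \<open>h\<close> are
      \<open>Suc (rk h)\<close> indices coming from a fibre of at most \<open>n\<close> elements, so
      the ranks are strictly below \<open>n\<close>.\<close>
    have "insert (idx h) (occ (s h) (idx h)) \<subseteq> idx ` ?F"
    proof
      fix i assume "i \<in> insert (idx h) (occ (s h) (idx h))"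
      then consider "i = idx h" | h' where "h' \<in> K" "h' \<in> piece i" "s h = s h'" by (auto simp: occ_def)
      then show "i \<in> idx ` ?F"
      proof cases
        case 2
        then show ?thesis using idx[OF 2(2)] by force
      qed (use h in auto)
    qed
    then have "card (insert (idx h) (occ (s h) (idx h))) \<le> card (idx ` ?F)" using f by (intro card_mono) auto
    also have "\<dots> \<le> card ?F" using f by (rule card_image_le)
    finally have "card (insert (idx h) (occ (s h) (idx h))) \<le> n" using cn by simp
    moreover have "card (insert (idx h) (occ (s h) (idx h))) = Suc (rk h)"
      unfolding rk_def by (subst card_insert_disjoint[OF fin_occ]) (simp_all add: occ_def)
    ultimately show ?thesis by simp
  qed
  have Bm: "B j \<in> sets M" for j
  proof -
    have Ym[measurable]: "s ` (K \<inter> piece i) \<in> sets M" for i using K by (intro s_image_M) auto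
    note [measurable] = K(1)
    \<comment> \<open>As a finite sum of indicators of Borel sets, the rank is visibly Borel on each
      piece.\<close>
    have occ_sum: "real (card (occ (s h) m)) = (\<Sum>i<m. indicator (s ` (K \<inter> piece i)) (s h))" for h m
    proof -
      have "occ (s h) m = {..<m} \<inter> {i. s h \<in> s ` (K \<inter> piece i)}" by (auto simp: occ_def)
      then show ?thesis by (simp add: indicator_def sum.If_cases)
    qed
    have "B j = (\<Union>m. {h \<in> space M. h \<in> K \<and> h \<in> piece m \<and> (\<Sum>i<m. indicator (s ` (K \<inter> piece i)) (s h)) = real j})"
    proof (intro equalityI subsetI)
      fix h assume h: "h \<in> B j"
      then have "h \<in> {h \<in> space M. h \<in> K \<and> h \<in> piece (idx h) \<and> (\<Sum>i<idx h. indicator (s ` (K \<inter> piece i)) (s h)) = real j}"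
        using idx_in sets_carr[OF K(1)] by (auto simp: B_def rk_def occ_sum[symmetric])
      then show "h \<in> (\<Union>m. {h \<in> space M. h \<in> K \<and> h \<in> piece m \<and> (\<Sum>i<m. indicator (s ` (K \<inter> piece i)) (s h)) = real j})" by blast
    next
      fix h assume "h \<in> (\<Union>m. {h \<in> space M. h \<in> K \<and> h \<in> piece m \<and> (\<Sum>i<m. indicator (s ` (K \<inter> piece i)) (s h)) = real j})"
      then obtain m where m: "h \<in> K" "h \<in> piece m" "(\<Sum>i<m. indicator (s ` (K \<inter> piece i)) (s h)) = real j" by blast
      then show "h \<in> B j" using idx[OF m(2)] unfolding B_def rk_def by (simp add: occ_sum[symmetric])
    qed
    also have "\<dots> \<in> sets M" by measurable
    finally show ?thesis .
  qed
  have "inj_on s (B j)" "inj_on t (B j)" for j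
  proof -
    show "inj_on s (B j)" using inj by (auto simp: inj_on_def B_def)
    then show "inj_on t (B j)" using K(2) IsoD(2) unfolding inj_on_def B_def by (metis (mono_tags, lifting) mem_Collect_eq subsetD)
  qed
  then have "borel_bisection G (B j)" for j using Bm by (simp add: borel_bisection_def)
  moreover have "disjoint_family B" by (auto simp: disjoint_family_on_def B_def)
  moreover have "(\<Union>j<n. B j) = K" using rk_less by (auto simp: B_def)
  ultimately show ?thesis using that by blast
qed

section \<open>From the center to icc\<close>

lemma center_imp_icc:
  assumes eq: "center \<nu> (groupoid_vN G \<mu>) = Linf_inv G \<mu>"
  shows "icc G \<mu>"
  unfolding icc_def
proof (intro allI impI, rule ccontr)
  fix A0 assume A0: "borel_bisection G A0" "A0 \<subseteq> Iso G" "emeasure \<nu> (conj_class G A0) < \<infinity>"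
    and not_null: "A0 - units G \<notin> null_sets \<nu>"
  \<comment> \<open>Units are removed before forming the class: only units are conjugate to units,
    so the class of \<open>A\<close> contains none.\<close>
  define A where "A = A0 - units G"
  have A: "A \<in> sets M" "A \<subseteq> Iso G" using bisD(1)[OF A0(1)] A0(2) by (auto simp: A_def)
  define \<Omega> where "\<Omega> = conj_class G A"
  have \<Omega>m[measurable]: "\<Omega> \<in> sets M" unfolding \<Omega>_def by (rule conj_class_sets[OF A])
  have \<Omega>I: "\<Omega> \<subseteq> Iso G" unfolding \<Omega>_def by (rule conj_class_Iso[OF A(2)])
  have \<Omega>inv: "cj g h \<in> \<Omega>" if "h \<in> \<Omega>" "g \<in> carr G" "s g = t h" for g h
    using conj_class_invariant[OF A(2)] that unfolding \<Omega>_def by blast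
  have \<Omega>units: "h \<notin> units G" if h: "h \<in> \<Omega>" for h
  proof
    assume u: "h \<in> units G"
    obtain g a where g: "h = cj g a" "a \<in> A" "g \<in> carr G" "s g = t a"
      using h unfolding \<Omega>_def conj_class_eq[OF A(2)] by blast
    have a: "a \<in> Iso G" using g A by auto
    note c = cj_Iso[OF a g(3,4)]
    have "h = t g" using c(3) g(1) t_unit[OF u] by simp
    then have "a = inv' g \<odot> t g \<odot> inv' (inv' g)" using c(4) g(1) by (simp add: cj_def)
    also have "\<dots> = s g" using g(3) mul_s[of "inv' g"] by simp
    finally show False using g(2,3) by (auto simp: A_def)
  qed
  have "A \<subseteq> \<Omega>" unfolding \<Omega>_def by (rule conj_class_super[OF A(2)])
  then have \<Omega>_not_null: "\<Omega> \<notin> null_sets \<nu>" using not_null A(1) null_sets_subset[of \<Omega> \<nu> A] by (auto simp: A_def)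
  have "\<Omega> \<subseteq> conj_class G A0" unfolding \<Omega>_def conj_class_def by (auto simp: A_def)
  moreover have "conj_class G A0 \<in> sets \<nu>" using conj_class_sets[OF bisD(1)[OF A0(1)] A0(2)] by simp
  ultimately have "emeasure \<nu> \<Omega> \<le> emeasure \<nu> (conj_class G A0)" by (rule emeasure_mono)
  then have "emeasure \<nu> \<Omega> \<noteq> \<infinity>" using A0(3) by auto
  then have "(\<integral>\<^sup>+x. cnt s \<Omega> x \<partial>\<mu>) \<noteq> \<infinity>" by (simp add: emeasure_\<nu>[OF \<Omega>m])
  then have fin: "AE x in \<mu>. cnt s \<Omega> x \<noteq> \<infinity>" by (intro nn_integral_noteq_infinite) simp_all
  \<comment> \<open>The fibres of \<open>\<Omega>\<close> are finite almost everywhere, so these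
    truncations exhaust it up to a null set, and one of them is not null.\<close>
  define K where "K n = {h \<in> \<Omega>. cnt s \<Omega> (s h) \<le> of_nat n}" for n :: nat
  have Km: "K n \<in> sets M" for n
  proof -
    have "K n = \<Omega> \<inter> {h \<in> space M. cnt s \<Omega> (s h) \<le> of_nat n}" using sets_carr[OF \<Omega>m] by (auto simp: K_def)
    also have "\<dots> \<in> sets M" by measurable
    finally show ?thesis .
  qed
  have "\<exists>n. K n \<notin> null_sets \<nu>"
  proof (rule ccontr)
    assume "\<not> ?thesis"
    then have "(\<Union>n. K n) \<in> null_sets \<nu>" by (intro null_sets_UN) auto
    moreover have "\<Omega> - (\<Union>n. K n) \<in> null_sets \<nu>"
    proof -
      have m: "\<Omega> - (\<Union>n. K n) \<in> sets M" using Km by auto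
      have "{x \<in> space \<mu>. cnt s \<Omega> x = \<infinity>} \<in> null_sets \<mu>" using fin by (subst (asm) AE_iff_null) auto
      moreover have "s ` (\<Omega> - (\<Union>n. K n)) \<subseteq> {x \<in> space \<mu>. cnt s \<Omega> x = \<infinity>}"
      proof
        fix x assume "x \<in> s ` (\<Omega> - (\<Union>n. K n))"
        then obtain g where g: "x = s g" "g \<in> \<Omega>" "\<And>n. g \<notin> K n" by blast
        have "cnt s \<Omega> x = \<infinity>"
        proof (rule ccontr)
          assume "cnt s \<Omega> x \<noteq> \<infinity>"
          then obtain n where "cnt s \<Omega> x < of_nat n" using ennreal_Ex_less_of_nat by (auto simp: less_top)
          then have "cnt s \<Omega> (s g) \<le> of_nat n" using g(1) by simp
          then show False using g(2) g(3)[of n] by (simp add: K_def)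
        qed
        then show "x \<in> {x \<in> space \<mu>. cnt s \<Omega> x = \<infinity>}" using g sets_carr[OF \<Omega>m] by (simp add: space_\<mu>)
      qed
      ultimately have "s ` (\<Omega> - (\<Union>n. K n)) \<in> null_sets \<mu>" using s_image[OF m] null_sets_subset by blast
      then show ?thesis using m by (simp add: null_s)
    qed
    ultimately have "(\<Union>n. K n) \<union> (\<Omega> - (\<Union>n. K n)) \<in> null_sets \<nu>" by (rule null_sets.Un)
    moreover have "(\<Union>n. K n) \<union> (\<Omega> - (\<Union>n. K n)) = \<Omega>" by (auto simp: K_def)
    ultimately show False using \<Omega>_not_null by simp
  qed
  then obtain n where Kn: "K n \<notin> null_sets \<nu>" by blast
  have KI: "K n \<subseteq> Iso G" using \<Omega>I by (auto simp: K_def)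
  have Kinv: "cj g h \<in> K n" if h: "h \<in> K n" "g \<in> carr G" "s g = t h" for g h
  proof -
    have hh: "h \<in> \<Omega>" "h \<in> Iso G" using h KI by (auto simp: K_def)
    have "s (cj g h) = t g" by (rule cj_Iso(2)[OF hh(2) h(2,3)])
    moreover have "cnt s \<Omega> (s g) = cnt s \<Omega> (t g)"
      by (rule cnt_conj_invariant[OF \<Omega>I _ h(2)]) (rule \<Omega>inv)
    ultimately have "cnt s \<Omega> (s (cj g h)) = cnt s \<Omega> (s h)"
      unfolding IsoD(2)[OF hh(2)] h(3) by simp
    then show ?thesis using h(1) \<Omega>inv[OF hh(1) h(2,3)] by (simp add: K_def)
  qed
  have Kfin: "cnt s (K n) (s h) \<le> of_nat n" if "h \<in> K n" for h
  proof -
    have "cnt s (K n) (s h) \<le> cnt s \<Omega> (s h)" unfolding cnt_def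
      by (rule emeasure_mono) (auto simp: K_def)
    then show ?thesis using that by (auto simp: K_def)
  qed
  obtain B where B: "\<And>j. borel_bisection G (B j)" "disjoint_family B" "(\<Union>j<n. B j) = K n"
    using bisection_decomposition[OF Km KI Kfin] by metis
  define \<Phi> where "\<Phi> h g = (\<Sum>j<n. lam (B j) h g)" for h g
  have \<Phi>K: "L2_kernel \<nu> \<Phi>" unfolding \<Phi>_def[abs_def] by (rule kernel_sum[OF lam_kernel[OF B(1)]])
  define T where "T = op_of \<nu> \<Phi>"
  define J where "J x = {j. j < n \<and> x \<in> t ` B j}" for x
  have BK: "B j \<subseteq> K n" if "j < n" for j using B(3) that by blast
  \<comment> \<open>The \<open>B j\<close> need not be invariant under conjugation, but
    \<open>K n\<close> is. This form forgets the decomposition, so the invariance can be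
    used.\<close>
  have \<Phi>_eq: "\<Phi> h g = (\<Sum>a\<in>{a \<in> K n. t a = t g}. h (inv' a \<odot> g))" if g: "g \<in> carr G" for h g
  proof -
    have "\<Phi> h g = (\<Sum>j\<in>J (t g). lam (B j) h g)" unfolding \<Phi>_def
      by (rule sum.mono_neutral_right) (auto simp: J_def lam_def)
    also have "\<dots> = (\<Sum>a\<in>{a \<in> K n. t a = t g}. h (inv' a \<odot> g))"
    proof (rule sum.reindex_bij_witness[where j = "\<lambda>j. sect (B j) (t g)" and i = "\<lambda>a. THE j. a \<in> B j"])
      have the: "(THE j. a \<in> B j) = j" if "a \<in> B j" for a j
        using that B(2) by (intro the_equality) (auto simp: disjoint_family_on_def)
      fix j assume "j \<in> J (t g)"
      then have j: "j < n" "t g \<in> t ` B j" by (auto simp: J_def)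
      note S = sect_in[OF B(1) j(2)]
      show "(THE j'. sect (B j) (t g) \<in> B j') = j" by (rule the[OF S(1)])
      show "sect (B j) (t g) \<in> {a \<in> K n. t a = t g}" using S BK[OF j(1)] by blast
      show "h (inv' (sect (B j) (t g)) \<odot> g) = lam (B j) h g" using j(2) g by (simp add: lam_def ltr_def)
    next
      have the: "(THE j. a \<in> B j) = j" if "a \<in> B j" for a j
        using that B(2) by (intro the_equality) (auto simp: disjoint_family_on_def)
      fix a assume "a \<in> {a \<in> K n. t a = t g}"
      then have a: "a \<in> K n" "t a = t g" by auto
      then obtain j where j: "j < n" "a \<in> B j" using B(3) by blast
      show "sect (B (THE j. a \<in> B j)) (t g) = a" unfolding the[OF j(2)] using sect_eq[OF B(1) j(2)] a by simp
      show "(THE j. a \<in> B j) \<in> J (t g)" unfolding the[OF j(2)] J_def using j a by (metis (mono_tags, lifting) imageI mem_Collect_eq)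
    qed
    finally show ?thesis .
  qed
  have comm: "\<Phi> (lam D f) g = lam D (\<Phi> f) g" if D: "borel_bisection G D" and g: "g \<in> carr G" for D f g
  proof (cases "t g \<in> t ` D")
    case False
    have "lam D f (inv' a \<odot> g) = 0" if "a \<in> K n" "t a = t g" for a
    proof -
      have "a \<in> carr G" "s a = t a" using that KI IsoD by blast+
      then have "t (inv' a \<odot> g) = t g" using that g by simp
      then show ?thesis using False by (simp add: lam_def)
    qed
    then have "\<Phi> (lam D f) g = 0" unfolding \<Phi>_eq[OF g] by (intro sum.neutral) auto
    then show ?thesis using False by (simp add: lam_def)
  next
    case True
    obtain d where d: "d \<in> D" "d \<in> carr G" "t d = t g" "ltr D g = inv' d \<odot> g" "ltr D g \<in> carr G"
      "t (ltr D g) = s d" using ltr_carr[OF D g True] by metis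
    have "\<Phi> (lam D f) g = (\<Sum>a\<in>{a \<in> K n. t a = t g}. lam D f (inv' a \<odot> g))" by (rule \<Phi>_eq[OF g])
    \<comment> \<open>Conjugation by the inverse of \<open>d\<close> is a bijection between the
      fibres of \<open>K n\<close> over \<open>t g\<close> and over \<open>s d\<close>.\<close>
    also have "\<dots> = (\<Sum>b\<in>{b \<in> K n. t b = s d}. f (inv' b \<odot> (inv' d \<odot> g)))"
    proof (rule sum.reindex_bij_witness[where j = "cj (inv' d)" and i = "cj d"])
      fix a assume "a \<in> {a \<in> K n. t a = t g}"
      then have a: "a \<in> K n" "t a = t g" "a \<in> Iso G" "a \<in> carr G" "s a = t a" using KI IsoD by auto
      have sd: "s (inv' d) = t a" using d a by simp
      note c = cj_Iso[OF a(3) inv_carr[OF d(2)] sd]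
      show "cj d (cj (inv' d) a) = a" using c(4) d(2) by simp
      show "cj (inv' d) a \<in> {b \<in> K n. t b = s d}" using Kinv[OF a(1) inv_carr[OF d(2)] sd] c(3) d(2) by simp
      define b where "b = cj (inv' d) a"
      have b: "b \<in> carr G" "t b = s d" "s b = s d" using IsoD(1)[OF c(1)] c(2,3) d(2) by (simp_all add: b_def)
      have ba: "d \<odot> b = a \<odot> d" using d a unfolding b_def cj_def by (simp add: mul_assoc)
      have ia: "inv' a \<odot> g \<in> carr G" "t (inv' a \<odot> g) = t d" using a g d by auto
      have "lam D f (inv' a \<odot> g) = f (inv' d \<odot> (inv' a \<odot> g))"
        using ltr_eq[OF D d(1) ia(2)] ia d(1) by (auto simp: lam_def)
      \<comment> \<open>The relation \<open>d \<odot> b = a \<odot> d\<close> with both factors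
        moved to the other side by cancellation.\<close>
      moreover have "inv' d \<odot> (inv' a \<odot> g) = inv' b \<odot> (inv' d \<odot> g)"
      proof -
        let ?x = "inv' d \<odot> (inv' a \<odot> g)"
        have x: "?x \<in> carr G" "t ?x = s d" using ia d by auto
        have "d \<odot> (b \<odot> ?x) = a \<odot> (d \<odot> ?x)"
          using ba b d a x mul_assoc[of d b ?x] mul_assoc[of a d ?x] by simp
        also have "d \<odot> ?x = inv' a \<odot> g" using ia d by simp
        also have "a \<odot> (inv' a \<odot> g) = g" using a g by simp
        finally have "inv' d \<odot> (d \<odot> (b \<odot> ?x)) = inv' d \<odot> g" by simp
        then have "b \<odot> ?x = inv' d \<odot> g" using b d x by simp
        then have "inv' b \<odot> (b \<odot> ?x) = inv' b \<odot> (inv' d \<odot> g)" by simp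
        then show ?thesis using b x by simp
      qed
      ultimately show "f (inv' (cj (inv' d) a) \<odot> (inv' d \<odot> g)) = lam D f (inv' a \<odot> g)" by (simp add: b_def)
    next
      fix b assume "b \<in> {b \<in> K n. t b = s d}"
      then have b: "b \<in> K n" "t b = s d" "b \<in> Iso G" using KI by auto
      note c = cj_Iso[OF b(3) d(2) b(2)[symmetric]]
      show "cj (inv' d) (cj d b) = b" by (rule c(4))
      show "cj d b \<in> {a \<in> K n. t a = t g}" using Kinv[OF b(1) d(2) b(2)[symmetric]] c(3) d(3) by simp
    qed
    also have "\<dots> = \<Phi> f (ltr D g)" using \<Phi>_eq[OF d(5), of f] d(4,6) by simp
    also have "\<dots> = lam D (\<Phi> f) g" using True g by (simp add: lam_def)
    finally show ?thesis .
  qed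
  have T1: "T \<in> commutant \<nu> Lam" unfolding T_def
    by (rule Lam_commutantI[OF \<Phi>K]) (rule AE_I2, simp add: comm)
  have T2: "T \<in> commutant \<nu> (commutant \<nu> Lam)"
    unfolding commutant_iff[OF commutant_bounded]
  proof (intro conjI ballI)
    show "T \<in> bounded_ops \<nu>" unfolding T_def by (rule op_of_bounded[OF \<Phi>K])
    fix R h assume R: "R \<in> commutant \<nu> Lam" and h: "h \<in> SQ"
    have Rb: "R \<in> bounded_ops \<nu>" using R commutant_bounded by blast
    obtain k where k: "k \<in> SQ" "R (cls h) = cls k" using op_cases[OF Rb h] .
    have "R (cls (\<lambda>g. \<Sum>j<n. 1 * lam (B j) h g)) = cls (\<lambda>g. \<Sum>j<n. 1 * lam (B j) k g)"
      by (rule op_sum[OF Rb finite_lessThan kernel_sq(1)[OF lam_kernel[OF B(1)] h]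
         kernel_sq(1)[OF lam_kernel[OF B(1)] k(1)] Lam_commutantD[OF R B(1) h k]])
    then have "R (cls (\<Phi> h)) = cls (\<Phi> k)" by (simp add: \<Phi>_def[abs_def])
    then show "T (R (cls h)) = R (T (cls h))" using k h by (simp add: T_def op_of_cls[OF \<Phi>K])
  qed
  have "T \<in> Linf_inv G \<mu>" using T1 T2 eq unfolding center_eq by blast
  then obtain f where f: "f \<in> Linf \<mu>" "T = op_of \<nu> (\<lambda>h g. f (t g) * h g)"
    by (auto simp: Linf_inv_def Linf_op_eq)
  note FK = Linf_kernel[OF f(1)]
  \<comment> \<open>Evaluation at the indicator of the units separates the two kinds of operators:
    convolution yields the indicator of \<open>K n\<close>, multiplication a function supported on
    the units, and \<open>K n\<close> contains no unit.\<close>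
  have "cls (\<Phi> (indicator (units G))) = cls (\<lambda>g. f (t g) * indicator (units G) g)"
    using f(2) op_of_cls[OF \<Phi>K units_sq] op_of_cls[OF FK units_sq] by (simp add: T_def)
  then have "AE g in \<nu>. \<Phi> (indicator (units G)) g = f (t g) * indicator (units G) g"
    using kernel_sq(1)[OF \<Phi>K units_sq] kernel_sq(1)[OF FK units_sq] by (simp add: cls_eq_iff)
  moreover have "\<Phi> (indicator (units G)) g = indicator (K n) g" for g
  proof -
    have "\<Phi> (indicator (units G)) g = (\<Sum>j<n. indicator (B j) g)" by (simp add: \<Phi>_def lam_units[OF B(1)])
    also have "\<dots> = indicator (\<Union>j<n. B j) g"
      using B(2) by (subst indicator_UN_disjoint) (auto simp: disjoint_family_on_def)
    finally show ?thesis unfolding B(3) .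
  qed
  ultimately have "AE g in \<nu>. indicator (K n) g = f (t g) * indicator (units G) g" by simp
  then have "AE g in \<nu>. g \<notin> K n"
  proof eventually_elim
    case (elim g)
    then show ?case using \<Omega>units[of g] by (auto simp: K_def)
  qed
  then have "{g \<in> space \<nu>. \<not> g \<notin> K n} \<in> null_sets \<nu>" using Km by (subst (asm) AE_iff_null) auto
  moreover have "{g \<in> space \<nu>. \<not> g \<notin> K n} = K n" using sets_carr[OF Km] by auto
  ultimately show False using Kn by simp
qed

end

theorem theorem1:
  fixes G :: "'g groupoid" and \<mu> :: "'g measure"
  assumes "discrete_measured_groupoid G \<mu>"
  shows "icc G \<mu> \<longleftrightarrow> center (mu_s G \<mu>) (groupoid_vN G \<mu>) = Linf_inv G \<mu>"
proof -
  interpret measured_groupoid G \<mu> by unfold_locales (rule assms)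
  show ?thesis
    using icc_imp_center_subset Linf_inv_subset_center center_imp_icc by blast
qed

end
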